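(* Let $\mathcal{H}$ be a nonzero complex Hilbert space with a countable orthonormal basis and let $A,B$ be bounded linear operators on $\mathcal{H}$. (a) $\frac{1}{\sqrt{2}}\sup_{\vec{x}\in\mathcal{H},\,\|\vec{x}\|=1}\|A\vec{x}\|\,\|B\vec{x}\| \leq \|A\odot B\|$, and this inequality is sharp (that is, equality holds for some choice of $\mathcal{H}$ and of nonzero $A,B$ on it). (b) If $A\neq 0$ and $B\neq 0$, then $A\odot B\neq 0$. (c) For every integer $n\geq 1$, $\rho(A^{\odot n})=\rho(A)^n$, where $\rho(T):=\sup\{|\lambda| : \lambda\in\sigma(T)\}$ denotes the spectral radius.
   Context: Let $\mathcal{H}^{\otimes n}$ denote the Hilbert-space tensor power: the completion of the span of simple tensors $\vec{u}_1\otimes\cdots\otimes\vec{u}_n$ with respect to the inner product determined by $\langle \vec{u}_1\otimes\cdots\otimes\vec{u}_n,\vec{v}_1\otimes\cdots\otimes\vec{v}_n\rangle=\prod_{i}\langle\vec{u}_i,\vec{v}_i\rangle$. Let $\Sigma_n$ be the group of permutations of $\{1,\ldots,n\}$; for $\pi\in\Sigma_n$ let $\hat\pi$ be the unitary operator on $\mathcal{H}^{\otimes n}$ determined by $\hat\pi(\vec{u}_1\otimes\cdots\otimes\vec{u}_n)=\vec{u}_{\pi(1)}\otimes\cdots\otimes\vec{u}_{\pi(n)}$. The symmetric tensor power is the closed subspace $\mathcal{H}^{\odot n}=\{\vec{v}\in\mathcal{H}^{\otimes n}:\hat\pi\vec{v}=\vec{v}\text{ for all }\pi\in\Sigma_n\}$.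 For bounded operators $A_1,\ldots,A_n$ on $\mathcal{H}$, $A_1\otimes\cdots\otimes A_n$ is the bounded operator on $\mathcal{H}^{\otimes n}$ with $(A_1\otimes\cdots\otimes A_n)(\vec{v}_1\otimes\cdots\otimes\vec{v}_n)=A_1\vec{v}_1\otimes\cdots\otimes A_n\vec{v}_n$. The symmetric tensor product $A_1\odot\cdots\odot A_n$ is the restriction of $\frac{1}{n!}\sum_{\pi\in\Sigma_n}A_{\pi(1)}\otimes\cdots\otimes A_{\pi(n)}$ to $\mathcal{H}^{\odot n}$, which is invariant under it, regarded as an operator on $\mathcal{H}^{\odot n}$. $A^{\odot n}$ denotes $A\odot\cdots\odot A$ ($n$ factors), and $\sigma(T)$ denotes the spectrum of $T$. *)

theory Defs
  imports "HOL-Analysis.Analysis" "HOL-Library.Function_Algebras" "HOL-Combinatorics.Permutations"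
begin

section \<open>Complex Hilbert spaces with explicit carriers\<close>

text \<open>A Hilbert space is a subspace \<open>carrier H\<close> of an ambient complex vector space
  (the whole type, with scalar multiplication \<open>smult H\<close>), together with an inner product on that
  subspace. Explicit carriers are needed because the symmetric tensor powers are subspaces
  depending on a number \<open>n\<close>. The inner product is conjugate-linear in its first and linear in
  its second argument.\<close>

record 'a hilb =
  carrier :: "'a set"
  smult :: "complex \<Rightarrow> 'a \<Rightarrow> 'a"
  cinner :: "'a \<Rightarrow> 'a \<Rightarrow> complex"

definition hnorm :: "'a hilb \<Rightarrow> 'a \<Rightarrow> real" where
  "hnorm H x = sqrt (Re (cinner H x x))"

text \<open>The value outside the carrier only serves the library locale \<open>Metric_space\<close>, which asks for
  a non-negative symmetric distance function on the whole type.\<close>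

definition hdist :: "'a::ab_group_add hilb \<Rightarrow> 'a \<Rightarrow> 'a \<Rightarrow> real" where
  "hdist H x y = (if x \<in> carrier H \<and> y \<in> carrier H then hnorm H (x - y) else 0)"

locale hilbert_space = vector_space "smult H" for H :: "'a::ab_group_add hilb" +
  assumes subspace_carrier: "subspace (carrier H)"
    and cinner_add_right:
      "\<lbrakk>x \<in> carrier H; y \<in> carrier H; z \<in> carrier H\<rbrakk>
        \<Longrightarrow> cinner H x (y + z) = cinner H x y + cinner H x z"
    and cinner_smult_right:
      "\<lbrakk>x \<in> carrier H; y \<in> carrier H\<rbrakk> \<Longrightarrow> cinner H x (smult H c y) = c * cinner H x y"
    and cinner_commute:
      "\<lbrakk>x \<in> carrier H; y \<in> carrier H\<rbrakk> \<Longrightarrow> cinner H x y = cnj (cinner H y x)"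
    and cinner_pos: "\<lbrakk>x \<in> carrier H; x \<noteq> 0\<rbrakk> \<Longrightarrow> 0 < Re (cinner H x x)"
    and complete: "Metric_space.mcomplete (carrier H) (hdist H)"

definition hclosure :: "'a::ab_group_add hilb \<Rightarrow> 'a set \<Rightarrow> 'a set" where
  "hclosure H S = Metric_space.mtopology (carrier H) (hdist H) closure_of S"

definition orthonormal_basis :: "'a::ab_group_add hilb \<Rightarrow> 'a set \<Rightarrow> bool" where
  "orthonormal_basis H E \<longleftrightarrow>
     E \<subseteq> carrier H \<and>
     (\<forall>e\<in>E. \<forall>f\<in>E. cinner H e f = (if e = f then 1 else 0)) \<and>
     hclosure H (module.span (smult H) E) = carrier H"

definition separable_hilbert_space :: "'a::ab_group_add hilb \<Rightarrow> bool" where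
  "separable_hilbert_space H \<longleftrightarrow>
     hilbert_space H \<and> (\<exists>E. countable E \<and> orthonormal_basis H E)"


section \<open>Bounded operators\<close>

text \<open>An operator on \<open>H\<close> is a function on the type of which only the values on the carrier
  matter.\<close>

definition bounded_operator :: "'a::ab_group_add hilb \<Rightarrow> ('a \<Rightarrow> 'a) \<Rightarrow> bool" where
  "bounded_operator H A \<longleftrightarrow>
     (\<forall>x\<in>carrier H. A x \<in> carrier H) \<and>
     (\<forall>x\<in>carrier H. \<forall>y\<in>carrier H. A (x + y) = A x + A y) \<and>
     (\<forall>c. \<forall>x\<in>carrier H. A (smult H c x) = smult H c (A x)) \<and>
     (\<exists>K. \<forall>x\<in>carrier H. hnorm H (A x) \<le> K * hnorm H x)"

definition nonzero_operator :: "'a::ab_group_add hilb \<Rightarrow> ('a \<Rightarrow> 'a) \<Rightarrow> bool" where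
  "nonzero_operator H A \<longleftrightarrow> (\<exists>x\<in>carrier H. A x \<noteq> 0)"

definition op_norm :: "'a::ab_group_add hilb \<Rightarrow> ('a \<Rightarrow> 'a) \<Rightarrow> real" where
  "op_norm H A = (SUP x\<in>{x \<in> carrier H. hnorm H x \<le> 1}. hnorm H (A x))"

definition unitary_operator :: "'a::ab_group_add hilb \<Rightarrow> ('a \<Rightarrow> 'a) \<Rightarrow> bool" where
  "unitary_operator H U \<longleftrightarrow>
     bounded_operator H U \<and> U ` carrier H = carrier H \<and>
     (\<forall>x\<in>carrier H. \<forall>y\<in>carrier H. cinner H (U x) (U y) = cinner H x y)"

definition spectrum :: "'a::ab_group_add hilb \<Rightarrow> ('a \<Rightarrow> 'a) \<Rightarrow> complex set" where
  "spectrum H A =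
     {l. \<not> (\<exists>R. bounded_operator H R \<and>
               (\<forall>x\<in>carrier H. R (A x - smult H l x) = x \<and> A (R x) - smult H l (R x) = x))}"

definition spectral_radius :: "'a::ab_group_add hilb \<Rightarrow> ('a \<Rightarrow> 'a) \<Rightarrow> real" where
  "spectral_radius H A = (SUP l\<in>spectrum H A. cmod l)"


section \<open>Tensor powers\<close>

text \<open>An \<open>n\<close>-tuple of vectors is a function \<open>u\<close> with \<open>u i \<in> carrier H\<close> for \<open>i \<in> {1..n}\<close>; its other
  values are irrelevant.\<close>

abbreviation tuples :: "'a hilb \<Rightarrow> nat \<Rightarrow> (nat \<Rightarrow> 'a) set" where
  "tuples H n \<equiv> {1..n} \<rightarrow> carrier H"

text \<open>\<open>T\<close> is a completion of the span of the simple tensors \<open>t u\<close> with respect to the inner product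
  determined by the product formula. Multilinearity of \<open>t\<close> follows from that formula, since the
  inner product of \<open>T\<close> is definite.\<close>

definition is_tensor_power ::
  "'a::ab_group_add hilb \<Rightarrow> nat \<Rightarrow> 'b::ab_group_add hilb \<Rightarrow> ((nat \<Rightarrow> 'a) \<Rightarrow> 'b) \<Rightarrow> bool" where
  "is_tensor_power H n T t \<longleftrightarrow>
     hilbert_space T \<and>
     (\<forall>u\<in>tuples H n. t u \<in> carrier T) \<and>
     (\<forall>u\<in>tuples H n. \<forall>v\<in>tuples H n. cinner T (t u) (t v) = (\<Prod>i=1..n. cinner H (u i) (v i))) \<and>
     hclosure T (module.span (smult T) (t ` tuples H n)) = carrier T"

text \<open>The completion is determined only up to a unique unitary compatible with simple tensors, so one
  model is chosen. The type \<open>(nat \<Rightarrow> 'a) \<Rightarrow> complex\<close> is large enough to contain one: for an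
  orthonormal basis \<open>E\<close> of \<open>H\<close>, take the square-summable functions supported on the
  \<open>n\<close>-tuples \<open>e\<close> of elements of \<open>E\<close>, the simple tensor of \<open>u\<close> being the function
  \<open>e \<mapsto> (\<Prod>i=1..n. cinner H (e i) (u i))\<close>.\<close>

definition tensor_model ::
  "'a::ab_group_add hilb \<Rightarrow> nat \<Rightarrow>
    ((nat \<Rightarrow> 'a) \<Rightarrow> complex) hilb \<times> ((nat \<Rightarrow> 'a) \<Rightarrow> (nat \<Rightarrow> 'a) \<Rightarrow> complex)" where
  "tensor_model H n = (SOME (T, t). is_tensor_power H n T t)"

definition tensor_power ::
  "'a::ab_group_add hilb \<Rightarrow> nat \<Rightarrow> ((nat \<Rightarrow> 'a) \<Rightarrow> complex) hilb" where
  "tensor_power H n = fst (tensor_model H n)"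

definition simple_tensor ::
  "'a::ab_group_add hilb \<Rightarrow> nat \<Rightarrow> (nat \<Rightarrow> 'a) \<Rightarrow> (nat \<Rightarrow> 'a) \<Rightarrow> complex" where
  "simple_tensor H n = snd (tensor_model H n)"

text \<open>Below, \<open>extensional\<close> makes the operators unique as functions on the whole type.\<close>

definition perm_operator ::
  "'a::ab_group_add hilb \<Rightarrow> nat \<Rightarrow> (nat \<Rightarrow> nat) \<Rightarrow>
    ((nat \<Rightarrow> 'a) \<Rightarrow> complex) \<Rightarrow> (nat \<Rightarrow> 'a) \<Rightarrow> complex" where
  "perm_operator H n p =
     (THE U. U \<in> extensional (carrier (tensor_power H n)) \<and>
             unitary_operator (tensor_power H n) U \<and>
             (\<forall>u\<in>tuples H n. U (simple_tensor H n u) = simple_tensor H n (\<lambda>i. u (p i))))"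

definition sym_tensor_power ::
  "'a::ab_group_add hilb \<Rightarrow> nat \<Rightarrow> ((nat \<Rightarrow> 'a) \<Rightarrow> complex) hilb" where
  "sym_tensor_power H n =
     (tensor_power H n)\<lparr>carrier :=
        {v \<in> carrier (tensor_power H n). \<forall>p. p permutes {1..n} \<longrightarrow> perm_operator H n p v = v}\<rparr>"

definition tensor_operator ::
  "'a::ab_group_add hilb \<Rightarrow> nat \<Rightarrow> (nat \<Rightarrow> 'a \<Rightarrow> 'a) \<Rightarrow>
    ((nat \<Rightarrow> 'a) \<Rightarrow> complex) \<Rightarrow> (nat \<Rightarrow> 'a) \<Rightarrow> complex" where
  "tensor_operator H n A =
     (THE S. S \<in> extensional (carrier (tensor_power H n)) \<and>
             bounded_operator (tensor_power H n) S \<and>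
             (\<forall>u\<in>tuples H n. S (simple_tensor H n u) = simple_tensor H n (\<lambda>i. A i (u i))))"

definition sym_tensor_operator ::
  "'a::ab_group_add hilb \<Rightarrow> nat \<Rightarrow> (nat \<Rightarrow> 'a \<Rightarrow> 'a) \<Rightarrow>
    ((nat \<Rightarrow> 'a) \<Rightarrow> complex) \<Rightarrow> (nat \<Rightarrow> 'a) \<Rightarrow> complex" where
  "sym_tensor_operator H n A =
     (\<lambda>v\<in>carrier (sym_tensor_power H n).
        smult (tensor_power H n) (1 / fact n)
          (\<Sum>p | p permutes {1..n}. tensor_operator H n (\<lambda>i. A (p i)) v))"

definition sym_tensor_operator2 ::
  "'a::ab_group_add hilb \<Rightarrow> ('a \<Rightarrow> 'a) \<Rightarrow> ('a \<Rightarrow> 'a) \<Rightarrow>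
    ((nat \<Rightarrow> 'a) \<Rightarrow> complex) \<Rightarrow> (nat \<Rightarrow> 'a) \<Rightarrow> complex" where
  "sym_tensor_operator2 H A B = sym_tensor_operator H 2 (\<lambda>i. if i = 1 then A else B)"

end

theory Submission
  imports Defs
begin

text \<open>Applied to \<open>x \<otimes> x\<close>, the operator \<open>A \<odot> B\<close> gives half the sum of \<open>A x \<otimes> B x\<close> and \<open>B x \<otimes> A x\<close>, two
  vectors of norm \<open>\<parallel>A x\<parallel> \<parallel>B x\<parallel>\<close> with the non-negative inner product \<open>\<bar>\<langle>A x, B x\<rangle>\<bar>\<^sup>2\<close>. This proves (a), where
  \<open>A = \<langle>e, \<cdot>\<rangle> e\<close> and \<open>B = \<langle>e, \<cdot>\<rangle> f\<close> with \<open>e\<close>, \<open>f\<close> orthonormal attain equality. It also proves (b): if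
  \<open>A \<odot> B = 0\<close> then every \<open>x\<close> lies in \<open>ker A\<close> or \<open>ker B\<close>, and a vector space is not the union of two
  proper subspaces. For (c), the spectral radius of \<open>T\<close> is the infimum of the numbers \<open>r\<close> such that
  \<open>\<parallel>T\<^sup>k\<parallel> \<le> C r\<^sup>k\<close> for all \<open>k\<close> and some \<open>C\<close> (a form of Gelfand's formula, obtained by averaging
  resolvents over roots of unity instead of by complex analysis), and the powers of \<open>A\<close> and of its
  \<open>n\<close>-th symmetric tensor power satisfy \<open>\<parallel>(A\<^sup>k)\<^sup>\<odot>\<^sup>n\<parallel> = \<parallel>A\<^sup>k\<parallel>\<^sup>n\<close>.\<close>

section \<open>Inner products and Parseval's identity\<close>

text \<open>The tensor power and the operators on it are given by descriptions (\<open>SOME\<close>,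
  \<open>THE\<close>), so existence and uniqueness come before any computation; afterwards only the
  product formula and the density of simple tensors are used, and even homogeneity in the slots is
  recovered from the formula. The obstacle is the existence of
  \<open>A\<^sub>1 \<otimes> ... \<otimes> A\<^sub>n\<close>: simple tensors are linearly dependent,
  and prescribing values on them is consistent only because of a norm estimate for all finite
  combinations. The squared norm of a combination is a quadratic form in a product of Gram kernels,
  hence the positive semidefinite kernels. The same estimate gives the upper bound for powers in
  (c); the lower bound comes from the symmetric vectors \<open>x \<otimes> ... \<otimes> x\<close>.
  For the spectral radius, invertibility of \<open>1 - z A\<close> is expressed by surjectivity and
  a lower bound \<open>\<parallel>x\<parallel> \<le> M \<parallel>(1 - z A) x\<parallel>\<close>.
  Compactness makes \<open>M\<close> uniform on a disc, and the bound on
  \<open>s\<^sup>N A\<^sup>N\<close> is carried from \<open>s = 0\<close> to the radius of the disc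
  in steps whose length depends only on \<open>M\<close> and a bound of \<open>A\<close>.\<close>

locale pre_hilbert_space = vector_space "smult H" for H :: "'a::ab_group_add hilb" +
  assumes subspace_carrier: "subspace (carrier H)"
    and cinner_add_right:
      "\<lbrakk>x \<in> carrier H; y \<in> carrier H; z \<in> carrier H\<rbrakk>
        \<Longrightarrow> cinner H x (y + z) = cinner H x y + cinner H x z"
    and cinner_smult_right:
      "\<lbrakk>x \<in> carrier H; y \<in> carrier H\<rbrakk> \<Longrightarrow> cinner H x (smult H c y) = c * cinner H x y"
    and cinner_commute:
      "\<lbrakk>x \<in> carrier H; y \<in> carrier H\<rbrakk> \<Longrightarrow> cinner H x y = cnj (cinner H y x)"
    and cinner_pos: "\<lbrakk>x \<in> carrier H; x \<noteq> 0\<rbrakk> \<Longrightarrow> 0 < Re (cinner H x x)"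

sublocale hilbert_space \<subseteq> pre_hilbert_space
  by unfold_locales
    (fact subspace_carrier cinner_add_right cinner_smult_right cinner_commute cinner_pos)+

context pre_hilbert_space
begin

lemma zero_closed [simp]: "0 \<in> carrier H"
  and add_closed [simp]: "x \<in> carrier H \<Longrightarrow> y \<in> carrier H \<Longrightarrow> x + y \<in> carrier H"
  and smult_closed [simp]: "x \<in> carrier H \<Longrightarrow> smult H c x \<in> carrier H"
  and diff_closed [simp]: "x \<in> carrier H \<Longrightarrow> y \<in> carrier H \<Longrightarrow> x - y \<in> carrier H"
  and uminus_closed [simp]: "x \<in> carrier H \<Longrightarrow> - x \<in> carrier H"
  using subspace_carrier subspace_diff subspace_neg by (auto simp: subspace_def)

lemma sum_closed [simp]: "(\<And>i. i \<in> F \<Longrightarrow> f i \<in> carrier H) \<Longrightarrow> sum f F \<in> carrier H"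
  by (rule subspace_sum[OF subspace_carrier])

lemma cinner_zero_right [simp]: "x \<in> carrier H \<Longrightarrow> cinner H x 0 = 0"
  using cinner_smult_right[of x 0 0] by simp

lemma cinner_zero_left [simp]: "x \<in> carrier H \<Longrightarrow> cinner H 0 x = 0"
  using cinner_commute[of 0 x] by simp

lemma cinner_add_left:
  "x \<in> carrier H \<Longrightarrow> y \<in> carrier H \<Longrightarrow> z \<in> carrier H \<Longrightarrow> cinner H (x + y) z = cinner H x z + cinner H y z"
  using cinner_commute[of "x + y" z] cinner_commute[of x z] cinner_commute[of y z]
    cinner_add_right[of z x y] by simp

lemma cinner_smult_left:
  "x \<in> carrier H \<Longrightarrow> y \<in> carrier H \<Longrightarrow> cinner H (smult H c x) y = cnj c * cinner H x y"
  using cinner_commute[of "smult H c x" y] cinner_commute[of x y] cinner_smult_right[of y x c] by simp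

lemma cinner_minus_right [simp]: "x \<in> carrier H \<Longrightarrow> y \<in> carrier H \<Longrightarrow> cinner H x (- y) = - cinner H x y"
  using cinner_smult_right[of x y "-1"] by simp

lemma cinner_minus_left [simp]: "x \<in> carrier H \<Longrightarrow> y \<in> carrier H \<Longrightarrow> cinner H (- x) y = - cinner H x y"
  using cinner_smult_left[of x y "-1"] by simp

lemma cinner_diff_right:
  "x \<in> carrier H \<Longrightarrow> y \<in> carrier H \<Longrightarrow> z \<in> carrier H \<Longrightarrow> cinner H x (y - z) = cinner H x y - cinner H x z"
  using cinner_add_right[of x y "- z"] by simp

lemma cinner_diff_left:
  "x \<in> carrier H \<Longrightarrow> y \<in> carrier H \<Longrightarrow> z \<in> carrier H \<Longrightarrow> cinner H (x - y) z = cinner H x z - cinner H y z"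
  using cinner_add_left[of x "- y" z] by simp

lemma cinner_sum_right:
  "x \<in> carrier H \<Longrightarrow> (\<And>i. i \<in> F \<Longrightarrow> f i \<in> carrier H) \<Longrightarrow> cinner H x (sum f F) = (\<Sum>i\<in>F. cinner H x (f i))"
  by (induction F rule: infinite_finite_induct) (auto simp: cinner_add_right)

lemma cinner_sum_left:
  "x \<in> carrier H \<Longrightarrow> (\<And>i. i \<in> F \<Longrightarrow> f i \<in> carrier H) \<Longrightarrow> cinner H (sum f F) x = (\<Sum>i\<in>F. cinner H (f i) x)"
  by (induction F rule: infinite_finite_induct) (auto simp: cinner_add_left)

lemma Re_cinner_self_nonneg: "x \<in> carrier H \<Longrightarrow> 0 \<le> Re (cinner H x x)"
  by (cases "x = 0") (auto dest: cinner_pos)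

lemma hnorm_nonneg [simp]: "x \<in> carrier H \<Longrightarrow> 0 \<le> hnorm H x"
  by (simp add: hnorm_def Re_cinner_self_nonneg)

lemma cinner_self: "x \<in> carrier H \<Longrightarrow> cinner H x x = of_real ((hnorm H x)\<^sup>2)"
  using arg_cong[OF cinner_commute[of x x], of Im] Re_cinner_self_nonneg[of x]
  by (auto simp: hnorm_def complex_eq_iff)

lemma hnorm_power2: "x \<in> carrier H \<Longrightarrow> (hnorm H x)\<^sup>2 = Re (cinner H x x)"
  by (simp add: cinner_self)

lemma hnorm_zero [simp]: "hnorm H 0 = 0"
  by (simp add: hnorm_def)

lemma hnorm_eq_0 [simp]: "x \<in> carrier H \<Longrightarrow> hnorm H x = 0 \<longleftrightarrow> x = 0"
  by (auto simp: hnorm_def dest: cinner_pos)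

lemma hnorm_pos [simp]: "x \<in> carrier H \<Longrightarrow> 0 < hnorm H x \<longleftrightarrow> x \<noteq> 0"
  using hnorm_nonneg[of x] hnorm_eq_0[of x] by linarith

lemma hnorm_smult [simp]: "x \<in> carrier H \<Longrightarrow> hnorm H (smult H c x) = cmod c * hnorm H x"
proof -
  assume x: "x \<in> carrier H"
  have "cinner H (smult H c x) (smult H c x) = (c * cnj c) * cinner H x x"
    using x by (simp add: cinner_smult_left cinner_smult_right)
  hence "(hnorm H (smult H c x))\<^sup>2 = (cmod c * hnorm H x)\<^sup>2"
    using x by (simp add: hnorm_power2[of "smult H c x"] cinner_self[OF x] power_mult_distrib
        flip: complex_norm_square)
  thus ?thesis using x by (simp add: power2_eq_iff_nonneg)
qed

lemma hnorm_uminus [simp]: "x \<in> carrier H \<Longrightarrow> hnorm H (- x) = hnorm H x"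
  using hnorm_smult[of x "-1"] by simp

lemma hnorm_minus_commute: "x \<in> carrier H \<Longrightarrow> y \<in> carrier H \<Longrightarrow> hnorm H (x - y) = hnorm H (y - x)"
  using hnorm_uminus[of "x - y"] by simp

lemma hnorm_add_power2:
  assumes "x \<in> carrier H" "y \<in> carrier H"
  shows "(hnorm H (x + y))\<^sup>2 = (hnorm H x)\<^sup>2 + 2 * Re (cinner H x y) + (hnorm H y)\<^sup>2"
  using assms arg_cong[OF cinner_commute[of x y], of Re]
  by (simp add: hnorm_power2 cinner_add_left cinner_add_right)

lemma Cauchy_Schwarz:
  assumes "x \<in> carrier H" "y \<in> carrier H"
  shows "cmod (cinner H x y) \<le> hnorm H x * hnorm H y"
proof (cases "y = 0")
  case False
  hence ny: "hnorm H y > 0" using assms by simp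
  define c where "c = cinner H x y"
  define a where "a = - (cnj c / (hnorm H y)\<^sup>2)"
  have "0 \<le> (hnorm H (x + smult H a y))\<^sup>2" by simp
  also have "\<dots> = (hnorm H x)\<^sup>2 + 2 * Re (a * c) + (cmod a * hnorm H y)\<^sup>2"
    using assms by (simp add: hnorm_add_power2 cinner_smult_right c_def)
  also have "a * c = - of_real ((cmod c / hnorm H y)\<^sup>2)"
    using complex_norm_square[of c] by (simp add: a_def power_divide mult.commute)
  also have "(cmod a * hnorm H y)\<^sup>2 = (cmod c / hnorm H y)\<^sup>2"
    using ny by (simp add: a_def norm_divide norm_power power_divide power_mult_distrib)
      (simp add: power2_eq_square power4_eq_xxxx)
  finally have "(cmod c / hnorm H y)\<^sup>2 \<le> (hnorm H x)\<^sup>2" by simp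
  hence "cmod c / hnorm H y \<le> hnorm H x" using assms by (simp add: power2_le_iff_abs_le ny)
  thus ?thesis using ny by (simp add: c_def field_simps)
qed (use assms in simp)

lemma hnorm_triangle:
  assumes "x \<in> carrier H" "y \<in> carrier H"
  shows "hnorm H (x + y) \<le> hnorm H x + hnorm H y"
proof -
  have "Re (cinner H x y) \<le> hnorm H x * hnorm H y"
    using Cauchy_Schwarz[OF assms] complex_Re_le_cmod order_trans by blast
  hence "(hnorm H (x + y))\<^sup>2 \<le> (hnorm H x + hnorm H y)\<^sup>2"
    using assms by (simp add: hnorm_add_power2 power2_sum)
  thus ?thesis by (rule power2_le_imp_le) (use assms in simp)
qed

lemma hnorm_triangle_diff:
  assumes "x \<in> carrier H" "y \<in> carrier H" "z \<in> carrier H"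
  shows "hnorm H (x - z) \<le> hnorm H (x - y) + hnorm H (y - z)"
  using hnorm_triangle[of "x - y" "y - z"] assms by simp

lemma hnorm_le_add_diff:
  assumes "x \<in> carrier H" "y \<in> carrier H"
  shows "hnorm H x \<le> hnorm H y + hnorm H (x - y)"
  using hnorm_triangle[of y "x - y"] assms by simp

lemma hnorm_sum:
  "(\<And>i. i \<in> F \<Longrightarrow> f i \<in> carrier H) \<Longrightarrow> hnorm H (sum f F) \<le> (\<Sum>i\<in>F. hnorm H (f i))"
proof (induction F rule: infinite_finite_induct)
  case (insert x F)
  then show ?case using hnorm_triangle[of "f x" "sum f F"] by fastforce
qed auto

lemma eq_if_hnorm_diff_small:
  assumes "x \<in> carrier H" "y \<in> carrier H" "\<And>e. e > 0 \<Longrightarrow> hnorm H (x - y) \<le> e"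
  shows "x = y"
proof -
  have "hnorm H (x - y) \<le> 0" using assms(3) field_le_epsilon[of "hnorm H (x - y)" 0] by simp
  thus ?thesis using assms hnorm_nonneg[of "x - y"] by (metis antisym diff_closed eq_iff_diff_eq_0 hnorm_eq_0)
qed

lemma Metric_space_hdist: "Metric_space (carrier H) (hdist H)"
proof
  fix x y z
  assume "x \<in> carrier H" "y \<in> carrier H" "z \<in> carrier H"
  thus "hdist H x z \<le> hdist H x y + hdist H y z" by (simp add: hdist_def hnorm_triangle_diff)
qed (auto simp: hdist_def hnorm_minus_commute)

lemma hclosure_iff:
  "x \<in> hclosure H S \<longleftrightarrow> x \<in> carrier H \<and> (\<forall>e>0. \<exists>y\<in>S \<inter> carrier H. hnorm H (x - y) < e)"
proof -
  interpret Metric_space "carrier H" "hdist H" by (rule Metric_space_hdist)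
  show ?thesis unfolding hclosure_def metric_closure_of by (auto simp: hdist_def)+
qed

text \<open>Completeness is the one axiom that \<open>pre_hilbert_space\<close> leaves out. It is
  reduced here to norm-Cauchy sequences, the form in which it is checked for square-summable
  functions and for symmetric tensors.\<close>

lemma hilbert_spaceI:
  assumes "\<And>s. \<lbrakk>\<And>n. s n \<in> carrier H;
        \<And>e. e > 0 \<Longrightarrow> \<exists>N. \<forall>m\<ge>N. \<forall>n\<ge>N. hnorm H (s m - s n) < e\<rbrakk> \<Longrightarrow>
        \<exists>x\<in>carrier H. (\<lambda>n. hnorm H (s n - x)) \<longlonglongrightarrow> 0"
  shows "hilbert_space H"
proof unfold_locales
  interpret M: Metric_space "carrier H" "hdist H" by (rule Metric_space_hdist)
  show "M.mcomplete"
    unfolding M.mcomplete_def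
  proof (intro allI impI)
    fix s assume s: "M.MCauchy s"
    hence c: "s n \<in> carrier H" for n by (auto simp: M.MCauchy_def)
    have "\<exists>N. \<forall>m\<ge>N. \<forall>n\<ge>N. hnorm H (s m - s n) < e" if "e > 0" for e
      using s that c unfolding M.MCauchy_def hdist_def by simp
    then obtain x where "x \<in> carrier H" "(\<lambda>n. hnorm H (s n - x)) \<longlonglongrightarrow> 0"
      using assms[of s] c by blast
    hence "limitin M.mtopology s x sequentially"
      using c by (simp add: M.limit_metric_sequentially hdist_def lim_sequentially dist_real_def)
    thus "\<exists>x. limitin M.mtopology s x sequentially" ..
  qed
qed (fact subspace_carrier cinner_add_right cinner_smult_right cinner_commute cinner_pos)+

end

context hilbert_space
begin

lemma Cauchy_converges:
  assumes "\<And>n. s n \<in> carrier H"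
    and "\<And>e. e > 0 \<Longrightarrow> \<exists>N. \<forall>m\<ge>N. \<forall>n\<ge>N. hnorm H (s m - s n) < e"
  obtains x where "x \<in> carrier H" "(\<lambda>n. hnorm H (s n - x)) \<longlonglongrightarrow> 0"
proof -
  interpret M: Metric_space "carrier H" "hdist H" by (rule Metric_space_hdist)
  have "M.MCauchy s" using assms by (fastforce simp: M.MCauchy_def hdist_def)
  then obtain x where "limitin M.mtopology s x sequentially"
    using complete unfolding M.mcomplete_def by blast
  hence "x \<in> carrier H" "\<And>e. e > 0 \<Longrightarrow> \<exists>N. \<forall>n\<ge>N. hnorm H (s n - x) < e"
    using assms(1) by (fastforce simp: M.limit_metric_sequentially hdist_def)+
  moreover from this have "(\<lambda>n. hnorm H (s n - x)) \<longlonglongrightarrow> 0"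
    using assms(1) by (simp add: lim_sequentially dist_real_def)
  ultimately show ?thesis using that by blast
qed

end

lemma has_sum_metric:
  fixes f :: "'a \<Rightarrow> 'b::real_normed_vector"
  shows "(f has_sum l) A \<longleftrightarrow> (\<forall>e>0. \<exists>X. finite X \<and> X \<subseteq> A \<and>
    (\<forall>Y. finite Y \<and> X \<subseteq> Y \<and> Y \<subseteq> A \<longrightarrow> dist (sum f Y) l < e))"
  unfolding has_sum_def tendsto_iff eventually_finite_subsets_at_top by blast

lemma has_sum_sum:
  fixes f :: "'i \<Rightarrow> 'a \<Rightarrow> 'b::{topological_comm_monoid_add}"
  assumes "\<And>i. i \<in> F \<Longrightarrow> (f i has_sum s i) A"
  shows "((\<lambda>x. \<Sum>i\<in>F. f i x) has_sum (\<Sum>i\<in>F. s i)) A"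
  using assms by (induction F rule: infinite_finite_induct) (auto intro: has_sum_add)

section \<open>Bessel's inequality and Parseval's identity\<close>

context pre_hilbert_space
begin

lemma orthonormal_sum_power2:
  assumes "finite F" "F \<subseteq> carrier H" "\<And>e f. e \<in> F \<Longrightarrow> f \<in> F \<Longrightarrow> cinner H e f = (if e = f then 1 else 0)"
  shows "(hnorm H (\<Sum>e\<in>F. smult H (c e) e))\<^sup>2 = (\<Sum>e\<in>F. (cmod (c e))\<^sup>2)"
proof -
  have F: "e \<in> carrier H" if "e \<in> F" for e using assms that by auto
  have "cinner H (\<Sum>e\<in>F. smult H (c e) e) (\<Sum>e\<in>F. smult H (c e) e)
      = (\<Sum>e\<in>F. \<Sum>f\<in>F. cnj (c f) * (c e) * cinner H f e)"
    using F by (simp add: cinner_sum_right cinner_sum_left cinner_smult_left cinner_smult_right mult_ac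
        sum_distrib_left)
  also have "\<dots> = (\<Sum>e\<in>F. \<Sum>f\<in>F. if f = e then cnj (c e) * c e else 0)"
    using assms(3) by (intro sum.cong refl) auto
  also have "\<dots> = (\<Sum>e\<in>F. of_real ((cmod (c e))\<^sup>2))"
    using assms(1) by (intro sum.cong refl) (simp only: sum.delta complex_norm_square if_True mult.commute)
  finally show ?thesis using F by (simp add: hnorm_power2)
qed

text \<open>The projection \<open>p\<close> satisfies
  \<open>\<langle>p, x\<rangle> = \<parallel>p\<parallel>\<^sup>2\<close>, so Cauchy-Schwarz gives
  \<open>\<parallel>p\<parallel>\<^sup>2 \<le> \<parallel>p\<parallel>
  \<parallel>x\<parallel>\<close>.\<close>

lemma Bessel:
  assumes "finite F" "F \<subseteq> carrier H" "\<And>e f. e \<in> F \<Longrightarrow> f \<in> F \<Longrightarrow> cinner H e f = (if e = f then 1 else 0)"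
    and x: "x \<in> carrier H"
  shows "hnorm H (\<Sum>e\<in>F. smult H (cinner H e x) e) \<le> hnorm H x"
proof -
  define p where "p = (\<Sum>e\<in>F. smult H (cinner H e x) e)"
  have F: "e \<in> carrier H" if "e \<in> F" for e using assms that by auto
  hence p: "p \<in> carrier H" by (auto simp: p_def)
  have "cinner H p x = (\<Sum>e\<in>F. cnj (cinner H e x) * cinner H e x)"
    using F x by (simp add: p_def cinner_sum_left cinner_smult_left)
  hence "Re (cinner H p x) = (\<Sum>e\<in>F. (cmod (cinner H e x))\<^sup>2)"
    by (simp add: cmod_power2) (simp add: power2_eq_square)
  also have "\<dots> = (hnorm H p)\<^sup>2"
    unfolding p_def by (rule orthonormal_sum_power2[symmetric]) (use assms in auto)
  finally have "(hnorm H p)\<^sup>2 = Re (cinner H p x)" ..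
  also have "\<dots> \<le> hnorm H p * hnorm H x"
    using Cauchy_Schwarz[OF p x] complex_Re_le_cmod order_trans by blast
  finally show ?thesis using p x hnorm_nonneg[OF p] hnorm_nonneg[OF x] unfolding p_def[symmetric]
    by (metis mult_le_cancel_left power2_eq_square less_eq_real_def not_less)
qed

text \<open>Once the finite set \<open>F\<close> contains the support of a combination
  \<open>s\<close> close to \<open>y\<close>, the partial sum is
  \<open>\<langle>p, y\<rangle>\<close> for the projection \<open>p\<close> of \<open>x\<close>, and
  \<open>\<langle>p, s\<rangle> = \<langle>x, s\<rangle>\<close>. The error is therefore
  \<open>\<langle>p - x, y - s\<rangle>\<close>, at most
  \<open>2 \<parallel>x\<parallel> \<parallel>y - s\<parallel>\<close>.\<close>

lemma orthonormal_basis_has_sum_cinner: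
  assumes E: "orthonormal_basis H E" and x: "x \<in> carrier H" and y: "y \<in> carrier H"
  shows "((\<lambda>e. cnj (cinner H e x) * cinner H e y) has_sum cinner H x y) E"
  unfolding has_sum_metric
proof (intro allI impI)
  fix \<epsilon> :: real assume \<epsilon>: "\<epsilon> > 0"
  have EC: "E \<subseteq> carrier H" and ortho: "\<And>e f. e \<in> E \<Longrightarrow> f \<in> E \<Longrightarrow> cinner H e f = (if e = f then 1 else 0)"
    and dense: "hclosure H (span E) = carrier H"
    using E by (auto simp: orthonormal_basis_def)
  \<comment> \<open>The summand 1 keeps the denominator positive for \<open>x = 0\<close>.\<close>
  define \<delta> where "\<delta> = \<epsilon> / (2 * hnorm H x + 1)"
  have d: "\<delta> > 0" using \<epsilon> x by (simp add: \<delta>_def add_nonneg_pos)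
  have "y \<in> hclosure H (span E)" using dense y by simp
  then obtain s where s: "s \<in> span E" "s \<in> carrier H" "hnorm H (y - s) < \<delta>"
    unfolding hclosure_iff using d by blast
  from s(1) obtain F0 c where F0: "finite F0" "F0 \<subseteq> E" and s_eq: "s = (\<Sum>e\<in>F0. smult H (c e) e)"
    unfolding span_explicit by auto
  show "\<exists>X. finite X \<and> X \<subseteq> E \<and> (\<forall>Y. finite Y \<and> X \<subseteq> Y \<and> Y \<subseteq> E \<longrightarrow>
      dist (\<Sum>e\<in>Y. cnj (cinner H e x) * cinner H e y) (cinner H x y) < \<epsilon>)"
  proof (rule exI[of _ F0], intro conjI F0 allI impI, elim conjE)
    fix F assume F: "finite F" "F0 \<subseteq> F" "F \<subseteq> E"
    have FC: "e \<in> carrier H" if "e \<in> F" for e using that F EC by auto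
    define p where "p = (\<Sum>e\<in>F. smult H (cinner H e x) e)"
    have p: "p \<in> carrier H" using FC by (auto simp: p_def)
    have pe: "cinner H p e = cinner H x e" if "e \<in> F" for e
    proof -
      have "cinner H p e = (\<Sum>f\<in>F. cnj (cinner H f x) * cinner H f e)"
        using FC that by (simp add: p_def cinner_sum_left cinner_smult_left)
      also have "\<dots> = (\<Sum>f\<in>F. if f = e then cnj (cinner H e x) else 0)"
        using ortho F that by (intro sum.cong refl) (auto simp: subset_iff)
      also have "\<dots> = cinner H x e"
        using F that FC[OF that] x cinner_commute[of x e] by simp
      finally show ?thesis .
    qed
    have ps: "cinner H p s = cinner H x s"
      unfolding s_eq using F0 F EC p x pe by (subst (1 2) cinner_sum_right) (auto simp: cinner_smult_right subset_iff intro!: sum.cong)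
    have np: "hnorm H p \<le> hnorm H x"
      unfolding p_def
    proof (rule Bessel[OF F(1) _ _ x])
      show "cinner H e f = (if e = f then 1 else 0)" if "e \<in> F" "f \<in> F" for e f
        using ortho[of e f] that F by blast
    qed (use F EC in auto)
    have "(\<Sum>e\<in>F. cnj (cinner H e x) * cinner H e y) = cinner H p y"
      using FC y by (simp add: p_def cinner_sum_left cinner_smult_left)
    also have "\<dots> - cinner H x y = cinner H p (y - s) - cinner H x (y - s)"
      using p x y s ps by (simp add: cinner_diff_right)
    finally have "cmod ((\<Sum>e\<in>F. cnj (cinner H e x) * cinner H e y) - cinner H x y)
        \<le> cmod (cinner H p (y - s)) + cmod (cinner H x (y - s))"
      by (metis norm_triangle_ineq4)
    also have "\<dots> \<le> hnorm H p * hnorm H (y - s) + hnorm H x * hnorm H (y - s)"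
      using p x y s by (intro add_mono Cauchy_Schwarz) auto
    also have "\<dots> \<le> (2 * hnorm H x) * hnorm H (y - s)"
      using np y s by (simp add: distrib_right[symmetric] mult_right_mono)
    also have "\<dots> \<le> (2 * hnorm H x) * \<delta>"
      using s x by (intro mult_left_mono) auto
    also have "\<dots> < (2 * hnorm H x + 1) * \<delta>" using d by (simp add: distrib_right)
    also have "\<dots> = \<epsilon>" using hnorm_nonneg[OF x] by (simp add: \<delta>_def)
    finally show "dist (\<Sum>e\<in>F. cnj (cinner H e x) * cinner H e y) (cinner H x y) < \<epsilon>"
      by (simp add: dist_norm)
  qed
qed

end

text \<open>Asking only for a non-negative real part spares the proof that the quadratic form is
  real.\<close>

definition psd_kernel :: "'i set \<Rightarrow> ('i \<Rightarrow> 'i \<Rightarrow> complex) \<Rightarrow> bool" where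
  "psd_kernel F P \<longleftrightarrow> (\<forall>c. 0 \<le> Re (\<Sum>i\<in>F. \<Sum>j\<in>F. cnj (c i) * c j * P i j))"

context pre_hilbert_space
begin

lemma cinner_sum_sum:
  assumes "\<And>i. i \<in> F \<Longrightarrow> x i \<in> carrier H" "\<And>i. i \<in> G \<Longrightarrow> y i \<in> carrier H"
  shows "cinner H (\<Sum>i\<in>F. smult H (c i) (x i)) (\<Sum>j\<in>G. smult H (d j) (y j))
    = (\<Sum>i\<in>F. \<Sum>j\<in>G. cnj (c i) * d j * cinner H (x i) (y j))"
proof -
  have "cinner H (\<Sum>i\<in>F. smult H (c i) (x i)) (\<Sum>j\<in>G. smult H (d j) (y j))
      = (\<Sum>i\<in>F. cinner H (smult H (c i) (x i)) (\<Sum>j\<in>G. smult H (d j) (y j)))"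
    using assms by (intro cinner_sum_left) auto
  also have "\<dots> = (\<Sum>i\<in>F. \<Sum>j\<in>G. cnj (c i) * d j * cinner H (x i) (y j))"
    using assms by (intro sum.cong refl)
      (auto simp: cinner_sum_right cinner_smult_left cinner_smult_right sum_distrib_left mult_ac intro!: sum.cong)
  finally show ?thesis .
qed

text \<open>A special case of the Schur product theorem: expanding the Gram factor in the basis by Parseval's
  identity writes the product as a sum of positive semidefinite kernels.\<close>

lemma psd_kernel_times_Gram:
  assumes E: "orthonormal_basis H E" and P: "psd_kernel F P"
    and x: "\<And>i. i \<in> F \<Longrightarrow> x i \<in> carrier H"
  shows "psd_kernel F (\<lambda>i j. P i j * cinner H (x i) (x j))"
  unfolding psd_kernel_def
proof
  fix c
  define S where "S = (\<Sum>i\<in>F. \<Sum>j\<in>F. cnj (c i) * c j * (P i j * cinner H (x i) (x j)))"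
  define T where "T e = (\<Sum>i\<in>F. \<Sum>j\<in>F. cnj (c i * cinner H e (x i)) * (c j * cinner H e (x j)) * P i j)" for e
  have hs: "((\<lambda>e. \<Sum>i\<in>F. \<Sum>j\<in>F. cnj (c i) * c j * (P i j * (cnj (cinner H e (x i)) * cinner H e (x j))))
      has_sum S) E" unfolding S_def
    by (intro has_sum_sum has_sum_cmult_right orthonormal_basis_has_sum_cinner[OF E] x)
  have "(T has_sum S) E"
    using hs by (rule has_sum_cong[THEN iffD1, rotated]) (simp add: T_def mult_ac)
  hence "((\<lambda>e. Re (T e)) has_sum Re S) E" by (rule has_sum_Re)
  moreover have "0 \<le> Re (T e)" for e
    using P[unfolded psd_kernel_def, rule_format, of "\<lambda>i. c i * cinner H e (x i)"] by (simp add: T_def)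
  ultimately show "0 \<le> Re S" by (rule has_sum_nonneg)
qed

lemma psd_kernel_times_prod_Gram:
  assumes E: "orthonormal_basis H E" and P: "psd_kernel F P" and "finite K"
    and x: "\<And>i k. i \<in> F \<Longrightarrow> k \<in> K \<Longrightarrow> x i k \<in> carrier H"
  shows "psd_kernel F (\<lambda>i j. P i j * (\<Prod>k\<in>K. cinner H (x i k) (x j k)))"
  using \<open>finite K\<close> x
proof (induction K)
  case (insert k K)
  have "psd_kernel F (\<lambda>i j. P i j * (\<Prod>k\<in>K. cinner H (x i k) (x j k)) * cinner H (x i k) (x j k))"
    by (rule psd_kernel_times_Gram[OF E]) (use insert in auto)
  thus ?case using insert by (simp add: mult_ac)
qed (use P in simp)

end

section \<open>Square-summable functions\<close>

text \<open>Functions vanish outside \<open>I\<close> so that the inner product, which sums over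
  \<open>I\<close> only, is definite. In this way spaces over different index sets live inside one
  function type.\<close>

definition l2_space :: "'i set \<Rightarrow> ('i \<Rightarrow> complex) hilb" where
  "l2_space I = \<lparr>carrier = {f. (\<forall>i. i \<notin> I \<longrightarrow> f i = 0) \<and> (\<lambda>i. (cmod (f i))\<^sup>2) summable_on I},
    smult = (\<lambda>c f i. c * f i), cinner = (\<lambda>f g. \<Sum>\<^sub>\<infinity>i\<in>I. cnj (f i) * g i)\<rparr>"

lemma l2_space_simps [simp]:
  "f \<in> carrier (l2_space I) \<longleftrightarrow> (\<forall>i. i \<notin> I \<longrightarrow> f i = 0) \<and> (\<lambda>i. (cmod (f i))\<^sup>2) summable_on I"
  "smult (l2_space I) c f = (\<lambda>i. c * f i)"
  "cinner (l2_space I) f g = (\<Sum>\<^sub>\<infinity>i\<in>I. cnj (f i) * g i)"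
  by (auto simp: l2_space_def)

lemma square_summable_mult:
  fixes f g :: "'i \<Rightarrow> complex"
  assumes "(\<lambda>i. (cmod (f i))\<^sup>2) summable_on I" "(\<lambda>i. (cmod (g i))\<^sup>2) summable_on I"
  shows "(\<lambda>i. cnj (f i) * g i) summable_on I"
proof (rule abs_summable_summable, rule summable_on_comparison_test)
  show "(\<lambda>i. (cmod (f i))\<^sup>2 + (cmod (g i))\<^sup>2) summable_on I"
    using assms by (rule summable_on_add)
  show "norm (cnj (f i) * g i) \<le> (cmod (f i))\<^sup>2 + (cmod (g i))\<^sup>2" for i
    using sum_squares_bound[of "cmod (f i)" "cmod (g i)"]
      mult_nonneg_nonneg[OF norm_ge_zero[of "f i"] norm_ge_zero[of "g i"]]
    unfolding norm_mult complex_mod_cnj by linarith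
qed auto

lemma square_summable_add:
  fixes f g :: "'i \<Rightarrow> complex"
  assumes "(\<lambda>i. (cmod (f i))\<^sup>2) summable_on I" "(\<lambda>i. (cmod (g i))\<^sup>2) summable_on I"
  shows "(\<lambda>i. (cmod (f i + g i))\<^sup>2) summable_on I"
proof (rule summable_on_comparison_test)
  show "(\<lambda>i. 2 * (cmod (f i))\<^sup>2 + 2 * (cmod (g i))\<^sup>2) summable_on I"
    using assms by (intro summable_on_add summable_on_cmult_right)
  show "(cmod (f i + g i))\<^sup>2 \<le> 2 * (cmod (f i))\<^sup>2 + 2 * (cmod (g i))\<^sup>2" for i
  proof -
    have "(cmod (f i + g i))\<^sup>2 \<le> (cmod (f i) + cmod (g i))\<^sup>2"
      by (intro power_mono norm_triangle_ineq) auto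
    also have "\<dots> \<le> 2 * (cmod (f i))\<^sup>2 + 2 * (cmod (g i))\<^sup>2"
      using sum_squares_bound[of "cmod (f i)" "cmod (g i)"] by (simp add: power2_sum)
    finally show ?thesis .
  qed
qed auto

lemma l2_space_cinner_self:
  "cinner (l2_space I) f f = of_real (\<Sum>\<^sub>\<infinity>i\<in>I. (cmod (f i))\<^sup>2)"
proof -
  have "cinner (l2_space I) f f = (\<Sum>\<^sub>\<infinity>i\<in>I. of_real ((cmod (f i))\<^sup>2))"
    by (simp only: l2_space_simps complex_norm_square mult.commute)
  also have "\<dots> = of_real (\<Sum>\<^sub>\<infinity>i\<in>I. (cmod (f i))\<^sup>2)"
  proof (cases "(\<lambda>i. (cmod (f i))\<^sup>2) summable_on I")
    case True
    thus ?thesis by (intro infsumI has_sum_of_real has_sum_infsum)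
  next
    \<comment> \<open>Both sums then take the default value 0.\<close>
    case False
    hence "\<not> (\<lambda>i. complex_of_real ((cmod (f i))\<^sup>2)) summable_on I"
      using summable_on_Re[of "\<lambda>i. complex_of_real ((cmod (f i))\<^sup>2)" I] by auto
    with False show ?thesis by (simp add: infsum_not_exists del: of_real_power)
  qed
  finally show ?thesis .
qed

lemma hnorm_l2_space: "hnorm (l2_space I) f = sqrt (\<Sum>\<^sub>\<infinity>i\<in>I. (cmod (f i))\<^sup>2)"
  unfolding hnorm_def l2_space_cinner_self by simp

lemma vector_space_l2_space: "vector_space (smult (l2_space I))"
  by unfold_locales (auto simp: fun_eq_iff algebra_simps)

lemma pre_hilbert_space_l2_space: "pre_hilbert_space (l2_space I)"
proof -
  interpret vector_space "smult (l2_space I)" by (rule vector_space_l2_space)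
  show ?thesis
  proof unfold_locales
    show "subspace (carrier (l2_space I))"
      by (rule subspaceI)
        (auto simp: square_summable_add norm_mult power_mult_distrib summable_on_cmult_right)
  next
    fix f g h assume "f \<in> carrier (l2_space I)" "g \<in> carrier (l2_space I)" "h \<in> carrier (l2_space I)"
    thus "cinner (l2_space I) f (g + h) = cinner (l2_space I) f g + cinner (l2_space I) f h"
      by (simp add: distrib_left infsum_add square_summable_mult)
  next
    fix f g c assume "f \<in> carrier (l2_space I)" "g \<in> carrier (l2_space I)"
    thus "cinner (l2_space I) f (smult (l2_space I) c g) = c * cinner (l2_space I) f g"
      by (simp add: square_summable_mult mult.left_commute[of _ c] infsum_cmult_right)
  next
    fix f g
    show "cinner (l2_space I) f g = cnj (cinner (l2_space I) g f)"
      unfolding l2_space_simps infsum_cnj[symmetric] by (simp add: mult.commute)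
  next
    fix f assume f: "f \<in> carrier (l2_space I)" "f \<noteq> 0"
    then obtain i where i: "f i \<noteq> 0" by (auto simp: fun_eq_iff)
    with f have "i \<in> I" by auto
    have "0 < (\<Sum>i\<in>{i}. (cmod (f i))\<^sup>2)" using i by simp
    also have "\<dots> \<le> (\<Sum>\<^sub>\<infinity>i\<in>I. (cmod (f i))\<^sup>2)"
      by (rule finite_sum_le_infsum) (use f \<open>i \<in> I\<close> in auto)
    finally show "0 < Re (cinner (l2_space I) f f)" unfolding l2_space_cinner_self by simp
  qed
qed

lemma sum_le_hnorm_l2_space:
  assumes "f \<in> carrier (l2_space I)" "finite F" "F \<subseteq> I"
  shows "(\<Sum>i\<in>F. (cmod (f i))\<^sup>2) \<le> (hnorm (l2_space I) f)\<^sup>2"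
  using assms finite_sum_le_infsum[of "\<lambda>i. (cmod (f i))\<^sup>2" I F]
  by (simp add: hnorm_l2_space infsum_nonneg)

text \<open>Finite sums are what passes to a pointwise limit; a bound on them yields membership and
  the norm bound at once.\<close>

lemma hnorm_l2_space_leI:
  assumes "\<And>i. i \<notin> I \<Longrightarrow> f i = 0" "0 \<le> r"
    and "\<And>F. finite F \<Longrightarrow> F \<subseteq> I \<Longrightarrow> (\<Sum>i\<in>F. (cmod (f i))\<^sup>2) \<le> r\<^sup>2"
  shows "f \<in> carrier (l2_space I)" "hnorm (l2_space I) f \<le> r"
proof -
  have s: "(\<lambda>i. (cmod (f i))\<^sup>2) summable_on I"
    by (rule nonneg_bdd_above_summable_on) (use assms(3) in \<open>auto simp: bdd_above_def\<close>)
  thus "f \<in> carrier (l2_space I)" using assms by simp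
  show "hnorm (l2_space I) f \<le> r" unfolding hnorm_l2_space
    using infsum_le_finite_sums[OF s, of "r\<^sup>2"] assms by (intro real_le_lsqrt) (auto simp: infsum_nonneg)
qed

text \<open>Riesz-Fischer: a Cauchy sequence converges in each coordinate, and letting
  \<open>m\<close> tend to infinity in the finite sums for \<open>s n - s m\<close> turns the Cauchy
  condition into convergence in norm.\<close>

lemma hilbert_space_l2_space: "hilbert_space (l2_space I)"
proof -
  interpret pre_hilbert_space "l2_space I" by (rule pre_hilbert_space_l2_space)
  show ?thesis
  proof (rule hilbert_spaceI)
    fix s :: "nat \<Rightarrow> 'a \<Rightarrow> complex"
    assume s: "\<And>n. s n \<in> carrier (l2_space I)"
      and C: "\<And>e. e > 0 \<Longrightarrow> \<exists>N. \<forall>m\<ge>N. \<forall>n\<ge>N. hnorm (l2_space I) (s m - s n) < e"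
    have point: "cmod (s m i - s n i) \<le> hnorm (l2_space I) (s m - s n)" for m n i
    proof (cases "i \<in> I")
      case True
      have "s m - s n \<in> carrier (l2_space I)" using s by (intro diff_closed)
      from sum_le_hnorm_l2_space[OF this, of "{i}"] True have
        "(cmod (s m i - s n i))\<^sup>2 \<le> (hnorm (l2_space I) (s m - s n))\<^sup>2" by simp
      thus ?thesis using hnorm_nonneg[OF \<open>s m - s n \<in> _\<close>] by (rule power2_le_imp_le)
    next
      case False
      hence "s m i = 0" "s n i = 0" using s by auto
      thus ?thesis using hnorm_nonneg[OF diff_closed[OF s s]] by simp
    qed
    have "Cauchy (\<lambda>n. s n i)" for i
    proof (rule metric_CauchyI)
      fix e :: real assume "e > 0"
      from C[OF this] obtain N where "\<forall>m\<ge>N. \<forall>n\<ge>N. hnorm (l2_space I) (s m - s n) < e" ..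
      thus "\<exists>M. \<forall>m\<ge>M. \<forall>n\<ge>M. dist (s m i) (s n i) < e"
        using point by (metis dist_norm le_less_trans)
    qed
    hence "\<exists>l. (\<lambda>n. s n i) \<longlonglongrightarrow> l" for i by (simp add: Cauchy_convergent_iff convergent_def)
    then obtain f where f: "\<And>i. (\<lambda>n. s n i) \<longlonglongrightarrow> f i" by metis
    have f0: "f i = 0" if "i \<notin> I" for i
      using f[of i] s that by (simp add: LIMSEQ_const_iff)
    have est: "s n - f \<in> carrier (l2_space I) \<and> hnorm (l2_space I) (s n - f) \<le> e"
      if e: "e > 0" and N: "\<forall>m\<ge>N. \<forall>n\<ge>N. hnorm (l2_space I) (s m - s n) < e" and n: "n \<ge> N" for e N n
    proof -
      have "(\<Sum>i\<in>F. (cmod ((s n - f) i))\<^sup>2) \<le> e\<^sup>2" if F: "finite F" "F \<subseteq> I" for F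
      proof (rule tendsto_upperbound)
        show "(\<lambda>m. \<Sum>i\<in>F. (cmod (s n i - s m i))\<^sup>2) \<longlonglongrightarrow> (\<Sum>i\<in>F. (cmod ((s n - f) i))\<^sup>2)"
          unfolding fun_diff_def by (intro tendsto_intros f)
        have "(\<Sum>i\<in>F. (cmod (s n i - s m i))\<^sup>2) \<le> e\<^sup>2" if "m \<ge> N" for m
        proof -
          have sd: "s n - s m \<in> carrier (l2_space I)" using s by (intro diff_closed)
          from sum_le_hnorm_l2_space[OF this F]
          have "(\<Sum>i\<in>F. (cmod (s n i - s m i))\<^sup>2) \<le> (hnorm (l2_space I) (s n - s m))\<^sup>2" by simp
          also have "\<dots> \<le> e\<^sup>2" using N n that hnorm_nonneg[OF sd] by (intro power_mono) (auto intro: less_imp_le)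
          finally show ?thesis .
        qed
        thus "\<forall>\<^sub>F m in sequentially. (\<Sum>i\<in>F. (cmod (s n i - s m i))\<^sup>2) \<le> e\<^sup>2"
          unfolding eventually_sequentially by blast
      qed auto
      from hnorm_l2_space_leI[of I "s n - f" e, OF _ _ this] show ?thesis
        using e f0 s by fastforce
    qed
    \<comment> \<open>The estimate controls differences only, so membership of the limit is obtained
      by writing it as \<open>s N - (s N - f)\<close>.\<close>
    from C[of 1] obtain N where N: "\<forall>m\<ge>N. \<forall>n\<ge>N. hnorm (l2_space I) (s m - s n) < 1" by auto
    have "s N - f \<in> carrier (l2_space I)" using est[of 1 N N] N by auto
    hence "s N - (s N - f) \<in> carrier (l2_space I)" by (rule diff_closed[OF s])
    moreover have "s N - (s N - f) = f" by simp
    ultimately have fc: "f \<in> carrier (l2_space I)" by (simp only:)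
    moreover have "(\<lambda>n. hnorm (l2_space I) (s n - f)) \<longlonglongrightarrow> 0"
      unfolding lim_sequentially
    proof (intro allI impI)
      fix r :: real assume "r > 0"
      then obtain N where "\<forall>m\<ge>N. \<forall>n\<ge>N. hnorm (l2_space I) (s m - s n) < r / 2" using C[of "r/2"] by auto
      hence "hnorm (l2_space I) (s n - f) \<le> r / 2" if "n \<ge> N" for n
        using est[of "r/2" N n] \<open>r > 0\<close> that by auto
      thus "\<exists>N. \<forall>n\<ge>N. dist (hnorm (l2_space I) (s n - f)) 0 < r"
        using \<open>r > 0\<close> hnorm_nonneg[OF diff_closed[OF s fc]] by (intro exI[of _ N]) (fastforce simp: dist_real_def)
    qed
    ultimately show "\<exists>x\<in>carrier (l2_space I). (\<lambda>n. hnorm (l2_space I) (s n - x)) \<longlonglongrightarrow> 0" by blast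
  qed
qed

lemma sum_fun_apply: "(\<Sum>i\<in>F. f i) j = (\<Sum>i\<in>F. f i j)"
  by (induction F rule: infinite_finite_induct) auto

abbreviation unit_vector :: "'i \<Rightarrow> 'i \<Rightarrow> complex" where
  "unit_vector i \<equiv> (\<lambda>j. if j = i then 1 else 0)"

lemma unit_vector_l2: "i \<in> I \<Longrightarrow> unit_vector i \<in> carrier (l2_space I)"
  by (auto intro!: finite_nonzero_values_imp_summable_on finite_subset[of _ "{i}"] split: if_splits)

lemma cinner_unit_vector: "i \<in> I \<Longrightarrow> cinner (l2_space I) (unit_vector i) f = f i"
  using infsum_cong_neutral[of "{i}" I "\<lambda>j. f j" "\<lambda>j. cnj (unit_vector i j) * f j"] by simp

lemma l2_space_unit_vectors_dense:
  "hclosure (l2_space I) (module.span (smult (l2_space I)) (unit_vector ` I)) = carrier (l2_space I)"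
proof -
  interpret hilbert_space "l2_space I" by (rule hilbert_space_l2_space)
  have "f \<in> hclosure (l2_space I) (span (unit_vector ` I))" if f: "f \<in> carrier (l2_space I)" for f
    unfolding hclosure_iff
  proof (intro conjI f allI impI)
    fix e :: real assume e: "e > 0"
    have "((\<lambda>i. (cmod (f i))\<^sup>2) has_sum (\<Sum>\<^sub>\<infinity>i\<in>I. (cmod (f i))\<^sup>2)) I"
      using f by (intro has_sum_infsum) simp
    \<comment> \<open>Two partial sums within \<open>(e/2)\<^sup>2 / 2\<close> of the total differ
      by at most \<open>(e/2)\<^sup>2\<close>, which bounds the squared norm of the tail outside
      \<open>F\<close>.\<close>
    then obtain F where F: "finite F" "F \<subseteq> I"
      and close: "\<And>Y. finite Y \<Longrightarrow> F \<subseteq> Y \<Longrightarrow> Y \<subseteq> I \<Longrightarrow>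
         dist (\<Sum>i\<in>Y. (cmod (f i))\<^sup>2) (\<Sum>\<^sub>\<infinity>i\<in>I. (cmod (f i))\<^sup>2) < (e/2)\<^sup>2 / 2"
      unfolding has_sum_metric using e by (auto dest!: spec[of _ "(e/2)\<^sup>2 / 2"])
    define g where "g = (\<Sum>i\<in>F. smult (l2_space I) (f i) (unit_vector i))"
    have "g j = (\<Sum>i\<in>F. if i = j then f i else 0)" for j
      unfolding g_def by (subst sum_fun_apply) (auto intro!: sum.cong)
    hence g: "g j = (if j \<in> F then f j else 0)" for j
      using F by simp
    have gspan: "g \<in> span (unit_vector ` I)"
      unfolding g_def using F by (intro span_sum span_scale span_base) auto
    moreover have gc: "g \<in> carrier (l2_space I)"
      unfolding g_def using F unit_vector_l2[of _ I] by (intro sum_closed smult_closed) auto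
    moreover have "hnorm (l2_space I) (f - g) \<le> e / 2"
    proof (rule hnorm_l2_space_leI(2))
      fix G assume G: "finite G" "G \<subseteq> I"
      have "(\<Sum>i\<in>G. (cmod ((f - g) i))\<^sup>2) = (\<Sum>i\<in>G - F. (cmod (f i))\<^sup>2)"
        using G by (intro sum.mono_neutral_cong_right) (auto simp: g)
      also have "\<dots> = (\<Sum>i\<in>G \<union> F. (cmod (f i))\<^sup>2) - (\<Sum>i\<in>F. (cmod (f i))\<^sup>2)"
        using sum.union_disjoint[of F "G - F" "\<lambda>i. (cmod (f i))\<^sup>2"] F G by (simp add: Un_commute)
      also have "\<dots> \<le> (e/2)\<^sup>2"
        using close[OF finite_UnI[OF G(1) F(1)] Un_upper2 Un_least[OF G(2) F(2)]] close[OF F(1) order_refl F(2)]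
        unfolding dist_real_def by linarith
      finally show "(\<Sum>i\<in>G. (cmod ((f - g) i))\<^sup>2) \<le> (e/2)\<^sup>2" .
    qed (use e f F in \<open>auto simp: g\<close>)
    hence "hnorm (l2_space I) (f - g) < e" using e by linarith
    ultimately show "\<exists>y\<in>span (unit_vector ` I) \<inter> carrier (l2_space I). hnorm (l2_space I) (f - y) < e"
      by blast
  qed
  thus ?thesis by (auto simp: hclosure_iff simp del: l2_space_simps)
qed

lemma orthonormal_basis_l2_space: "orthonormal_basis (l2_space I) (unit_vector ` I)"
  unfolding orthonormal_basis_def
proof (intro conjI ballI l2_space_unit_vectors_dense)
  show "unit_vector ` I \<subseteq> carrier (l2_space I)" by (intro image_subsetI unit_vector_l2)
  fix e f assume "e \<in> unit_vector ` I" "f \<in> unit_vector ` I"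
  then obtain i j where ij: "i \<in> I" "j \<in> I" "e = unit_vector i" "f = unit_vector j" by blast
  show "cinner (l2_space I) e f = (if e = f then 1 else 0)"
    unfolding ij(3,4) cinner_unit_vector[OF ij(1)] by (metis zero_neq_one)
qed

section \<open>Operators on tensor powers\<close>

text \<open>A finite set of functions lies in the product of its finite projections
  \<open>C x\<close>, where the sum of products factors; each factor is at most the full sum over
  \<open>B x\<close>.\<close>

lemma summable_on_prod_PiE:
  fixes f :: "'a \<Rightarrow> 'b \<Rightarrow> real"
  assumes A: "finite A" and nonneg: "\<And>x y. x \<in> A \<Longrightarrow> y \<in> B x \<Longrightarrow> 0 \<le> f x y"
    and sm: "\<And>x. x \<in> A \<Longrightarrow> f x summable_on B x"
  shows "(\<lambda>g. \<Prod>x\<in>A. f x (g x)) summable_on PiE A B"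
proof (rule nonneg_bdd_above_summable_on)
  show "0 \<le> (\<Prod>x\<in>A. f x (g x))" if "g \<in> PiE A B" for g
    using that nonneg by (intro prod_nonneg) (auto simp: PiE_iff)
  show "bdd_above (sum (\<lambda>g. \<Prod>x\<in>A. f x (g x)) ` {F. F \<subseteq> PiE A B \<and> finite F})"
  proof (rule bdd_aboveI2, clarify)
    fix F assume F: "F \<subseteq> PiE A B" "finite F"
    define C where "C x = (\<lambda>g. g x) ` F" for x
    have C: "C x \<subseteq> B x" "finite (C x)" if "x \<in> A" for x
      using F that by (auto simp: C_def)
    have "F \<subseteq> PiE A C"
    proof
      fix g assume "g \<in> F"
      moreover from this have "g \<in> PiE A B" using F(1) by blast
      ultimately show "g \<in> PiE A C" by (auto simp: C_def PiE_iff)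
    qed
    hence "(\<Sum>g\<in>F. \<Prod>x\<in>A. f x (g x)) \<le> (\<Sum>g\<in>PiE A C. \<Prod>x\<in>A. f x (g x))"
    proof (intro sum_mono2 finite_PiE prod_nonneg)
      fix g x assume "g \<in> PiE A C - F" "x \<in> A"
      hence "g x \<in> B x" using C by blast
      thus "0 \<le> f x (g x)" using nonneg \<open>x \<in> A\<close> by blast
    qed (use A C in auto)
    also have "\<dots> = (\<Prod>x\<in>A. \<Sum>y\<in>C x. f x y)"
      using A C by (intro prod_sum_PiE[symmetric]) auto
    also have "\<dots> \<le> (\<Prod>x\<in>A. infsum (f x) (B x))"
    proof (rule prod_mono)
      fix x assume x: "x \<in> A"
      have "0 \<le> (\<Sum>y\<in>C x. f x y)" using C[OF x] nonneg[OF x] by (intro sum_nonneg) auto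
      moreover have "(\<Sum>y\<in>C x. f x y) \<le> infsum (f x) (B x)"
        by (rule finite_sum_le_infsum) (use C[OF x] nonneg[OF x] sm[OF x] in auto)
      ultimately show "0 \<le> (\<Sum>y\<in>C x. f x y) \<and> (\<Sum>y\<in>C x. f x y) \<le> infsum (f x) (B x)" ..
    qed
    finally show "(\<Sum>g\<in>F. \<Prod>x\<in>A. f x (g x)) \<le> (\<Prod>x\<in>A. infsum (f x) (B x))" .
  qed
qed

text \<open>The product formula is Parseval's identity in every slot, multiplied out over all tuples
  of basis vectors. Such a tuple is sent by \<open>t\<close> to its own unit vector, and unit
  vectors span a dense subspace.\<close>

lemma tensor_power_exists:
  fixes H :: "'a::ab_group_add hilb"
  assumes "hilbert_space H" and E: "orthonormal_basis H E"
  shows "\<exists>(T :: ((nat \<Rightarrow> 'a) \<Rightarrow> complex) hilb) t. is_tensor_power H n T t"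
proof -
  interpret hilbert_space H by fact
  \<comment> \<open>Extensional tuples, so that a tuple of basis vectors occurs only once as an
    index, whatever its values outside the slots; otherwise \<open>t e\<close> would not be a unit
    vector.\<close>
  define I where "I = PiE {1..n} (\<lambda>_. E)"
  define T where "T = l2_space I"
  define t where "t u = (\<lambda>e. if e \<in> I then \<Prod>i=1..n. cinner H (e i) (u i) else 0)" for u
  interpret T: hilbert_space T unfolding T_def by (rule hilbert_space_l2_space)
  have EC: "E \<subseteq> carrier H" and ortho: "\<And>e f. e \<in> E \<Longrightarrow> f \<in> E \<Longrightarrow> cinner H e f = (if e = f then 1 else 0)"
    using E by (auto simp: orthonormal_basis_def)
  note Parseval = orthonormal_basis_has_sum_cinner[OF E]
  have sq: "(\<lambda>e. (cmod (cinner H e x))\<^sup>2) summable_on E" if "x \<in> carrier H" for x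
  proof -
    have "(\<lambda>e. complex_of_real ((cmod (cinner H e x))\<^sup>2)) summable_on E"
      using has_sum_imp_summable[OF Parseval[OF that that]]
      by (simp only: complex_norm_square mult.commute)
    from summable_on_Re[OF this] show ?thesis by simp
  qed
  have tT: "t u \<in> carrier T" if u: "u \<in> tuples H n" for u
  proof -
    have "(\<lambda>e. \<Prod>i=1..n. (cmod (cinner H (e i) (u i)))\<^sup>2) summable_on I"
      unfolding I_def by (rule summable_on_prod_PiE) (use u in \<open>auto intro!: sq\<close>)
    hence "(\<lambda>e. (cmod (t u e))\<^sup>2) summable_on I"
      by (rule summable_on_cong[THEN iffD1, rotated]) (simp add: t_def prod_norm[symmetric] prod_power_distrib)
    thus ?thesis by (simp add: T_def t_def)
  qed
  have tip: "cinner T (t u) (t v) = (\<Prod>i=1..n. cinner H (u i) (v i))"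
    if u: "u \<in> tuples H n" and v: "v \<in> tuples H n" for u v
  proof -
    have "cinner T (t u) (t v)
        = (\<Sum>\<^sub>\<infinity>e\<in>I. \<Prod>i=1..n. cnj (cinner H (e i) (u i)) * cinner H (e i) (v i))"
      by (auto simp: T_def t_def prod.distrib cnj_prod intro!: infsum_cong)
    also have "\<dots> = (\<Prod>i=1..n. \<Sum>\<^sub>\<infinity>e\<in>E. cnj (cinner H e (u i)) * cinner H e (v i))"
      unfolding I_def
    proof (rule infsum_prod_PiE_abs)
      fix i assume "i \<in> {1..n}"
      hence "u i \<in> carrier H" "v i \<in> carrier H" using u v by auto
      from has_sum_imp_summable[OF Parseval[OF this]]
      show "(\<lambda>e. norm (cnj (cinner H e (u i)) * cinner H e (v i))) summable_on E"
        by (simp add: summable_on_iff_abs_summable_on_complex)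
    qed auto
    also have "\<dots> = (\<Prod>i=1..n. cinner H (u i) (v i))"
      using u v by (intro prod.cong refl infsumI Parseval) auto
    finally show ?thesis .
  qed
  have te: "t e = unit_vector e" if "e \<in> I" for e
  proof
    fix f
    have "(\<Prod>i=1..n. cinner H (f i) (e i)) = (if f = e then 1 else 0)" if f: "f \<in> I"
    proof (cases "f = e")
      case True
      have "cinner H (e i) (e i) = 1" if "i \<in> {1..n}" for i
        using ortho[of "e i" "e i"] \<open>e \<in> I\<close> that by (auto simp: I_def PiE_iff)
      with True show ?thesis by simp
    next
      case False
      then obtain i where i: "i \<in> {1..n}" "f i \<noteq> e i"
        using f \<open>e \<in> I\<close> unfolding I_def by (meson PiE_ext)
      hence "cinner H (f i) (e i) = 0"
        using ortho[of "f i" "e i"] f \<open>e \<in> I\<close> by (auto simp: I_def PiE_iff)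
      with i False show ?thesis by (auto intro: prod_zero)
    qed
    thus "t e f = unit_vector e f" using that by (auto simp: t_def)
  qed
  have "unit_vector ` I \<subseteq> t ` tuples H n"
  proof
    fix x assume "x \<in> unit_vector ` I"
    then obtain e where e: "e \<in> I" "x = unit_vector e" by blast
    hence "x = t e" using te by simp
    moreover have "e \<in> tuples H n" using e EC by (auto simp: I_def PiE_iff)
    ultimately show "x \<in> t ` tuples H n" by blast
  qed
  hence "T.span (unit_vector ` I) \<subseteq> T.span (t ` tuples H n)" by (rule T.span_mono)
  hence "hclosure T (T.span (unit_vector ` I)) \<subseteq> hclosure T (T.span (t ` tuples H n))"
    by (fastforce simp: T.hclosure_iff subset_iff)
  moreover have "hclosure T (T.span (unit_vector ` I)) = carrier T"
    unfolding T_def by (rule l2_space_unit_vectors_dense)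
  ultimately have "hclosure T (T.span (t ` tuples H n)) = carrier T"
    using T.hclosure_iff by blast
  hence "is_tensor_power H n T t"
    unfolding is_tensor_power_def using T.hilbert_space_axioms tT tip by blast
  thus ?thesis by blast
qed

section \<open>Bounded operators and their extension from dense subspaces\<close>

context hilbert_space
begin

lemma bounded_operatorD:
  assumes "bounded_operator H A"
  shows "x \<in> carrier H \<Longrightarrow> A x \<in> carrier H"
    and "x \<in> carrier H \<Longrightarrow> y \<in> carrier H \<Longrightarrow> A (x + y) = A x + A y"
    and "x \<in> carrier H \<Longrightarrow> A (smult H c x) = smult H c (A x)"
  using assms by (auto simp: bounded_operator_def)

lemma bounded_operator_bound:
  assumes "bounded_operator H A"
  obtains K where "K \<ge> 0" "\<And>x. x \<in> carrier H \<Longrightarrow> hnorm H (A x) \<le> K * hnorm H x"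
proof -
  from assms obtain K where K: "\<forall>x\<in>carrier H. hnorm H (A x) \<le> K * hnorm H x"
    by (auto simp: bounded_operator_def)
  have "hnorm H (A x) \<le> max K 0 * hnorm H x" if "x \<in> carrier H" for x
    using K that mult_right_mono[of K "max K 0" "hnorm H x"] by fastforce
  with that[of "max K 0"] show ?thesis by simp
qed

lemma bounded_operator_zero: "bounded_operator H A \<Longrightarrow> A 0 = 0"
  using bounded_operatorD(3)[of A 0 0] by simp

lemma bounded_operator_uminus: "bounded_operator H A \<Longrightarrow> x \<in> carrier H \<Longrightarrow> A (- x) = - A x"
  using bounded_operatorD(3)[of A x "-1"] bounded_operatorD(1)[of A x] by simp

lemma bounded_operator_diff:
  "bounded_operator H A \<Longrightarrow> x \<in> carrier H \<Longrightarrow> y \<in> carrier H \<Longrightarrow> A (x - y) = A x - A y"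
  using bounded_operatorD(2)[of A x "- y"] by (simp add: bounded_operator_uminus)

lemma bounded_operator_sum:
  assumes "bounded_operator H A" "\<And>i. i \<in> F \<Longrightarrow> f i \<in> carrier H"
  shows "A (sum f F) = (\<Sum>i\<in>F. A (f i))"
  using assms(2) by (induction F rule: infinite_finite_induct)
    (auto simp: bounded_operator_zero bounded_operatorD(2) assms(1))

lemma bounded_operator_compose:
  assumes A: "bounded_operator H A" and B: "bounded_operator H B"
  shows "bounded_operator H (\<lambda>x. A (B x))"
proof -
  obtain K where K: "K \<ge> 0" "\<And>x. x \<in> carrier H \<Longrightarrow> hnorm H (A x) \<le> K * hnorm H x"
    using bounded_operator_bound[OF A] by blast
  obtain L where L: "L \<ge> 0" "\<And>x. x \<in> carrier H \<Longrightarrow> hnorm H (B x) \<le> L * hnorm H x"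
    using bounded_operator_bound[OF B] by blast
  have "hnorm H (A (B x)) \<le> (K * L) * hnorm H x" if "x \<in> carrier H" for x
    using K(2)[OF bounded_operatorD(1)[OF B that]] mult_left_mono[OF L(2)[OF that] K(1)] by simp
  thus ?thesis using bounded_operatorD[OF A] bounded_operatorD[OF B]
    unfolding bounded_operator_def by auto
qed

lemma bounded_operator_power: "bounded_operator H A \<Longrightarrow> bounded_operator H (A ^^ k)"
proof (induction k)
  case 0
  thus ?case by (auto simp: bounded_operator_def intro!: exI[of _ 1])
next
  case (Suc k)
  thus ?case using bounded_operator_compose[of A "A ^^ k"] by (simp add: o_def)
qed

text \<open>Agreement passes from \<open>S\<close> to its span by linearity and to the closure by
  boundedness. This is the uniqueness behind every operator that is fixed by its values on simple
  tensors.\<close>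

lemma bounded_operators_eqI:
  assumes A: "bounded_operator H A" and B: "bounded_operator H B"
    and dense: "hclosure H (span S) = carrier H" and S: "S \<subseteq> carrier H"
    and eq: "\<And>x. x \<in> S \<Longrightarrow> A x = B x" and x: "x \<in> carrier H"
  shows "A x = B x"
proof (rule eq_if_hnorm_diff_small)
  note D = bounded_operatorD[OF A] bounded_operatorD[OF B]
  show c: "A x \<in> carrier H" "B x \<in> carrier H" using x D by auto
  obtain K where K: "K \<ge> 0" "\<And>x. x \<in> carrier H \<Longrightarrow> hnorm H (A x) \<le> K * hnorm H x"
    using bounded_operator_bound[OF A] by blast
  obtain L where L: "L \<ge> 0" "\<And>x. x \<in> carrier H \<Longrightarrow> hnorm H (B x) \<le> L * hnorm H x"
    using bounded_operator_bound[OF B] by blast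
  have "subspace {x \<in> carrier H. A x = B x}"
    by (rule subspaceI) (auto simp: D bounded_operator_zero[OF A] bounded_operator_zero[OF B])
  hence sp: "span S \<subseteq> {x \<in> carrier H. A x = B x}"
    using S eq by (intro span_minimal) auto
  fix e :: real assume e: "e > 0"
  have "x \<in> hclosure H (span S)" using dense x by simp
  moreover have "e / (K + L + 1) > 0" using e K L by (simp add: add_nonneg_pos)
  ultimately obtain y where y: "y \<in> span S" "y \<in> carrier H" "hnorm H (x - y) < e / (K + L + 1)"
    unfolding hclosure_iff by blast
  have "A y = B y" using sp y by auto
  hence "hnorm H (A x - B x) = hnorm H (A (x - y) - B (x - y))"
    using x y by (simp add: bounded_operator_diff[OF A] bounded_operator_diff[OF B])
  also have "\<dots> \<le> hnorm H (A (x - y)) + hnorm H (B (x - y))"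
    using hnorm_triangle[of "A (x - y)" "- B (x - y)"] x y D by simp
  also have "\<dots> \<le> K * hnorm H (x - y) + L * hnorm H (x - y)"
    using x y by (intro add_mono K L) auto
  also have "\<dots> \<le> (K + L + 1) * hnorm H (x - y)"
    using hnorm_nonneg[OF diff_closed[OF x y(2)]] by (simp add: algebra_simps)
  also have "\<dots> \<le> (K + L + 1) * (e / (K + L + 1))"
    using y(3) K L by (intro mult_left_mono) auto
  also have "\<dots> = e" using K L by simp
  finally show "hnorm H (A x - B x) \<le> e" .
qed

text \<open>Extension by continuity, for a linear relation instead of a function: the norm bound,
  applied to the difference of two pairs with the same first component, itself gives
  single-valuedness. So no well-definedness has to be shown beforehand.\<close>

lemma bounded_operator_closure_of_graph:
  assumes G: "\<And>x y. (x, y) \<in> G \<Longrightarrow> x \<in> carrier H \<and> y \<in> carrier H \<and> hnorm H y \<le> a * hnorm H x"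
    and add: "\<And>x y x' y'. (x, y) \<in> G \<Longrightarrow> (x', y') \<in> G \<Longrightarrow> (x + x', y + y') \<in> G"
    and scale: "\<And>x y c. (x, y) \<in> G \<Longrightarrow> (smult H c x, smult H c y) \<in> G"
    and dense: "hclosure H (Domain G) = carrier H" and a: "a \<ge> 0"
  obtains S where "bounded_operator H S" "S \<in> extensional (carrier H)"
    "\<And>x y. (x, y) \<in> G \<Longrightarrow> S x = y" "\<And>x. x \<in> carrier H \<Longrightarrow> hnorm H (S x) \<le> a * hnorm H x"
proof -
  \<comment> \<open>The closure of \<open>G\<close> in the product space; the operator is read off
    from it.\<close>
  define R where "R x y \<longleftrightarrow> x \<in> carrier H \<and> y \<in> carrier H \<and>
    (\<forall>e>0. \<exists>(x', y')\<in>G. hnorm H (x - x') < e \<and> hnorm H (y - y') < e)" for x y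
  have diff: "(x - x', y - y') \<in> G" if "(x, y) \<in> G" "(x', y') \<in> G" for x y x' y'
    using add[OF that(1) scale[OF that(2), of "-1"]] by simp
  have RG: "R x y" if "(x, y) \<in> G" for x y
    unfolding R_def using G[OF that] that by force
  have Rbound: "hnorm H y \<le> a * hnorm H x" if R: "R x y" for x y
  proof (rule field_le_epsilon)
    have xy: "x \<in> carrier H" "y \<in> carrier H" using R by (auto simp: R_def)
    fix e :: real assume "e > 0"
    define d where "d = e / (a + 1)"
    have "d > 0" using \<open>e > 0\<close> a by (simp add: d_def)
    then obtain x' y' where g: "(x', y') \<in> G" "hnorm H (x - x') < d" "hnorm H (y - y') < d"
      using R unfolding R_def by blast
    have "hnorm H y \<le> hnorm H y' + d"
      using hnorm_le_add_diff[of y y'] xy G[OF g(1)] g by simp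
    also have "\<dots> \<le> a * hnorm H x' + d" using G[OF g(1)] by simp
    also have "hnorm H x' \<le> hnorm H x + d"
      using hnorm_le_add_diff[of x' x] xy G[OF g(1)] g hnorm_minus_commute[of x x'] by simp
    hence "a * hnorm H x' + d \<le> a * (hnorm H x + d) + d" using a by (simp add: mult_left_mono)
    also have "\<dots> = a * hnorm H x + d * (a + 1)" by (simp add: algebra_simps)
    also have "d * (a + 1) = e" using a by (simp add: d_def)
    finally show "hnorm H y \<le> a * hnorm H x + e" .
  qed
  have Radd: "R (x + x') (y + y')" if R: "R x y" and R': "R x' y'" for x y x' y'
  proof -
    have c: "x \<in> carrier H" "y \<in> carrier H" "x' \<in> carrier H" "y' \<in> carrier H"
      using R R' by (auto simp: R_def)
    have "\<exists>(u, v)\<in>G. hnorm H (x + x' - u) < e \<and> hnorm H (y + y' - v) < e" if "e > 0" for e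
    proof -
      have e2: "e / 2 > 0" using that by simp
      obtain u v where u: "(u, v) \<in> G" "hnorm H (x - u) < e/2" "hnorm H (y - v) < e/2"
        using R e2 unfolding R_def by blast
      obtain u' v' where u': "(u', v') \<in> G" "hnorm H (x' - u') < e/2" "hnorm H (y' - v') < e/2"
        using R' e2 unfolding R_def by blast
      have "hnorm H (x + x' - (u + u')) < e"
        using hnorm_triangle[of "x - u" "x' - u'"] c G[OF u(1)] G[OF u'(1)] u u' by (simp add: add_diff_add)
      moreover have "hnorm H (y + y' - (v + v')) < e"
        using hnorm_triangle[of "y - v" "y' - v'"] c G[OF u(1)] G[OF u'(1)] u u' by (simp add: add_diff_add)
      ultimately show ?thesis using add[OF u(1) u'(1)] by blast
    qed
    thus ?thesis using c by (simp add: R_def)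
  qed
  have Rscale: "R (smult H c x) (smult H c y)" if R: "R x y" for c x y
  proof -
    have c: "x \<in> carrier H" "y \<in> carrier H" using R by (auto simp: R_def)
    have "\<exists>(u, v)\<in>G. hnorm H (smult H c x - u) < e \<and> hnorm H (smult H c y - v) < e" if e: "e > 0" for e
    proof -
      have "e / (cmod c + 1) > 0" using e by (simp add: add_nonneg_pos)
      then obtain u v where u: "(u, v) \<in> G" "hnorm H (x - u) < e / (cmod c + 1)" "hnorm H (y - v) < e / (cmod c + 1)"
        using R unfolding R_def by blast
      have *: "cmod c * r < e" if "0 \<le> r" "r < e / (cmod c + 1)" for r :: real
      proof -
        have "cmod c * r \<le> (cmod c + 1) * r" using that by (simp add: distrib_right)
        also have "\<dots> < (cmod c + 1) * (e / (cmod c + 1))"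
          using that by (intro mult_strict_left_mono) (auto simp: add_nonneg_pos)
        also have "\<dots> = e" using add_nonneg_pos[OF norm_ge_zero[of c], of 1] by simp
        finally show ?thesis .
      qed
      have "hnorm H (smult H c x - smult H c u) < e" "hnorm H (smult H c y - smult H c v) < e"
        using c G[OF u(1)] u *[of "hnorm H (x - u)"] *[of "hnorm H (y - v)"]
        by (auto simp flip: scale_right_diff_distrib)
      thus ?thesis using scale[OF u(1)] by blast
    qed
    thus ?thesis using c by (simp add: R_def)
  qed
  have Runique: "y = y'" if R: "R x y" and R': "R x y'" for x y y'
  proof -
    have "R 0 (y - y')" using Radd[OF R Rscale[OF R', of "-1"]] by simp
    hence "hnorm H (y - y') \<le> 0" "y - y' \<in> carrier H" using Rbound[of 0 "y - y'"] by (auto simp: R_def)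
    thus ?thesis by (metis hnorm_pos leD right_minus_eq)
  qed
  have Rex: "\<exists>y. R x y" if x: "x \<in> carrier H" for x
  proof -
    have "\<exists>(x', y')\<in>G. hnorm H (x - x') < 1 / Suc k" for k
    proof -
      have "x \<in> hclosure H (Domain G)" using dense x by simp
      hence "\<exists>x'\<in>Domain G \<inter> carrier H. hnorm H (x - x') < 1 / Suc k"
        unfolding hclosure_iff by (simp del: of_nat_Suc)
      thus ?thesis by blast
    qed
    then obtain g where "\<forall>k. case g k of (x', y') \<Rightarrow> (x', y') \<in> G \<and> hnorm H (x - x') < 1 / Suc k"
      by (metis (mono_tags, lifting) case_prodE case_prodI)
    hence "\<exists>xs ys. \<forall>k. (xs k, ys k) \<in> G \<and> hnorm H (x - xs k) < 1 / Suc k"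
      by (intro exI[of _ "\<lambda>k. fst (g k)"] exI[of _ "\<lambda>k. snd (g k)"]) (auto simp: case_prod_beta)
    then obtain xs ys where g: "\<And>k. (xs k, ys k) \<in> G" and d: "\<And>k. hnorm H (x - xs k) < 1 / Suc k"
      by blast
    have c: "xs k \<in> carrier H" "ys k \<in> carrier H" for k using G[OF g] by auto
    have small: "\<exists>N. \<forall>n\<ge>N. hnorm H (x - xs n) < e" if e: "e > 0" for e
    proof -
      obtain N where N: "1 / Suc N < e" using nat_approx_posE[OF e] by blast
      have "hnorm H (x - xs n) < e" if "n \<ge> N" for n
        using d[of n] N that frac_le[of 1 1 "Suc N" "Suc n"] by (simp del: of_nat_Suc)
      thus ?thesis by blast
    qed
    \<comment> \<open>The bound on \<open>G\<close>, applied to differences of pairs, carries the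
      Cauchy property from first to second components; completeness supplies the limit.\<close>
    obtain y where y: "y \<in> carrier H" "(\<lambda>n. hnorm H (ys n - y)) \<longlonglongrightarrow> 0"
    proof (rule Cauchy_converges[OF c(2)])
      fix e :: real assume e: "e > 0"
      have "e / (2 * (a + 1)) > 0" using e a by simp
      then obtain N where N: "\<forall>n\<ge>N. hnorm H (x - xs n) < e / (2 * (a + 1))" using small by blast
      have "hnorm H (ys m - ys n) < e" if "m \<ge> N" "n \<ge> N" for m n
      proof -
        have "hnorm H (ys m - ys n) \<le> a * hnorm H (xs m - xs n)" using G[OF diff[OF g g]] by blast
        also have "\<dots> \<le> (a + 1) * hnorm H (xs m - xs n)"
          using hnorm_nonneg[OF diff_closed[OF c(1) c(1)]] by (simp add: distrib_right)
        also have "hnorm H (xs m - xs n) \<le> hnorm H (x - xs m) + hnorm H (x - xs n)"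
          using hnorm_triangle_diff[OF c(1)[of m] x c(1)[of n]] hnorm_minus_commute[OF x c(1)[of m]] by simp
        also have "\<dots> < e / (2 * (a + 1)) + e / (2 * (a + 1))"
          using N that by (intro add_strict_mono) auto
        also have "\<dots> = e / (a + 1)"
          using field_sum_of_halves[of "e / (a + 1)"] by (simp only: divide_divide_eq_left mult.commute)
        finally have "hnorm H (ys m - ys n) < (a + 1) * (e / (a + 1))"
          using a by (simp add: mult_left_mono)
        thus ?thesis using a by simp
      qed
      thus "\<exists>N. \<forall>m\<ge>N. \<forall>n\<ge>N. hnorm H (ys m - ys n) < e" by blast
    qed blast
    have "\<exists>(x', y')\<in>G. hnorm H (x - x') < e \<and> hnorm H (y - y') < e" if e: "e > 0" for e
    proof -
      obtain N where N: "\<forall>n\<ge>N. hnorm H (x - xs n) < e" using small[OF e] by blast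
      obtain M where M: "\<forall>n\<ge>M. \<bar>hnorm H (ys n - y)\<bar> < e"
        using y(2) e unfolding lim_sequentially dist_real_def by force
      have "hnorm H (x - xs (max N M)) < e" "hnorm H (y - ys (max N M)) < e"
        using N M c y hnorm_minus_commute[of y "ys (max N M)"] by (auto dest!: spec[of _ "max N M"])
      thus ?thesis using g[of "max N M"] by blast
    qed
    thus ?thesis using x y by (auto simp: R_def)
  qed
  define S where "S = (\<lambda>x\<in>carrier H. THE y. R x y)"
  have S: "R x (S x)" if "x \<in> carrier H" for x
    unfolding S_def using that Rex[OF that] Runique by (auto intro: theI)
  have Seq: "S x = y" if "R x y" for x y
    using S[of x] that Runique[of x] by (auto simp: R_def)
  have Sb: "hnorm H (S x) \<le> a * hnorm H x" if "x \<in> carrier H" for x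
    using Rbound[OF S[OF that]] .
  have "bounded_operator H S"
    unfolding bounded_operator_def
  proof (intro conjI ballI allI exI[of _ a] Sb)
    show "S x \<in> carrier H" if "x \<in> carrier H" for x using S[OF that] by (simp add: R_def)
    show "S (x + y) = S x + S y" if "x \<in> carrier H" "y \<in> carrier H" for x y
      by (rule Seq[OF Radd[OF S[OF that(1)] S[OF that(2)]]])
    show "S (smult H c x) = smult H c (S x)" if "x \<in> carrier H" for c x
      by (rule Seq[OF Rscale[OF S[OF that]]])
  qed
  moreover have "S \<in> extensional (carrier H)" by (simp add: S_def)
  moreover have "S x = y" if "(x, y) \<in> G" for x y by (rule Seq[OF RG[OF that]])
  ultimately show ?thesis using that Sb by blast
qed

text \<open>Combinations are indexed by \<open>U\<close> and not by its image, because
  \<open>t\<close> need not be injective and the intended values are prescribed for each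
  \<open>u\<close> separately.\<close>

lemma span_image_explicit:
  "span (t ` U) = {\<Sum>u\<in>F. smult H (c u) (t u) | F c. finite F \<and> F \<subseteq> U}"
proof
  show "span (t ` U) \<subseteq> {\<Sum>u\<in>F. smult H (c u) (t u) | F c. finite F \<and> F \<subseteq> U}"
  proof
    fix x assume "x \<in> span (t ` U)"
    then obtain F' r where F': "finite F'" "F' \<subseteq> t ` U" "x = (\<Sum>a\<in>F'. smult H (r a) a)"
      unfolding span_explicit by blast
    obtain F where F: "F \<subseteq> U" "inj_on t F" "F' = t ` F"
      using F'(2) by (auto simp: subset_image_inj)
    have "x = (\<Sum>u\<in>F. smult H (r (t u)) (t u))"
      unfolding F'(3) F(3) by (simp add: sum.reindex[OF F(2)])
    moreover have "finite F" using F F'(1) by (simp add: finite_image_iff)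
    ultimately show "x \<in> {\<Sum>u\<in>F. smult H (c u) (t u) | F c. finite F \<and> F \<subseteq> U}"
      using F(1) by (intro CollectI exI[of _ F] exI[of _ "\<lambda>u. r (t u)"]) simp
  qed
next
  show "{\<Sum>u\<in>F. smult H (c u) (t u) | F c. finite F \<and> F \<subseteq> U} \<subseteq> span (t ` U)"
    by (clarify, rule span_sum, rule span_scale, rule span_base, blast)
qed

text \<open>The bound on combinations does two things: every linear relation among the
  \<open>t u\<close> must hold among the \<open>s u\<close>, so the assignment is consistent, and
  the resulting linear map is bounded.\<close>

lemma bounded_extension:
  assumes t: "\<And>u. u \<in> U \<Longrightarrow> t u \<in> carrier H" and s: "\<And>u. u \<in> U \<Longrightarrow> s u \<in> carrier H"
    and dense: "hclosure H (span (t ` U)) = carrier H" and a: "a \<ge> 0"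
    and bound: "\<And>F c. finite F \<Longrightarrow> F \<subseteq> U \<Longrightarrow>
      hnorm H (\<Sum>u\<in>F. smult H (c u) (s u)) \<le> a * hnorm H (\<Sum>u\<in>F. smult H (c u) (t u))"
  obtains S where "bounded_operator H S" "S \<in> extensional (carrier H)"
    "\<And>u. u \<in> U \<Longrightarrow> S (t u) = s u" "\<And>x. x \<in> carrier H \<Longrightarrow> hnorm H (S x) \<le> a * hnorm H x"
proof -
  define G where "G = {((\<Sum>u\<in>F. smult H (c u) (t u)), (\<Sum>u\<in>F. smult H (c u) (s u))) | F c.
    finite F \<and> F \<subseteq> U}"
  show ?thesis
  proof (rule bounded_operator_closure_of_graph[of G a])
    show "x \<in> carrier H \<and> y \<in> carrier H \<and> hnorm H y \<le> a * hnorm H x" if "(x, y) \<in> G" for x y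
      using that t s bound unfolding G_def by (auto intro!: sum_closed smult_closed simp: subset_iff)
    show "(x + x', y + y') \<in> G" if g: "(x, y) \<in> G" and g': "(x', y') \<in> G" for x y x' y'
    proof -
      obtain F c where F: "finite F" "F \<subseteq> U" "x = (\<Sum>u\<in>F. smult H (c u) (t u))" "y = (\<Sum>u\<in>F. smult H (c u) (s u))"
        using g by (auto simp: G_def)
      obtain F' c' where F': "finite F'" "F' \<subseteq> U" "x' = (\<Sum>u\<in>F'. smult H (c' u) (t u))" "y' = (\<Sum>u\<in>F'. smult H (c' u) (s u))"
        using g' by (auto simp: G_def)
      \<comment> \<open>Coefficients on the union of the supports; on the overlap both
        contribute.\<close>
      define d where "d u = (if u \<in> F then c u else 0) + (if u \<in> F' then c' u else 0)" for u
      have comb: "(\<Sum>u\<in>F. smult H (c u) (r u)) + (\<Sum>u\<in>F'. smult H (c' u) (r u)) = (\<Sum>u\<in>F \<union> F'. smult H (d u) (r u))" for r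
      proof -
        have "(\<Sum>u\<in>F. smult H (c u) (r u)) = (\<Sum>u\<in>F \<union> F'. smult H (if u \<in> F then c u else 0) (r u))"
          using F F' by (intro sum.mono_neutral_cong_left) auto
        moreover have "(\<Sum>u\<in>F'. smult H (c' u) (r u)) = (\<Sum>u\<in>F \<union> F'. smult H (if u \<in> F' then c' u else 0) (r u))"
          using F F' by (intro sum.mono_neutral_cong_left) auto
        ultimately show ?thesis by (simp only: d_def scale_left_distrib sum.distrib)
      qed
      show ?thesis unfolding F F' comb G_def using F F' by blast
    qed
    show "(smult H k x, smult H k y) \<in> G" if g: "(x, y) \<in> G" for x y k
    proof -
      obtain F c where F: "finite F" "F \<subseteq> U" "x = (\<Sum>u\<in>F. smult H (c u) (t u))" "y = (\<Sum>u\<in>F. smult H (c u) (s u))"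
        using g by (auto simp: G_def)
      show ?thesis unfolding F G_def scale_sum_right scale_scale using F
        by (intro CollectI exI[of _ F] exI[of _ "\<lambda>u. k * c u"]) simp
    qed
    have "Domain G = span (t ` U)" unfolding span_image_explicit G_def by blast
    thus "hclosure H (Domain G) = carrier H" using dense by simp
    fix S assume S: "bounded_operator H S" "S \<in> extensional (carrier H)"
      "\<And>x y. (x, y) \<in> G \<Longrightarrow> S x = y" "\<And>x. x \<in> carrier H \<Longrightarrow> hnorm H (S x) \<le> a * hnorm H x"
    have "(t u, s u) \<in> G" if "u \<in> U" for u
      unfolding G_def using that by (intro CollectI exI[of _ "{u}"] exI[of _ "\<lambda>_. 1"]) simp
    with S show thesis using that by blast
  qed (fact a)
qed

end

text \<open>An arbitrary realisation \<open>T\<close>, \<open>t\<close> of the tensor power, known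
  only through the product formula and density. Every statement about simple tensors below is
  derived from inner products; the basis \<open>E\<close> of \<open>H\<close> is there for the Schur
  product argument.\<close>

locale tensor_power_space = H: hilbert_space H + T: hilbert_space T
  for H :: "'a::ab_group_add hilb" and T :: "'b::ab_group_add hilb" +
  fixes n :: nat and t :: "(nat \<Rightarrow> 'a) \<Rightarrow> 'b" and E :: "'a set"
  assumes basis: "orthonormal_basis H E"
    and simple_closed: "u \<in> tuples H n \<Longrightarrow> t u \<in> carrier T"
    and cinner_simple: "u \<in> tuples H n \<Longrightarrow> v \<in> tuples H n \<Longrightarrow>
      cinner T (t u) (t v) = (\<Prod>i=1..n. cinner H (u i) (v i))"
    and dense: "hclosure T (T.span (t ` tuples H n)) = carrier T"
begin

lemma hnorm_simple: "u \<in> tuples H n \<Longrightarrow> hnorm T (t u) = (\<Prod>i=1..n. hnorm H (u i))"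
proof -
  assume u: "u \<in> tuples H n"
  have "cinner T (t u) (t u) = (\<Prod>i=1..n. of_real ((hnorm H (u i))\<^sup>2))"
    unfolding cinner_simple[OF u u] using u by (intro prod.cong refl H.cinner_self) auto
  hence "(hnorm T (t u))\<^sup>2 = (\<Prod>i=1..n. (hnorm H (u i))\<^sup>2)"
    using u by (simp add: T.hnorm_power2 simple_closed del: of_real_power flip: of_real_prod)
  also have "\<dots> = (\<Prod>i=1..n. hnorm H (u i))\<^sup>2" by (simp add: prod_power_distrib)
  finally show ?thesis
    by (rule power2_eq_imp_eq) (use u in \<open>auto intro!: prod_nonneg H.hnorm_nonneg Pi_mem[OF u] simp: simple_closed\<close>)
qed

text \<open>Here tensor norms become quadratic forms of products of Gram kernels. Indices
  \<open>i\<close> with tuples \<open>w i\<close> allow the tuples to be altered slot by slot, even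
  to coincide, while the index set stays the same.\<close>

lemma hnorm_combination_power2:
  assumes "\<And>i. i \<in> F \<Longrightarrow> w i \<in> tuples H n"
  shows "(hnorm T (\<Sum>i\<in>F. smult T (c i) (t (w i))))\<^sup>2
    = Re (\<Sum>i\<in>F. \<Sum>j\<in>F. cnj (c i) * c j * (\<Prod>k=1..n. cinner H (w i k) (w j k)))"
proof -
  have "cinner T (\<Sum>i\<in>F. smult T (c i) (t (w i))) (\<Sum>i\<in>F. smult T (c i) (t (w i)))
      = (\<Sum>i\<in>F. \<Sum>j\<in>F. cnj (c i) * c j * (\<Prod>k=1..n. cinner H (w i k) (w j k)))"
    using assms by (simp add: T.cinner_sum_sum simple_closed cinner_simple)
  thus ?thesis using assms by (simp add: T.hnorm_power2 simple_closed)
qed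

text \<open>If \<open>\<parallel>A\<parallel> \<le> a\<close> then \<open>a\<^sup>2 \<langle>x, y\<rangle> - \<langle>A x, A y\<rangle>\<close> is a positive semidefinite kernel, and it stays one
  after multiplication with the Gram kernels of the other slots.\<close>

lemma hnorm_combination_slot:
  assumes F: "finite F" and w: "\<And>i. i \<in> F \<Longrightarrow> w i \<in> tuples H n" and m: "m \<in> {1..n}"
    and A: "bounded_operator H A" and a: "0 \<le> a"
    and bound: "\<And>x. x \<in> carrier H \<Longrightarrow> hnorm H (A x) \<le> a * hnorm H x"
  shows "hnorm T (\<Sum>i\<in>F. smult T (c i) (t ((w i)(m := A (w i m)))))
    \<le> a * hnorm T (\<Sum>i\<in>F. smult T (c i) (t (w i)))"
proof -
  have wc: "w i k \<in> carrier H" if "i \<in> F" "k \<in> {1..n}" for i k using Pi_mem[OF w[OF that(1)] that(2)] .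
  have Ac: "A x \<in> carrier H" if "x \<in> carrier H" for x using H.bounded_operatorD[OF A] that by blast
  have w': "(w i)(m := A (w i m)) \<in> tuples H n" if "i \<in> F" for i
    using w[OF that] Ac[OF wc[OF that m]] by auto
  define K where "K = {1..n} - {m}"
  have K: "(\<Prod>k=1..n. f k) = f m * (\<Prod>k\<in>K. f k)" for f :: "nat \<Rightarrow> complex"
    unfolding K_def using m by (intro prod.remove) auto
  define P where "P i j = of_real (a\<^sup>2) * cinner H (w i m) (w j m) - cinner H (A (w i m)) (A (w j m))" for i j
  have "psd_kernel F P"
    unfolding psd_kernel_def
  proof
    fix d
    \<comment> \<open>With this \<open>x\<close>, the quadratic form of \<open>P\<close> at
      \<open>d\<close> is \<open>a\<^sup>2 \<parallel>x\<parallel>\<^sup>2 - \<parallel>A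
      x\<parallel>\<^sup>2\<close>.\<close>
    define x where "x = (\<Sum>i\<in>F. smult H (d i) (w i m))"
    have x: "x \<in> carrier H" unfolding x_def using wc m by auto
    have Ax: "A x = (\<Sum>i\<in>F. smult H (d i) (A (w i m)))"
      unfolding x_def using wc m by (simp add: H.bounded_operator_sum[OF A] H.bounded_operatorD(3)[OF A])
    have "(\<Sum>i\<in>F. \<Sum>j\<in>F. cnj (d i) * d j * P i j)
      = of_real (a\<^sup>2) * (\<Sum>i\<in>F. \<Sum>j\<in>F. cnj (d i) * d j * cinner H (w i m) (w j m))
        - (\<Sum>i\<in>F. \<Sum>j\<in>F. cnj (d i) * d j * cinner H (A (w i m)) (A (w j m)))"
      unfolding sum_distrib_left sum_subtractf[symmetric] by (simp add: P_def algebra_simps)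
    also have "\<dots> = of_real (a\<^sup>2) * cinner H x x - cinner H (A x) (A x)"
      unfolding Ax unfolding x_def using wc m Ac by (simp add: H.cinner_sum_sum)
    finally have "Re (\<Sum>i\<in>F. \<Sum>j\<in>F. cnj (d i) * d j * P i j) = (a * hnorm H x)\<^sup>2 - (hnorm H (A x))\<^sup>2"
      using x Ac[OF x] by (simp add: H.cinner_self power_mult_distrib flip: of_real_mult of_real_power)
    also have "\<dots> \<ge> 0" using bound[OF x] Ac[OF x] by (simp add: power_mono)
    finally show "0 \<le> Re (\<Sum>i\<in>F. \<Sum>j\<in>F. cnj (d i) * d j * P i j)" .
  qed
  hence "psd_kernel F (\<lambda>i j. P i j * (\<Prod>k\<in>K. cinner H (w i k) (w j k)))"
    by (rule H.psd_kernel_times_prod_Gram[OF basis]) (auto simp: K_def wc)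
  hence "0 \<le> Re (\<Sum>i\<in>F. \<Sum>j\<in>F. cnj (c i) * c j * (P i j * (\<Prod>k\<in>K. cinner H (w i k) (w j k))))"
    by (auto simp: psd_kernel_def)
  also have "(\<Sum>i\<in>F. \<Sum>j\<in>F. cnj (c i) * c j * (P i j * (\<Prod>k\<in>K. cinner H (w i k) (w j k))))
    = of_real (a\<^sup>2) * (\<Sum>i\<in>F. \<Sum>j\<in>F. cnj (c i) * c j * (\<Prod>k=1..n. cinner H (w i k) (w j k)))
      - (\<Sum>i\<in>F. \<Sum>j\<in>F. cnj (c i) * c j *
          (\<Prod>k=1..n. cinner H (((w i)(m := A (w i m))) k) (((w j)(m := A (w j m))) k)))"
  proof -
    have "(\<Prod>k\<in>K. cinner H (((w i)(m := A (w i m))) k) (((w j)(m := A (w j m))) k))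
       = (\<Prod>k\<in>K. cinner H (w i k) (w j k))" for i j
      by (intro prod.cong) (auto simp: K_def)
    thus ?thesis
      unfolding sum_distrib_left sum_subtractf[symmetric] K by (simp add: P_def algebra_simps)
  qed
  also have "Re \<dots> = (a * hnorm T (\<Sum>i\<in>F. smult T (c i) (t (w i))))\<^sup>2
      - (hnorm T (\<Sum>i\<in>F. smult T (c i) (t ((w i)(m := A (w i m))))))\<^sup>2"
    using hnorm_combination_power2[of F w c, OF w]
      hnorm_combination_power2[of F "\<lambda>i. (w i)(m := A (w i m))" c, OF w']
    by (simp add: power_mult_distrib flip: of_real_mult of_real_power)
  finally have "(hnorm T (\<Sum>i\<in>F. smult T (c i) (t ((w i)(m := A (w i m))))))\<^sup>2
      \<le> (a * hnorm T (\<Sum>i\<in>F. smult T (c i) (t (w i))))\<^sup>2" by simp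
  thus ?thesis
    by (rule power2_le_imp_le) (intro mult_nonneg_nonneg a T.hnorm_nonneg T.sum_closed
      T.smult_closed simple_closed w)
qed

text \<open>The operators are applied one slot at a time, each contributing its factor;
  \<open>S\<close> is the set of slots already treated.\<close>

lemma hnorm_combination_slots:
  assumes F: "finite F" and w: "\<And>i. i \<in> F \<Longrightarrow> w i \<in> tuples H n" and S: "S \<subseteq> {1..n}"
    and A: "\<And>k. k \<in> S \<Longrightarrow> bounded_operator H (A k)" and a: "\<And>k. k \<in> S \<Longrightarrow> 0 \<le> a k"
    and bound: "\<And>k x. k \<in> S \<Longrightarrow> x \<in> carrier H \<Longrightarrow> hnorm H (A k x) \<le> a k * hnorm H x"
  shows "hnorm T (\<Sum>i\<in>F. smult T (c i) (t (\<lambda>k. if k \<in> S then A k (w i k) else w i k)))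
    \<le> (\<Prod>k\<in>S. a k) * hnorm T (\<Sum>i\<in>F. smult T (c i) (t (w i)))"
proof -
  have "finite S" using S finite_subset by blast
  thus ?thesis using S A a bound
  proof (induction S)
    case (insert m S)
    define v where "v i = (\<lambda>k. if k \<in> S then A k (w i k) else w i k)" for i
    have v: "v i \<in> tuples H n" if "i \<in> F" for i
    proof
      fix k assume "k \<in> {1..n}"
      hence "w i k \<in> carrier H" using w[OF that] by auto
      thus "v i k \<in> carrier H" using H.bounded_operatorD(1)[OF insert.prems(2)] by (auto simp: v_def)
    qed
    have "(\<lambda>k. if k \<in> insert m S then A k (w i k) else w i k) = (v i)(m := A m (v i m))" for i
      using insert.hyps by (auto simp: v_def)
    hence "hnorm T (\<Sum>i\<in>F. smult T (c i) (t (\<lambda>k. if k \<in> insert m S then A k (w i k) else w i k)))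
        = hnorm T (\<Sum>i\<in>F. smult T (c i) (t ((v i)(m := A m (v i m)))))" by simp
    also have "\<dots> \<le> a m * hnorm T (\<Sum>i\<in>F. smult T (c i) (t (v i)))"
      by (rule hnorm_combination_slot[OF F v]) (use insert.prems in auto)
    also have "\<dots> \<le> a m * ((\<Prod>k\<in>S. a k) * hnorm T (\<Sum>i\<in>F. smult T (c i) (t (w i))))"
      unfolding v_def using insert by (intro mult_left_mono insert.IH) auto
    finally show ?case using insert.hyps by (simp add: mult.assoc)
  qed simp
qed

text \<open>As \<open>t\<close> is known only through inner products, equality is shown by expanding
  \<open>\<parallel>t u - t v\<parallel>\<^sup>2\<close> into four equal products that
  cancel.\<close>

lemma simple_cong:
  assumes u: "u \<in> tuples H n" and eq: "\<And>i. i \<in> {1..n} \<Longrightarrow> u i = v i"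
  shows "t u = t v"
proof -
  have v: "v \<in> tuples H n" using u eq by (auto simp: Pi_iff)
  have *: "(\<Prod>i=1..n. cinner H (x i) (y i)) = (\<Prod>i=1..n. cinner H (u i) (u i))"
    if "x \<in> {u, v}" "y \<in> {u, v}" for x y
    using that eq by (intro prod.cong) auto
  have "cinner T (t u - t v) (t u - t v) = 0"
    using u v *[of u u] *[of u v] *[of v u] *[of v v]
    by (simp add: T.cinner_diff_left T.cinner_diff_right simple_closed cinner_simple)
  hence "hnorm T (t u - t v) = 0" by (simp add: hnorm_def)
  thus ?thesis using simple_closed[OF u] simple_closed[OF v] by simp
qed

lemma operators_eqI:
  assumes "bounded_operator T R" "bounded_operator T S"
    "\<And>u. u \<in> tuples H n \<Longrightarrow> R (t u) = S (t u)" "x \<in> carrier T"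
  shows "R x = S x"
  by (rule T.bounded_operators_eqI[OF assms(1,2) dense]) (use assms simple_closed in auto)

lemma tensor_operator_exists:
  assumes A: "\<And>i. i \<in> {1..n} \<Longrightarrow> bounded_operator H (A i)" and a: "\<And>i. i \<in> {1..n} \<Longrightarrow> 0 \<le> a i"
    and bound: "\<And>i x. i \<in> {1..n} \<Longrightarrow> x \<in> carrier H \<Longrightarrow> hnorm H (A i x) \<le> a i * hnorm H x"
  obtains S where "bounded_operator T S" "S \<in> extensional (carrier T)"
    "\<And>u. u \<in> tuples H n \<Longrightarrow> S (t u) = t (\<lambda>i. A i (u i))"
    "\<And>x. x \<in> carrier T \<Longrightarrow> hnorm T (S x) \<le> (\<Prod>i=1..n. a i) * hnorm T x"
proof (rule T.bounded_extension[of "tuples H n" t "\<lambda>u. t (\<lambda>i. A i (u i))" "\<Prod>i=1..n. a i"])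
  have c: "(\<lambda>i. A i (u i)) \<in> tuples H n" if "u \<in> tuples H n" for u
    by (rule Pi_I) (rule H.bounded_operatorD(1)[OF A Pi_mem[OF that]])
  show "t (\<lambda>i. A i (u i)) \<in> carrier T" if "u \<in> tuples H n" for u
    using c[OF that] by (rule simple_closed)
  show "0 \<le> (\<Prod>i=1..n. a i)" using a by (intro prod_nonneg) auto
  fix F c assume F: "finite F" "F \<subseteq> tuples H n"
  \<comment> \<open>The tuples differ only outside the slots, where
    \<open>hnorm_combination_slots\<close> leaves \<open>u\<close> unchanged.\<close>
  have "t (\<lambda>i. A i (u i)) = t (\<lambda>k. if k \<in> {1..n} then A k (u k) else u k)" if "u \<in> F" for u
    using c F that by (intro simple_cong) auto
  hence "(\<Sum>u\<in>F. smult T (c u) (t (\<lambda>i. A i (u i))))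
      = (\<Sum>u\<in>F. smult T (c u) (t (\<lambda>k. if k \<in> {1..n} then A k (u k) else u k)))"
    by (intro sum.cong) auto
  thus "hnorm T (\<Sum>u\<in>F. smult T (c u) (t (\<lambda>i. A i (u i))))
      \<le> (\<Prod>i=1..n. a i) * hnorm T (\<Sum>u\<in>F. smult T (c u) (t u))"
    using hnorm_combination_slots[of F "\<lambda>u. u" "{1..n}" A a c] F A a bound by auto
qed (use dense simple_closed that in auto)

lemma permutation_closed: "p permutes {1..n} \<Longrightarrow> u \<in> tuples H n \<Longrightarrow> (\<lambda>i. u (p i)) \<in> tuples H n"
  by (rule Pi_I) (metis Pi_mem permutes_in_image)

text \<open>Permuting the slots only reorders the factors in each product of inner products, so
  norms of combinations are preserved. A contraction is enough here, since the inverse permutation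
  gives one as well.\<close>

lemma permutation_contraction_exists:
  assumes p: "p permutes {1..n}"
  obtains U where "bounded_operator T U" "U \<in> extensional (carrier T)"
    "\<And>u. u \<in> tuples H n \<Longrightarrow> U (t u) = t (\<lambda>i. u (p i))"
    "\<And>x. x \<in> carrier T \<Longrightarrow> hnorm T (U x) \<le> hnorm T x"
proof (rule T.bounded_extension[of "tuples H n" t "\<lambda>u. t (\<lambda>i. u (p i))" 1])
  show "t (\<lambda>i. u (p i)) \<in> carrier T" if "u \<in> tuples H n" for u
    using permutation_closed[OF p that] by (rule simple_closed)
  fix F c assume F: "finite F" "F \<subseteq> tuples H n"
  have "(\<Prod>k=1..n. cinner H (u (p k)) (v (p k))) = (\<Prod>k=1..n. cinner H (u k) (v k))" for u v
    using prod.permute[OF p, of "\<lambda>k. cinner H (u k) (v k)"] by (simp add: o_def)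
  hence "(hnorm T (\<Sum>u\<in>F. smult T (c u) (t (\<lambda>i. u (p i)))))\<^sup>2 = (hnorm T (\<Sum>u\<in>F. smult T (c u) (t u)))\<^sup>2"
    using hnorm_combination_power2[of F "\<lambda>u. u" c] hnorm_combination_power2[of F "\<lambda>u i. u (p i)" c]
      F(2) permutation_closed[OF p] by (simp add: subset_iff)
  hence "hnorm T (\<Sum>u\<in>F. smult T (c u) (t (\<lambda>i. u (p i)))) = hnorm T (\<Sum>u\<in>F. smult T (c u) (t u))"
    by (rule power2_eq_imp_eq)
      (intro T.hnorm_nonneg T.sum_closed T.smult_closed simple_closed permutation_closed[OF p] subsetD[OF F(2)],
        assumption)+
  thus "hnorm T (\<Sum>u\<in>F. smult T (c u) (t (\<lambda>i. u (p i)))) \<le> 1 * hnorm T (\<Sum>u\<in>F. smult T (c u) (t u))"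
    by simp
qed (use dense simple_closed that in auto)

end

context hilbert_space
begin

text \<open>Mutually inverse contractions are isometries. Polarisation then recovers the inner
  product: its real part from \<open>\<parallel>x + y\<parallel>\<^sup>2\<close>, its imaginary part
  after replacing \<open>y\<close> by \<open>\<i> y\<close>.\<close>

lemma unitary_operatorI:
  assumes U: "bounded_operator H U" and V: "bounded_operator H V"
    and UV: "\<And>x. x \<in> carrier H \<Longrightarrow> U (V x) = x" and VU: "\<And>x. x \<in> carrier H \<Longrightarrow> V (U x) = x"
    and nU: "\<And>x. x \<in> carrier H \<Longrightarrow> hnorm H (U x) \<le> hnorm H x"
    and nV: "\<And>x. x \<in> carrier H \<Longrightarrow> hnorm H (V x) \<le> hnorm H x"
  shows "unitary_operator H U"
  unfolding unitary_operator_def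
proof (intro conjI U ballI)
  note D = bounded_operatorD[OF U] bounded_operatorD[OF V]
  show "U ` carrier H = carrier H" using D UV by (force simp: image_iff)
  have n: "hnorm H (U x) = hnorm H x" if "x \<in> carrier H" for x
    using nU[OF that] nV[OF D(1)[OF that]] VU[OF that] by simp
  have re: "Re (cinner H (U x) (U y)) = Re (cinner H x y)" if "x \<in> carrier H" "y \<in> carrier H" for x y
    using hnorm_add_power2[OF that] hnorm_add_power2[OF D(1)[OF that(1)] D(1)[OF that(2)]] that
    by (simp add: n flip: D(2))
  fix x y assume x: "x \<in> carrier H" and y: "y \<in> carrier H"
  have "Re (cinner H (U x) (U (smult H \<i> y))) = Re (cinner H x (smult H \<i> y))"
    using x y by (intro re) auto
  hence "Im (cinner H (U x) (U y)) = Im (cinner H x y)"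
    using x y D by (simp add: cinner_smult_right)
  with re[OF x y] show "cinner H (U x) (U y) = cinner H x y" by (simp add: complex_eq_iff)
qed

end

context tensor_power_space
begin

lemma permutation_unitary_exists:
  assumes p: "p permutes {1..n}"
  shows "\<exists>U. U \<in> extensional (carrier T) \<and> unitary_operator T U \<and>
             (\<forall>u\<in>tuples H n. U (t u) = t (\<lambda>i. u (p i)))"
proof -
  obtain U where U: "bounded_operator T U" "U \<in> extensional (carrier T)"
    "\<And>u. u \<in> tuples H n \<Longrightarrow> U (t u) = t (\<lambda>i. u (p i))"
    "\<And>x. x \<in> carrier T \<Longrightarrow> hnorm T (U x) \<le> hnorm T x"
    by (rule permutation_contraction_exists[OF p]) (rule that; assumption)
  have p': "inv p permutes {1..n}" using p by (rule permutes_inv)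
  obtain V where V: "bounded_operator T V"
    "\<And>u. u \<in> tuples H n \<Longrightarrow> V (t u) = t (\<lambda>i. u (inv p i))"
    "\<And>x. x \<in> carrier T \<Longrightarrow> hnorm T (V x) \<le> hnorm T x"
    by (rule permutation_contraction_exists[OF p']) (rule that; assumption)
  have id: "bounded_operator T (\<lambda>x. x)"
    unfolding bounded_operator_def by (auto intro: exI[of _ 1])
  have UV: "U (V x) = x" if "x \<in> carrier T" for x
    using T.bounded_operator_compose[OF U(1) V(1)] id
  proof (rule operators_eqI)
    fix u assume u: "u \<in> tuples H n"
    show "U (V (t u)) = t u"
      using u permutation_closed[OF p' u] by (simp add: U(3) V(2) permutes_inverses[OF p])
  qed (fact that)
  have VU: "V (U x) = x" if "x \<in> carrier T" for x
    using T.bounded_operator_compose[OF V(1) U(1)] id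
  proof (rule operators_eqI)
    fix u assume u: "u \<in> tuples H n"
    show "V (U (t u)) = t u"
      using u permutation_closed[OF p u] by (simp add: U(3) V(2) permutes_inverses[OF p])
  qed (fact that)
  have "unitary_operator T U"
    by (rule T.unitary_operatorI[OF U(1) V(1) UV VU U(4) V(3)])
  with U show ?thesis by blast
qed

end

section \<open>Operators on the chosen model of the tensor power\<close>

lemma tensor_power_space_model:
  assumes "hilbert_space H" "orthonormal_basis H E"
  shows "tensor_power_space H (tensor_power H n) n (simple_tensor H n) E"
proof -
  have "is_tensor_power H n (tensor_power H n) (simple_tensor H n)"
  proof -
    have "\<exists>x :: ((nat \<Rightarrow> 'a) \<Rightarrow> complex) hilb \<times> ((nat \<Rightarrow> 'a) \<Rightarrow> (nat \<Rightarrow> 'a) \<Rightarrow> complex).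
        case x of (T, t) \<Rightarrow> is_tensor_power H n T t"
      using tensor_power_exists[OF assms, of n] by auto
    from someI_ex[OF this] show ?thesis
      unfolding tensor_power_def simple_tensor_def tensor_model_def by (simp only: case_prod_unfold)
  qed
  thus ?thesis using assms
    unfolding is_tensor_power_def tensor_power_space_def tensor_power_space_axioms_def by blast
qed

locale hilbert_tensor_power = hilbert_space H for H :: "'a::ab_group_add hilb" +
  fixes n :: nat and E :: "'a set"
  assumes onb: "orthonormal_basis H E"

sublocale hilbert_tensor_power \<subseteq> T: tensor_power_space H "tensor_power H n" n "simple_tensor H n" E
  by (rule tensor_power_space_model[OF hilbert_space_axioms onb])

context hilbert_tensor_power
begin

text \<open>The description has a solution, and two solutions agree on the dense span of simple
  tensors, hence on the carrier; \<open>extensional\<close> settles the remaining values.\<close>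

lemma perm_operator:
  assumes p: "p permutes {1..n}"
  shows "unitary_operator (tensor_power H n) (perm_operator H n p)"
    and "\<And>u. u \<in> tuples H n \<Longrightarrow> perm_operator H n p (simple_tensor H n u) = simple_tensor H n (\<lambda>i. u (p i))"
proof -
  let ?P = "\<lambda>U. U \<in> extensional (carrier (tensor_power H n)) \<and> unitary_operator (tensor_power H n) U \<and>
    (\<forall>u\<in>tuples H n. U (simple_tensor H n u) = simple_tensor H n (\<lambda>i. u (p i)))"
  obtain U where U: "?P U" using T.permutation_unitary_exists[OF p] by blast
  have "V = U" if V: "?P V" for V
  proof (rule extensionalityI[of _ "carrier (tensor_power H n)"])
    show "V x = U x" if "x \<in> carrier (tensor_power H n)" for x
      by (rule T.operators_eqI) (use U V that in \<open>auto simp: unitary_operator_def\<close>)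
  qed (use U V in auto)
  hence "?P (perm_operator H n p)" unfolding perm_operator_def using U by (intro theI[of ?P]) auto
  thus "unitary_operator (tensor_power H n) (perm_operator H n p)"
    and "\<And>u. u \<in> tuples H n \<Longrightarrow> perm_operator H n p (simple_tensor H n u) = simple_tensor H n (\<lambda>i. u (p i))"
    by auto
qed

lemma perm_operator_bounded:
  "p permutes {1..n} \<Longrightarrow> bounded_operator (tensor_power H n) (perm_operator H n p)"
  using perm_operator(1) by (simp add: unitary_operator_def)

lemma tensor_operator_spec:
  assumes A: "\<And>i. i \<in> {1..n} \<Longrightarrow> bounded_operator H (A i)"
  shows "bounded_operator (tensor_power H n) (tensor_operator H n A) \<and>
    (\<forall>u\<in>tuples H n. tensor_operator H n A (simple_tensor H n u) = simple_tensor H n (\<lambda>i. A i (u i)))"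
proof -
  let ?P = "\<lambda>S. S \<in> extensional (carrier (tensor_power H n)) \<and> bounded_operator (tensor_power H n) S \<and>
    (\<forall>u\<in>tuples H n. S (simple_tensor H n u) = simple_tensor H n (\<lambda>i. A i (u i)))"
  have "\<exists>a\<ge>0. \<forall>x\<in>carrier H. hnorm H (A i x) \<le> a * hnorm H x" if "i \<in> {1..n}" for i
    using bounded_operator_bound[OF A[OF that]] by metis
  then obtain a where a: "\<And>i. i \<in> {1..n} \<Longrightarrow> a i \<ge> 0"
    "\<And>i x. i \<in> {1..n} \<Longrightarrow> x \<in> carrier H \<Longrightarrow> hnorm H (A i x) \<le> a i * hnorm H x" by metis
  obtain S where "bounded_operator (tensor_power H n) S" "S \<in> extensional (carrier (tensor_power H n))"
    "\<And>u. u \<in> tuples H n \<Longrightarrow> S (simple_tensor H n u) = simple_tensor H n (\<lambda>i. A i (u i))"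
    by (rule T.tensor_operator_exists[of A a, OF A a]) (assumption | (rule that; assumption))+
  hence S: "?P S" by blast
  have "R = S" if R: "?P R" for R
  proof (rule extensionalityI[of _ "carrier (tensor_power H n)"])
    show "R x = S x" if "x \<in> carrier (tensor_power H n)" for x
      by (rule T.operators_eqI) (use S R that in auto)
  qed (use S R in auto)
  hence "?P (tensor_operator H n A)" unfolding tensor_operator_def using S by (intro theI[of ?P]) auto
  thus ?thesis by auto
qed

lemma
  assumes A: "\<And>i. i \<in> {1..n} \<Longrightarrow> bounded_operator H (A i)"
  shows tensor_operator_bounded: "bounded_operator (tensor_power H n) (tensor_operator H n A)"
    and tensor_operator_simple: "\<And>u. u \<in> tuples H n \<Longrightarrow>
      tensor_operator H n A (simple_tensor H n u) = simple_tensor H n (\<lambda>i. A i (u i))"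
  using tensor_operator_spec[OF A] by auto

text \<open>The description of \<open>tensor_operator\<close> retains no norm bound. The operator is
  therefore constructed anew with the given \<open>a\<close> and identified with it on simple
  tensors.\<close>

lemma hnorm_tensor_operator_le:
  assumes A: "\<And>i. i \<in> {1..n} \<Longrightarrow> bounded_operator H (A i)" and a: "\<And>i. i \<in> {1..n} \<Longrightarrow> 0 \<le> a i"
    and bound: "\<And>i x. i \<in> {1..n} \<Longrightarrow> x \<in> carrier H \<Longrightarrow> hnorm H (A i x) \<le> a i * hnorm H x"
    and x: "x \<in> carrier (tensor_power H n)"
  shows "hnorm (tensor_power H n) (tensor_operator H n A x) \<le> (\<Prod>i=1..n. a i) * hnorm (tensor_power H n) x"
proof -
  obtain S where S: "bounded_operator (tensor_power H n) S"
    "\<And>u. u \<in> tuples H n \<Longrightarrow> S (simple_tensor H n u) = simple_tensor H n (\<lambda>i. A i (u i))"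
    "\<And>x. x \<in> carrier (tensor_power H n) \<Longrightarrow>
      hnorm (tensor_power H n) (S x) \<le> (\<Prod>i=1..n. a i) * hnorm (tensor_power H n) x"
    by (rule T.tensor_operator_exists[of A a, OF A a bound]) (assumption | (rule that; assumption))+
  have "tensor_operator H n A x = S x"
  proof (rule T.operators_eqI[OF tensor_operator_bounded[OF A] S(1) _ x])
    show "tensor_operator H n A (simple_tensor H n u) = S (simple_tensor H n u)" if "u \<in> tuples H n" for u
      unfolding S(2)[OF that] using A that by (rule tensor_operator_simple)
  qed
  thus ?thesis using S(3)[OF x] by simp
qed

end

section \<open>Symmetric tensor powers\<close>

lemma sym_tensor_power_simps [simp]:
  "smult (sym_tensor_power H n) = smult (tensor_power H n)"
  "cinner (sym_tensor_power H n) = cinner (tensor_power H n)"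
  "hnorm (sym_tensor_power H n) = hnorm (tensor_power H n)"
  by (auto simp: sym_tensor_power_def hnorm_def fun_eq_iff)

lemma sym_tensor_power_carrier:
  "v \<in> carrier (sym_tensor_power H n) \<longleftrightarrow> v \<in> carrier (tensor_power H n) \<and>
    (\<forall>p. p permutes {1..n} \<longrightarrow> perm_operator H n p v = v)"
  by (simp add: sym_tensor_power_def)

context hilbert_tensor_power
begin

text \<open>Permutation operators are isometries, so a limit \<open>x\<close> of fixed vectors
  \<open>s k\<close> is fixed: \<open>\<parallel>P x - x\<parallel> \<le> \<parallel>P (x - s
  k)\<parallel> + \<parallel>s k - x\<parallel>\<close>.\<close>

lemma hilbert_space_sym_tensor_power: "hilbert_space (sym_tensor_power H n)"
proof -
  let ?S = "sym_tensor_power H n"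
  note P = perm_operator_bounded
  note D = T.T.bounded_operatorD[OF P]
  have sub: "carrier ?S \<subseteq> carrier (tensor_power H n)" by (auto simp: sym_tensor_power_carrier)
  have "T.T.subspace (carrier ?S)"
    by (rule T.T.subspaceI) (auto simp: sym_tensor_power_carrier D T.T.bounded_operator_zero[OF P])
  then interpret S: pre_hilbert_space ?S
    by unfold_locales
      (use sub in \<open>auto simp: T.T.scale_right_distrib T.T.scale_left_distrib subset_iff
        T.T.cinner_add_right T.T.cinner_smult_right T.T.cinner_pos intro: T.T.cinner_commute\<close>)
  show ?thesis
  proof (rule S.hilbert_spaceI)
    fix s :: "nat \<Rightarrow> (nat \<Rightarrow> 'a) \<Rightarrow> complex"
    assume s: "\<And>k. s k \<in> carrier ?S"
      and C: "\<And>e. e > 0 \<Longrightarrow> \<exists>N. \<forall>m\<ge>N. \<forall>k\<ge>N. hnorm ?S (s m - s k) < e"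
    have sT: "s k \<in> carrier (tensor_power H n)" for k using s sub by auto
    obtain x where x: "x \<in> carrier (tensor_power H n)" and lim: "(\<lambda>k. hnorm (tensor_power H n) (s k - x)) \<longlonglongrightarrow> 0"
      by (rule T.T.Cauchy_converges[of s]) (use sT C in auto)
    have "perm_operator H n p x = x" if p: "p permutes {1..n}" for p
    proof (rule T.T.eq_if_hnorm_diff_small)
      show px: "perm_operator H n p x \<in> carrier (tensor_power H n)" using D(1)[OF p x] .
      fix e :: real assume "e > 0"
      then obtain k where "\<forall>j\<ge>k. norm (hnorm (tensor_power H n) (s j - x) - 0) < e / 2"
        using LIMSEQ_D[OF lim, of "e/2"] by auto
      from spec[OF this, of k] have k: "hnorm (tensor_power H n) (s k - x) < e / 2" by (auto simp: abs_less_iff)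
      have fix_s: "perm_operator H n p (s k) = s k" using s p by (simp add: sym_tensor_power_carrier)
      have isom: "hnorm (tensor_power H n) (perm_operator H n p v) = hnorm (tensor_power H n) v"
        if "v \<in> carrier (tensor_power H n)" for v
        using perm_operator(1)[OF p] that by (simp add: unitary_operator_def hnorm_def)
      have "hnorm (tensor_power H n) (perm_operator H n p x - s k) = hnorm (tensor_power H n) (x - s k)"
        using isom[of "x - s k"] x sT by (simp add: T.T.bounded_operator_diff[OF P[OF p]] fix_s)
      thus "hnorm (tensor_power H n) (perm_operator H n p x - x) \<le> e"
        using T.T.hnorm_triangle_diff[OF px sT[of k] x] k T.T.hnorm_minus_commute[OF x sT[of k]] by simp
    qed (fact x)
    hence "x \<in> carrier ?S" using x by (simp add: sym_tensor_power_carrier)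
    with lim show "\<exists>x\<in>carrier ?S. (\<lambda>k. hnorm ?S (s k - x)) \<longlonglongrightarrow> 0" by auto
  qed
qed

text \<open>The vectors \<open>x \<otimes> ... \<otimes> x\<close> are the test vectors of all lower
  bounds.\<close>

lemma pure_in_sym_tensor_power:
  "x \<in> carrier H \<Longrightarrow> simple_tensor H n (\<lambda>_. x) \<in> carrier (sym_tensor_power H n)"
  using T.simple_closed[of "\<lambda>_. x"] perm_operator(2)[of _ "\<lambda>_. x"]
  by (auto simp: sym_tensor_power_carrier)

lemma hnorm_pure: "x \<in> carrier H \<Longrightarrow> hnorm (tensor_power H n) (simple_tensor H n (\<lambda>_. x)) = hnorm H x ^ n"
  by (subst T.hnorm_simple) auto

text \<open>All \<open>n!\<close> permuted summands coincide, which cancels the factor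
  \<open>1 / fact n\<close>.\<close>

lemma sym_tensor_operator_power:
  "v \<in> carrier (sym_tensor_power H n) \<Longrightarrow> sym_tensor_operator H n (\<lambda>_. A) v = tensor_operator H n (\<lambda>_. A) v"
  by (simp add: sym_tensor_operator_def T.T.sum_constant_scale card_permutations del: sum_constant)

text \<open>With the same \<open>A\<close> in every slot, the operator commutes with permutations;
  this is checked on simple tensors.\<close>

lemma tensor_operator_power_in_sym:
  assumes A: "bounded_operator H A" and v: "v \<in> carrier (sym_tensor_power H n)"
  shows "tensor_operator H n (\<lambda>_. A) v \<in> carrier (sym_tensor_power H n)"
  unfolding sym_tensor_power_carrier
proof (intro conjI allI impI)
  let ?S = "tensor_operator H n (\<lambda>_. A)"
  have S: "bounded_operator (tensor_power H n) ?S" using A by (intro tensor_operator_bounded)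
  have Ss: "?S (simple_tensor H n u) = simple_tensor H n (\<lambda>i. A (u i))" if "u \<in> tuples H n" for u
    using A that by (rule tensor_operator_simple)
  have vT: "v \<in> carrier (tensor_power H n)" using v by (simp add: sym_tensor_power_carrier)
  show "?S v \<in> carrier (tensor_power H n)" using T.T.bounded_operatorD(1)[OF S vT] .
  fix p assume p: "p permutes {1..n}"
  note P = perm_operator_bounded[OF p]
  have "perm_operator H n p (?S v) = ?S (perm_operator H n p v)"
  proof (rule T.operators_eqI[OF T.T.bounded_operator_compose[OF P S] T.T.bounded_operator_compose[OF S P] _ vT])
    fix u assume u: "u \<in> tuples H n"
    have "(\<lambda>i. A (u i)) \<in> tuples H n"
      by (rule Pi_I) (rule bounded_operatorD(1)[OF A Pi_mem[OF u]])
    thus "perm_operator H n p (?S (simple_tensor H n u)) = ?S (perm_operator H n p (simple_tensor H n u))"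
      using T.permutation_closed[OF p u] by (simp only: Ss u perm_operator(2)[OF p])
  qed
  thus "perm_operator H n p (?S v) = ?S v" using v p by (simp add: sym_tensor_power_carrier)
qed

lemma sym_tensor_operator_power_bounded:
  assumes A: "bounded_operator H A"
  shows "bounded_operator (sym_tensor_power H n) (sym_tensor_operator H n (\<lambda>_. A))"
proof -
  interpret S: hilbert_space "sym_tensor_power H n" by (rule hilbert_space_sym_tensor_power)
  have sub: "v \<in> carrier (tensor_power H n)" if "v \<in> carrier (sym_tensor_power H n)" for v
    using that by (simp add: sym_tensor_power_carrier)
  have S: "bounded_operator (tensor_power H n) (tensor_operator H n (\<lambda>_. A))"
    using A by (intro tensor_operator_bounded)
  note D = T.T.bounded_operatorD[OF S]
  obtain K where K: "\<And>x. x \<in> carrier (tensor_power H n) \<Longrightarrow>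
      hnorm (tensor_power H n) (tensor_operator H n (\<lambda>_. A) x) \<le> K * hnorm (tensor_power H n) x"
    using T.T.bounded_operator_bound[OF S] by blast
  show ?thesis
    unfolding bounded_operator_def
  proof (intro conjI ballI allI exI[of _ K])
    fix x y c assume x: "x \<in> carrier (sym_tensor_power H n)"
    show "sym_tensor_operator H n (\<lambda>_. A) x \<in> carrier (sym_tensor_power H n)"
      using x tensor_operator_power_in_sym[OF A x] by (simp add: sym_tensor_operator_power)
    show "hnorm (sym_tensor_power H n) (sym_tensor_operator H n (\<lambda>_. A) x) \<le> K * hnorm (sym_tensor_power H n) x"
      using x K[OF sub[OF x]] by (simp add: sym_tensor_operator_power)
    show "sym_tensor_operator H n (\<lambda>_. A) (smult (sym_tensor_power H n) c x)
        = smult (sym_tensor_power H n) c (sym_tensor_operator H n (\<lambda>_. A) x)"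
      using x S.smult_closed[OF x, of c] D(3)[OF sub[OF x], of c] by (simp add: sym_tensor_operator_power)
    assume y: "y \<in> carrier (sym_tensor_power H n)"
    show "sym_tensor_operator H n (\<lambda>_. A) (x + y)
        = sym_tensor_operator H n (\<lambda>_. A) x + sym_tensor_operator H n (\<lambda>_. A) y"
      using x y S.add_closed[OF x y] D(2)[OF sub[OF x] sub[OF y]] by (simp add: sym_tensor_operator_power)
  qed
qed

end

section \<open>Symmetric products of two operators\<close>

lemma permutations_1_2: "{p. p permutes {1..2::nat}} = {id, Transposition.transpose 1 2}"
proof -
  have "{1..2::nat} = insert 1 {2}" by auto
  thus ?thesis by (auto simp: permutes_doubleton_iff)
qed

lemma prod_1_2: "(\<Prod>i=1..2::nat. f i) = f 1 * f 2"
proof -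
  have "{1..2::nat} = {1, 2}" by auto
  thus ?thesis by simp
qed

text \<open>The transposition moves \<open>A\<close> to slot 2. Written with the test
  \<open>i = 2\<close>, both summands belong to the family \<open>if i = k then A else B\<close>, so
  they can be treated together.\<close>

lemma (in hilbert_space) sym_tensor_operator2:
  assumes E: "orthonormal_basis H E" and v: "v \<in> carrier (sym_tensor_power H 2)"
  shows "sym_tensor_operator2 H A B v = smult (tensor_power H 2) (1 / 2)
    (tensor_operator H 2 (\<lambda>i. if i = 1 then A else B) v + tensor_operator H 2 (\<lambda>i. if i = 2 then A else B) v)"
proof -
  have "(Transposition.transpose 1 (2::nat) i = 1) \<longleftrightarrow> i = 2" for i
    by (auto simp: Transposition.transpose_def)
  moreover have "id \<noteq> Transposition.transpose 1 (2::nat)"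
    by (metis id_apply one_eq_numeral_iff semiring_norm(83) transpose_apply_first)
  ultimately show ?thesis
    using v unfolding sym_tensor_operator2_def sym_tensor_operator_def permutations_1_2 by simp
qed

locale hilbert_tensor_square = hilbert_tensor_power H 2 E for H :: "'a::ab_group_add hilb" and E
begin

context
  fixes A B
  assumes A: "bounded_operator H A" and B: "bounded_operator H B"
begin

lemma two_operators_bounded:
  "bounded_operator (tensor_power H 2) (tensor_operator H 2 (\<lambda>i. if i = k then A else B))"
  by (rule tensor_operator_bounded) (use A B in auto)

lemma hnorm_sym_tensor_operator2_pure:
  assumes x: "x \<in> carrier H"
  shows "hnorm H (A x) * hnorm H (B x) / sqrt 2
    \<le> hnorm (tensor_power H 2) (sym_tensor_operator2 H A B (simple_tensor H 2 (\<lambda>_. x)))"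
proof -
  have Ax: "A x \<in> carrier H" and Bx: "B x \<in> carrier H"
    using bounded_operatorD(1)[OF A x] bounded_operatorD(1)[OF B x] by auto
  let ?u = "\<lambda>i::nat. (if i = 1 then A else B) x" and ?v = "\<lambda>i::nat. (if i = 2 then A else B) x"
  have u: "?u \<in> tuples H 2" and v: "?v \<in> tuples H 2" using Ax Bx by auto
  define p where "p = simple_tensor H 2 ?u"
  define q where "q = simple_tensor H 2 ?v"
  have p: "p \<in> carrier (tensor_power H 2)" and q: "q \<in> carrier (tensor_power H 2)"
    unfolding p_def q_def using u v by (auto intro: T.simple_closed simp del: One_nat_def)
  have ops: "tensor_operator H 2 (\<lambda>i. if i = k then A else B) (simple_tensor H 2 (\<lambda>_. x))
      = simple_tensor H 2 (\<lambda>i. (if i = k then A else B) x)" for k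
    by (rule tensor_operator_simple) (use A B x in auto)
  have S: "sym_tensor_operator2 H A B (simple_tensor H 2 (\<lambda>_. x)) = smult (tensor_power H 2) (1 / 2) (p + q)"
    unfolding sym_tensor_operator2[OF onb pure_in_sym_tensor_power[OF x]] ops p_def q_def ..
  define r where "r = hnorm H (A x) * hnorm H (B x)"
  have np: "hnorm (tensor_power H 2) p = r"
    unfolding p_def T.hnorm_simple[OF u] prod_1_2 by (simp add: r_def)
  have nq: "hnorm (tensor_power H 2) q = r"
    unfolding q_def T.hnorm_simple[OF v] prod_1_2 by (simp add: r_def mult.commute)
  have "cinner (tensor_power H 2) p q = cinner H (A x) (B x) * cinner H (B x) (A x)"
    unfolding p_def q_def T.cinner_simple[OF u v] prod_1_2 by simp
  also have "cinner H (B x) (A x) = cnj (cinner H (A x) (B x))" by (rule cinner_commute[OF Bx Ax])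
  finally have "Re (cinner (tensor_power H 2) p q) \<ge> 0"
    by (simp add: complex_mult_cnj)
  \<comment> \<open>Dropping the cross term leaves \<open>sqrt 2 * r / 2\<close> for half the sum,
    the origin of the factor \<open>1 / sqrt 2\<close>.\<close>
  hence "2 * r\<^sup>2 \<le> (hnorm (tensor_power H 2) (p + q))\<^sup>2"
    unfolding T.T.hnorm_add_power2[OF p q] np nq by simp
  hence "sqrt 2 * \<bar>r\<bar> \<le> hnorm (tensor_power H 2) (p + q)"
  proof -
    assume a: "2 * r\<^sup>2 \<le> (hnorm (tensor_power H 2) (p + q))\<^sup>2"
    have "(sqrt 2 * \<bar>r\<bar>)\<^sup>2 \<le> (hnorm (tensor_power H 2) (p + q))\<^sup>2"
      using a by (simp only: power_mult_distrib power2_abs real_sqrt_pow2 zero_le_numeral)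
    thus ?thesis by (rule power2_le_imp_le) (rule T.T.hnorm_nonneg[OF T.T.add_closed[OF p q]])
  qed
  hence "sqrt 2 * r / 2 \<le> hnorm (tensor_power H 2) (smult (tensor_power H 2) (1 / 2) (p + q))"
  proof -
    assume a: "sqrt 2 * \<bar>r\<bar> \<le> hnorm (tensor_power H 2) (p + q)"
    have "sqrt 2 * r \<le> sqrt 2 * \<bar>r\<bar>" by (rule mult_left_mono) auto
    from order_trans[OF this a] show ?thesis using p q by simp
  qed
  moreover have "sqrt 2 * r / 2 = r / sqrt 2" by (simp add: field_simps)
  ultimately show ?thesis unfolding S r_def by simp
qed

text \<open>\<open>op_norm\<close> is a supremum of reals, so its set of values must be bounded
  before a value can be compared with it; bounds \<open>K\<close> and \<open>L\<close> of the two
  summands serve for this.\<close>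

lemma hnorm_sym_tensor_operator2_le_op_norm:
  assumes v: "v \<in> carrier (sym_tensor_power H 2)" "hnorm (tensor_power H 2) v \<le> 1"
  shows "hnorm (tensor_power H 2) (sym_tensor_operator2 H A B v)
    \<le> op_norm (sym_tensor_power H 2) (sym_tensor_operator2 H A B)"
proof -
  let ?T = "tensor_power H 2"
  obtain K where K: "K \<ge> 0" "\<And>x. x \<in> carrier ?T \<Longrightarrow>
      hnorm ?T (tensor_operator H 2 (\<lambda>i. if i = 1 then A else B) x) \<le> K * hnorm ?T x"
    by (rule T.T.bounded_operator_bound[OF two_operators_bounded]) (rule that; assumption)
  obtain L where L: "L \<ge> 0" "\<And>x. x \<in> carrier ?T \<Longrightarrow>
      hnorm ?T (tensor_operator H 2 (\<lambda>i. if i = 2 then A else B) x) \<le> L * hnorm ?T x"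
    by (rule T.T.bounded_operator_bound[OF two_operators_bounded]) (rule that; assumption)
  have "hnorm ?T (sym_tensor_operator2 H A B x) \<le> K + L"
    if x: "x \<in> carrier (sym_tensor_power H 2)" "hnorm ?T x \<le> 1" for x
  proof -
    have xT: "x \<in> carrier ?T" using x by (simp add: sym_tensor_power_carrier)
    note c = T.T.bounded_operatorD(1)[OF two_operators_bounded xT]
    have "hnorm ?T (sym_tensor_operator2 H A B x) \<le> 1 / 2 * (K * hnorm ?T x + L * hnorm ?T x)"
      unfolding sym_tensor_operator2[OF onb x(1)] T.T.hnorm_smult[OF T.T.add_closed[OF c c]]
      using T.T.hnorm_triangle[OF c c, of 1 2] K(2)[OF xT] L(2)[OF xT] by simp
    also have "\<dots> \<le> (K + L) * hnorm ?T x" using K(1) L(1) xT by (simp add: distrib_right[symmetric])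
    also have "\<dots> \<le> (K + L) * 1" using x K L by (intro mult_left_mono) auto
    finally show ?thesis by simp
  qed
  thus ?thesis unfolding op_norm_def sym_tensor_power_simps using v
    by (intro cSUP_upper bdd_aboveI2[of _ _ "K + L"]) auto
qed

lemma product_norm_le_op_norm:
  assumes x: "x \<in> carrier H" "hnorm H x = 1"
  shows "hnorm H (A x) * hnorm H (B x) / sqrt 2 \<le> op_norm (sym_tensor_power H 2) (sym_tensor_operator2 H A B)"
  using hnorm_sym_tensor_operator2_pure[OF x(1)]
    hnorm_sym_tensor_operator2_le_op_norm[OF pure_in_sym_tensor_power[OF x(1)]] x
  by (simp add: hnorm_pure)

lemma sym_tensor_operator2_nonzero:
  assumes "nonzero_operator H A" "nonzero_operator H B"
  shows "nonzero_operator (sym_tensor_power H 2) (sym_tensor_operator2 H A B)"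
proof -
  obtain x y where x: "x \<in> carrier H" "A x \<noteq> 0" and y: "y \<in> carrier H" "B y \<noteq> 0"
    using assms by (auto simp: nonzero_operator_def)
  text \<open>A vector space is not the union of two proper subspaces, here the kernels.\<close>
  have "\<exists>z\<in>carrier H. A z \<noteq> 0 \<and> B z \<noteq> 0"
  proof (cases "B x = 0 \<and> A y = 0")
    case True
    hence "A (x + y) \<noteq> 0" "B (x + y) \<noteq> 0"
      using x y bounded_operatorD(2)[OF A x(1) y(1)] bounded_operatorD(2)[OF B x(1) y(1)] by auto
    thus ?thesis using x y by (intro bexI[of _ "x + y"]) auto
  qed (use x y in blast)
  then obtain z where z: "z \<in> carrier H" "A z \<noteq> 0" "B z \<noteq> 0" by blast
  hence "0 < hnorm H (A z) * hnorm H (B z) / sqrt 2"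
    using bounded_operatorD(1)[OF A z(1)] bounded_operatorD(1)[OF B z(1)] by simp
  also note hnorm_sym_tensor_operator2_pure[OF z(1)]
  finally have "sym_tensor_operator2 H A B (simple_tensor H 2 (\<lambda>_. z)) \<noteq> 0" by auto
  thus ?thesis unfolding nonzero_operator_def using pure_in_sym_tensor_power[OF z(1)] by blast
qed

end

end

text \<open>Homogeneity is extracted from the product formula: with \<open>k\<close> the product of
  the scalars, \<open>\<parallel>t v - k t u\<parallel>\<^sup>2\<close> expands to 0.\<close>

lemma (in tensor_power_space) simple_smult:
  assumes u: "u \<in> tuples H n"
  shows "t (\<lambda>i. smult H (c i) (u i)) = smult T (\<Prod>i=1..n. c i) (t u)"
proof -
  have uc: "u i \<in> carrier H" if "i \<in> {1..n}" for i using Pi_mem[OF u that] .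
  define v where "v = (\<lambda>i. smult H (c i) (u i))"
  define k where "k = (\<Prod>i=1..n. c i)"
  have v: "v \<in> tuples H n" unfolding v_def by (rule Pi_I) (rule H.smult_closed[OF uc])
  define g where "g = (\<Prod>i=1..n. cinner H (u i) (u i))"
  have "cinner T (t v) (t v) = cnj k * k * g" "cinner T (t v) (t u) = cnj k * g"
    "cinner T (t u) (t v) = k * g" "cinner T (t u) (t u) = g"
    using u v unfolding g_def k_def
    by (simp_all only: cinner_simple cnj_prod prod.distrib[symmetric])
      (auto intro!: prod.cong simp: v_def H.cinner_smult_left H.cinner_smult_right uc simp del: One_nat_def)
  hence "cinner T (t v - smult T k (t u)) (t v - smult T k (t u)) = 0"
    using simple_closed[OF u] simple_closed[OF v]
    by (simp add: T.cinner_diff_left T.cinner_diff_right T.cinner_smult_left T.cinner_smult_right)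
  hence "hnorm T (t v - smult T k (t u)) = 0" by (simp add: hnorm_def)
  thus ?thesis using simple_closed[OF u] simple_closed[OF v] by (simp add: v_def k_def)
qed

lemma (in hilbert_space) bounded_operator_rank_one:
  assumes f: "f \<in> carrier H" and g: "g \<in> carrier H"
  shows "bounded_operator H (\<lambda>x. smult H (cinner H f x) g)"
proof -
  have "hnorm H (smult H (cinner H f x) g) \<le> (hnorm H f * hnorm H g) * hnorm H x" if "x \<in> carrier H" for x
    using mult_right_mono[OF Cauchy_Schwarz[OF f that] hnorm_nonneg[OF g]] g by (simp add: mult_ac)
  thus ?thesis using f g
    by (auto simp: bounded_operator_def cinner_add_right cinner_smult_right scale_left_distrib)
qed

section \<open>Rank-one operators attaining the bound\<close>

context hilbert_tensor_square
begin

text \<open>Both operators use the functional given by \<open>e\<close>. So, with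
  \<open>w = e \<otimes> e\<close>, each of the two tensor operators has rank one and maps
  \<open>v\<close> to \<open>\<langle>w, v\<rangle> p k\<close>. The vectors
  \<open>p 1 = e \<otimes> f\<close> and \<open>p 2 = f \<otimes> e\<close> are orthonormal, and
  half their sum has norm \<open>1 / sqrt 2\<close>.\<close>

lemma op_norm_rank_one_le:
  assumes e: "e \<in> carrier H" "hnorm H e = 1" and f: "f \<in> carrier H" "hnorm H f = 1" and ef: "cinner H e f = 0"
  defines "C \<equiv> \<lambda>x. smult H (cinner H e x) e" and "D \<equiv> \<lambda>x. smult H (cinner H e x) f"
  shows "op_norm (sym_tensor_power H 2) (sym_tensor_operator2 H C D) \<le> 1 / sqrt 2"
proof -
  let ?T = "tensor_power H 2"
  have C: "bounded_operator H C" and D: "bounded_operator H D"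
    unfolding C_def D_def using e f by (auto intro: bounded_operator_rank_one)
  define w where "w = simple_tensor H 2 (\<lambda>_. e)"
  define p where "p k = simple_tensor H 2 (\<lambda>i. if i = k then e else f)" for k :: nat
  have w: "w \<in> carrier ?T" "hnorm ?T w = 1"
    using T.simple_closed[of "\<lambda>_. e"] hnorm_pure[OF e(1)] e by (auto simp: w_def)
  have tup: "(\<lambda>i. if i = k then e else f) \<in> tuples H 2" for k using e f by auto
  have p: "p k \<in> carrier ?T" for k unfolding p_def by (rule T.simple_closed[OF tup])
  have pn: "hnorm ?T (p k) = 1" for k
    unfolding p_def T.hnorm_simple[OF tup] prod_1_2 using e f by simp
  have pq: "cinner ?T (p 1) (p 2) = 0"
    unfolding p_def T.cinner_simple[OF tup tup] prod_1_2 using ef by simp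
  have op: "tensor_operator H 2 (\<lambda>i. if i = k then C else D) v = smult ?T (cinner ?T w v) (p k)"
    if v: "v \<in> carrier ?T" for k v
  proof (rule T.operators_eqI[OF two_operators_bounded[OF C D] T.T.bounded_operator_rank_one[OF w(1) p] _ v])
    fix u assume u: "u \<in> tuples H 2"
    have "tensor_operator H 2 (\<lambda>i. if i = k then C else D) (simple_tensor H 2 u)
        = simple_tensor H 2 (\<lambda>i. (if i = k then C else D) (u i))"
      by (rule tensor_operator_simple[OF _ u]) (use C D in auto)
    also have "(\<lambda>i. (if i = k then C else D) (u i)) = (\<lambda>i. smult H (cinner H e (u i)) (if i = k then e else f))"
      by (auto simp: C_def D_def)
    also have "simple_tensor H 2 \<dots> = smult ?T (\<Prod>i=1..2. cinner H e (u i)) (p k)"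
      unfolding p_def by (rule T.simple_smult[OF tup])
    also have "(\<Prod>i=1..2. cinner H e (u i)) = cinner ?T w (simple_tensor H 2 u)"
      unfolding w_def by (rule T.cinner_simple[symmetric]) (use e u in auto)
    finally show "tensor_operator H 2 (\<lambda>i. if i = k then C else D) (simple_tensor H 2 u)
        = smult ?T (cinner ?T w (simple_tensor H 2 u)) (p k)" .
  qed
  have "(hnorm ?T (p 1 + p 2))\<^sup>2 = 2"
    unfolding T.T.hnorm_add_power2[OF p p] pn pq by simp
  hence n2: "hnorm ?T (p 1 + p 2) = sqrt 2" using p by (metis T.T.add_closed T.T.hnorm_nonneg real_sqrt_unique)
  have "hnorm ?T (sym_tensor_operator2 H C D v) \<le> 1 / sqrt 2"
    if v: "v \<in> carrier (sym_tensor_power H 2)" "hnorm ?T v \<le> 1" for v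
  proof -
    have vT: "v \<in> carrier ?T" using v by (simp add: sym_tensor_power_carrier)
    have "sym_tensor_operator2 H C D v = smult ?T (cinner ?T w v / 2) (p 1 + p 2)"
      unfolding sym_tensor_operator2[OF onb v(1)] op[OF vT] by (simp add: T.T.scale_right_distrib)
    hence "hnorm ?T (sym_tensor_operator2 H C D v) = cmod (cinner ?T w v) / 2 * sqrt 2"
      using n2 p by (simp add: norm_divide)
    also have "\<dots> \<le> 1 / 2 * sqrt 2"
      using T.T.Cauchy_Schwarz[OF w(1) vT] w v(2) by (intro mult_right_mono divide_right_mono) auto
    also have "\<dots> = 1 / sqrt 2" by (simp add: field_simps)
    finally show ?thesis .
  qed
  \<comment> \<open>The supremum is bounded by its upper bounds only over a nonempty set.\<close>
  moreover have "0 \<in> {x \<in> carrier (sym_tensor_power H 2). hnorm (sym_tensor_power H 2) x \<le> 1}"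
    by (simp add: sym_tensor_power_carrier T.T.bounded_operator_zero[OF perm_operator_bounded])
  ultimately show ?thesis unfolding op_norm_def by (intro cSUP_least) auto
qed

end

text \<open>\<open>C e = e\<close> and \<open>D e = f\<close> give the product of norms its largest
  value 1 at \<open>x = e\<close>, while \<open>op_norm_rank_one_le\<close> bounds the symmetric
  product by \<open>1 / sqrt 2\<close>. Two orthonormal vectors suffice, hence the two-point index
  set.\<close>

lemma product_norm_bound_sharp:
  "\<exists>(K :: (nat \<Rightarrow> complex) hilb) C D.
     separable_hilbert_space K \<and> carrier K \<noteq> {0} \<and>
     bounded_operator K C \<and> bounded_operator K D \<and>
     nonzero_operator K C \<and> nonzero_operator K D \<and>
     (1 / sqrt 2) * (SUP x\<in>{x \<in> carrier K. hnorm K x = 1}. hnorm K (C x) * hnorm K (D x))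
       = op_norm (sym_tensor_power K 2) (sym_tensor_operator2 K C D)"
proof -
  define K :: "(nat \<Rightarrow> complex) hilb" where "K = l2_space {0, 1}"
  have onb: "orthonormal_basis K (unit_vector ` {0, 1})"
    unfolding K_def by (rule orthonormal_basis_l2_space)
  interpret hilbert_space K unfolding K_def by (rule hilbert_space_l2_space)
  interpret hilbert_tensor_square K "unit_vector ` {0, 1}" by unfold_locales (rule onb)
  define e :: "nat \<Rightarrow> complex" where "e = unit_vector 0"
  define f :: "nat \<Rightarrow> complex" where "f = unit_vector 1"
  have "e 0 \<noteq> f 0" by (simp add: e_def f_def)
  hence "e \<noteq> f" by auto
  hence ef: "e \<in> carrier K" "f \<in> carrier K" "cinner K e e = 1" "cinner K f f = 1" "cinner K e f = 0"
    using onb unfolding orthonormal_basis_def by (auto simp: e_def f_def)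
  hence n: "hnorm K e = 1" "hnorm K f = 1" by (auto simp: hnorm_def)
  hence nz: "e \<noteq> 0" "f \<noteq> 0" by auto
  define C where "C = (\<lambda>x. smult K (cinner K e x) e)"
  define D where "D = (\<lambda>x. smult K (cinner K e x) f)"
  have CD: "bounded_operator K C" "bounded_operator K D"
    unfolding C_def D_def using ef by (auto intro: bounded_operator_rank_one)
  have CDe: "C e = e" "D e = f" using ef by (auto simp: C_def D_def)
  have norms: "hnorm K (C x) * hnorm K (D x) \<le> 1" if x: "x \<in> carrier K" "hnorm K x = 1" for x
  proof -
    have "cmod (cinner K e x) \<le> 1" using Cauchy_Schwarz[OF ef(1) x(1)] n x by simp
    hence "cmod (cinner K e x) * cmod (cinner K e x) \<le> 1" by (simp add: mult_le_one)
    thus ?thesis using ef n by (simp add: C_def D_def)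
  qed
  have sup: "(SUP x\<in>{x \<in> carrier K. hnorm K x = 1}. hnorm K (C x) * hnorm K (D x)) = 1"
  proof (rule cSup_eq_maximum)
    show "1 \<in> (\<lambda>x. hnorm K (C x) * hnorm K (D x)) ` {x \<in> carrier K. hnorm K x = 1}"
      using ef n CDe by (intro image_eqI[of _ _ e]) auto
  qed (use norms in auto)
  have "op_norm (sym_tensor_power K 2) (sym_tensor_operator2 K C D) \<le> 1 / sqrt 2"
    unfolding C_def D_def by (rule op_norm_rank_one_le) (use ef n in auto)
  moreover have "1 / sqrt 2 \<le> op_norm (sym_tensor_power K 2) (sym_tensor_operator2 K C D)"
    using product_norm_le_op_norm[OF CD ef(1) n(1)] CDe n by simp
  ultimately have "(1 / sqrt 2) * (SUP x\<in>{x \<in> carrier K. hnorm K x = 1}. hnorm K (C x) * hnorm K (D x))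
       = op_norm (sym_tensor_power K 2) (sym_tensor_operator2 K C D)" unfolding sup by simp
  moreover have "separable_hilbert_space K"
    unfolding separable_hilbert_space_def
    by (intro conjI hilbert_space_axioms exI[of _ "unit_vector ` {0, 1}"] onb) simp
  moreover have "carrier K \<noteq> {0}" using ef nz by auto
  moreover have "nonzero_operator K C" "nonzero_operator K D"
    unfolding nonzero_operator_def using ef nz CDe by (auto intro!: bexI[of _ e])
  ultimately show ?thesis using CD by blast
qed

section \<open>Growth of powers and the spectral radius\<close>

text \<open>Quantifying over vectors instead of using \<open>op_norm\<close> keeps suprema out of
  the estimates; what matters is that \<open>C\<close> is uniform in \<open>k\<close>.\<close>

definition growth_bound :: "'a::ab_group_add hilb \<Rightarrow> ('a \<Rightarrow> 'a) \<Rightarrow> real \<Rightarrow> bool" where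
  "growth_bound H A r \<longleftrightarrow> (\<exists>C\<ge>0. \<forall>k. \<forall>x\<in>carrier H. hnorm H ((A ^^ k) x) \<le> C * r ^ k * hnorm H x)"

section \<open>Invertibility as a bound from below\<close>

context hilbert_space
begin

text \<open>The lower bound gives injectivity and, with the same constant, boundedness of the
  inverse.\<close>

lemma bounded_operator_inverse:
  assumes T: "bounded_operator H T" and below: "\<And>x. x \<in> carrier H \<Longrightarrow> hnorm H x \<le> M * hnorm H (T x)"
    and surj: "\<And>y. y \<in> carrier H \<Longrightarrow> \<exists>x\<in>carrier H. T x = y"
  obtains R where "bounded_operator H R" "\<And>x. x \<in> carrier H \<Longrightarrow> R (T x) = x"
    "\<And>x. x \<in> carrier H \<Longrightarrow> T (R x) = x"
proof -
  note D = bounded_operatorD[OF T]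
  have inj: "x = y" if "x \<in> carrier H" "y \<in> carrier H" "T x = T y" for x y
  proof -
    have "hnorm H (x - y) \<le> 0"
      using below[of "x - y"] that by (simp add: bounded_operator_diff[OF T])
    thus ?thesis using hnorm_pos[of "x - y"] that by (metis diff_closed leD right_minus_eq)
  qed
  define R where "R y = (SOME x. x \<in> carrier H \<and> T x = y)" for y
  have R: "R y \<in> carrier H \<and> T (R y) = y" if "y \<in> carrier H" for y
    unfolding R_def using surj[OF that] by (intro someI_ex[of "\<lambda>x. x \<in> carrier H \<and> T x = y"]) blast
  have Req: "R y = x" if "x \<in> carrier H" "T x = y" for x y
    using R[of y] that D(1) inj by metis
  have "bounded_operator H R"
    unfolding bounded_operator_def
  proof (intro conjI ballI allI exI[of _ M])
    show "hnorm H (R x) \<le> M * hnorm H x" if "x \<in> carrier H" for x using below[of "R x"] R[OF that] by simp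
    show "R (x + y) = R x + R y" if "x \<in> carrier H" "y \<in> carrier H" for x y
      using R[OF that(1)] R[OF that(2)] by (intro Req) (auto simp: D)
    show "R (smult H c x) = smult H c (R x)" if "x \<in> carrier H" for c x
      using R[OF that] by (intro Req) (auto simp: D)
  qed (use R in auto)
  with that show ?thesis using R Req D(1) by blast
qed

lemma bounded_operator_minus_smult:
  assumes A: "bounded_operator H A"
  shows "bounded_operator H (\<lambda>x. A x - smult H l x)"
proof -
  note D = bounded_operatorD[OF A]
  obtain K where K: "K \<ge> 0" "\<And>x. x \<in> carrier H \<Longrightarrow> hnorm H (A x) \<le> K * hnorm H x"
    by (rule bounded_operator_bound[OF A]) (rule that; assumption)
  have "hnorm H (A x - smult H l x) \<le> (K + cmod l) * hnorm H x" if x: "x \<in> carrier H" for x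
    using hnorm_triangle[of "A x" "- smult H l x"] K(2)[OF x] D(1)[OF x] x by (simp add: distrib_right)
  thus ?thesis unfolding bounded_operator_def
    by (intro conjI ballI allI exI[of _ "K + cmod l"])
      (auto simp: D scale_right_distrib scale_right_diff_distrib mult.commute)
qed

text \<open>Replaces the resolvent by two statements about vectors. The lower bound is stable under
  small perturbations of the operator, which the compactness argument on a disc exploits.\<close>

lemma not_in_spectrum_iff:
  assumes A: "bounded_operator H A"
  shows "l \<notin> spectrum H A \<longleftrightarrow>
    (\<exists>M. \<forall>x\<in>carrier H. hnorm H x \<le> M * hnorm H (A x - smult H l x)) \<and>
    (\<forall>y\<in>carrier H. \<exists>x\<in>carrier H. A x - smult H l x = y)" (is "_ \<longleftrightarrow> ?rhs")
proof
  note T = bounded_operator_minus_smult[OF A, of l]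
  assume "l \<notin> spectrum H A"
  then obtain R where R: "bounded_operator H R"
    "\<And>x. x \<in> carrier H \<Longrightarrow> R (A x - smult H l x) = x \<and> A (R x) - smult H l (R x) = x"
    by (auto simp: spectrum_def)
  obtain M where "\<And>x. x \<in> carrier H \<Longrightarrow> hnorm H (R x) \<le> M * hnorm H x"
    by (rule bounded_operator_bound[OF R(1)]) (rule that; assumption)
  hence "\<forall>x\<in>carrier H. hnorm H x \<le> M * hnorm H (A x - smult H l x)"
    using R(2) bounded_operatorD(1)[OF T] by metis
  thus ?rhs using R(2) bounded_operatorD(1)[OF R(1)] by blast
next
  note T = bounded_operator_minus_smult[OF A, of l]
  assume r: ?rhs
  then obtain M where M: "\<And>x. x \<in> carrier H \<Longrightarrow> hnorm H x \<le> M * hnorm H (A x - smult H l x)" by blast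
  obtain R where R: "bounded_operator H R" "\<And>x. x \<in> carrier H \<Longrightarrow> R (A x - smult H l x) = x"
    "\<And>x. x \<in> carrier H \<Longrightarrow> A (R x) - smult H l (R x) = x"
    by (rule bounded_operator_inverse[OF T M]) (use r that in auto)
  hence "\<exists>R. bounded_operator H R \<and>
      (\<forall>x\<in>carrier H. R (A x - smult H l x) = x \<and> A (R x) - smult H l (R x) = x)"
    by blast
  thus "l \<notin> spectrum H A" unfolding spectrum_def by simp
qed

text \<open>A partial Neumann series: multiplied by \<open>1 - z A\<close> on either side it gives
  exactly \<open>1 - z\<^sup>N A\<^sup>N\<close>.\<close>

definition geometric :: "('a \<Rightarrow> 'a) \<Rightarrow> complex \<Rightarrow> nat \<Rightarrow> 'a \<Rightarrow> 'a" where
  "geometric A z N x = (\<Sum>k<N. smult H (z ^ k) ((A ^^ k) x))"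

section \<open>Neumann series, averages over roots of unity, and the spectral radius\<close>

context
  fixes A assumes A: "bounded_operator H A"
begin

lemma power_closed: "x \<in> carrier H \<Longrightarrow> (A ^^ k) x \<in> carrier H"
  using bounded_operatorD(1)[OF bounded_operator_power[OF A]] .

lemma hnorm_power_le:
  assumes a: "0 \<le> a" "\<And>x. x \<in> carrier H \<Longrightarrow> hnorm H (A x) \<le> a * hnorm H x" and x: "x \<in> carrier H"
  shows "hnorm H ((A ^^ k) x) \<le> a ^ k * hnorm H x"
proof (induction k)
  case (Suc k)
  have "hnorm H ((A ^^ Suc k) x) \<le> a * hnorm H ((A ^^ k) x)"
    using a(2)[OF power_closed[OF x]] by simp
  also have "\<dots> \<le> a * (a ^ k * hnorm H x)" by (rule mult_left_mono[OF Suc.IH a(1)])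
  finally show ?case by (simp add: mult.assoc)
qed simp

lemma geometric_closed: "x \<in> carrier H \<Longrightarrow> geometric A z N x \<in> carrier H"
  by (auto simp: geometric_def power_closed)

lemma geometric_left:
  assumes x: "x \<in> carrier H"
  shows "geometric A z N x - smult H z (A (geometric A z N x)) = x - smult H (z ^ N) ((A ^^ N) x)"
proof (induction N)
  case 0
  show ?case by (simp add: geometric_def bounded_operator_zero[OF A])
next
  case (Suc N)
  have S: "geometric A z (Suc N) x = geometric A z N x + smult H (z ^ N) ((A ^^ N) x)"
    by (simp add: geometric_def)
  have "A (geometric A z (Suc N) x) = A (geometric A z N x) + smult H (z ^ N) ((A ^^ Suc N) x)"
    unfolding S using x by (simp add: bounded_operatorD[OF A] geometric_closed power_closed)
  hence "geometric A z (Suc N) x - smult H z (A (geometric A z (Suc N) x))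
      = (geometric A z N x - smult H z (A (geometric A z N x)))
        + smult H (z ^ N) ((A ^^ N) x) - smult H (z ^ Suc N) ((A ^^ Suc N) x)"
    unfolding S by (simp add: scale_right_distrib)
  thus ?case unfolding Suc.IH by simp
qed

lemma geometric_right:
  assumes x: "x \<in> carrier H"
  shows "geometric A z N (x - smult H z (A x)) = x - smult H (z ^ N) ((A ^^ N) x)"
proof -
  have "geometric A z N (x - smult H z (A x))
      = (\<Sum>k<N. smult H (z ^ k) ((A ^^ k) x) - smult H (z ^ Suc k) ((A ^^ Suc k) x))"
    unfolding geometric_def using x bounded_operatorD(1)[OF A x]
    by (intro sum.cong refl) (simp add: bounded_operator_diff[OF bounded_operator_power[OF A]]
        bounded_operatorD(3)[OF bounded_operator_power[OF A]] scale_right_diff_distrib funpow_swap1 mult.commute)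
  also have "\<dots> = x - smult H (z ^ N) ((A ^^ N) x)"
    by (subst sum_lessThan_telescope') simp
  finally show ?thesis .
qed

lemma hnorm_geometric_le:
  assumes g: "\<And>k x. x \<in> carrier H \<Longrightarrow> hnorm H ((A ^^ k) x) \<le> C * r ^ k * hnorm H x"
    and C: "0 \<le> C" and r: "0 \<le> r" and z: "cmod z * r < 1" and x: "x \<in> carrier H"
  shows "hnorm H (geometric A z N x) \<le> C / (1 - cmod z * r) * hnorm H x"
proof -
  have "hnorm H (geometric A z N x) \<le> (\<Sum>k<N. hnorm H (smult H (z ^ k) ((A ^^ k) x)))"
    unfolding geometric_def by (rule hnorm_sum) (simp add: power_closed x)
  also have "\<dots> \<le> (\<Sum>k<N. (C * hnorm H x) * (cmod z * r) ^ k)"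
  proof (rule sum_mono)
    fix k
    have "cmod z ^ k * hnorm H ((A ^^ k) x) \<le> cmod z ^ k * (C * r ^ k * hnorm H x)"
      by (intro mult_left_mono g x) simp
    thus "hnorm H (smult H (z ^ k) ((A ^^ k) x)) \<le> (C * hnorm H x) * (cmod z * r) ^ k"
      using x by (simp add: power_closed norm_power power_mult_distrib mult_ac)
  qed
  also have "\<dots> = (C * hnorm H x) * (\<Sum>k<N. (cmod z * r) ^ k)" by (simp add: sum_distrib_left)
  also have "(\<Sum>k<N. (cmod z * r) ^ k) \<le> 1 / (1 - cmod z * r)"
    using z r by (subst sum_gp_strict) (auto simp: divide_right_mono)
  finally show ?thesis using C x by (simp add: mult_left_mono)
qed

text \<open>The geometric sums are left and right inverses of \<open>1 - z A\<close> up to an error tending to 0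
  (Neumann series).\<close>

lemma growth_bound_not_in_spectrum:
  assumes gb: "growth_bound H A r" and r: "0 \<le> r" "r < cmod l"
  shows "l \<notin> spectrum H A"
proof -
  obtain C where C: "C \<ge> 0" and g: "\<And>k x. x \<in> carrier H \<Longrightarrow> hnorm H ((A ^^ k) x) \<le> C * r ^ k * hnorm H x"
    using gb by (auto simp: growth_bound_def)
  define z where "z = 1 / l"
  have l: "l \<noteq> 0" using r by auto
  define q where "q = cmod z * r"
  have q: "0 \<le> q" "q < 1" using r l by (auto simp: q_def z_def norm_divide)
  have Gle: "hnorm H (geometric A z N x) \<le> C / (1 - q) * hnorm H x" if "x \<in> carrier H" for N x
    unfolding q_def by (rule hnorm_geometric_le[OF g C r(1) q(2)[unfolded q_def] that])
  have tail: "hnorm H (smult H (z ^ N) ((A ^^ N) x)) \<le> C * hnorm H x * q ^ N" if x: "x \<in> carrier H" for N x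
  proof -
    have "cmod z ^ N * hnorm H ((A ^^ N) x) \<le> cmod z ^ N * (C * r ^ N * hnorm H x)"
      by (intro mult_left_mono g x) simp
    thus ?thesis using x by (simp add: power_closed norm_power power_mult_distrib mult_ac q_def)
  qed
  have q0: "(\<lambda>N. c * q ^ N) \<longlonglongrightarrow> 0" for c
    using tendsto_mult_right_zero[OF LIMSEQ_realpow_zero[OF q], of c] by simp
  define B where "B x = x - smult H z (A x)" for x
  have Bl: "A x - smult H l x = smult H (- l) (B x)" for x
    using l by (simp add: B_def z_def scale_right_diff_distrib)
  have Bc: "B x \<in> carrier H" if "x \<in> carrier H" for x
    using that bounded_operatorD(1)[OF A that] by (simp add: B_def)
  define M where "M = C / (1 - q)"
  have M: "M \<ge> 0" using C q by (simp add: M_def)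
  \<comment> \<open>\<open>x\<close> is \<open>geometric A z N (B x)\<close> plus a tail that tends
    to 0 as \<open>N\<close> grows.\<close>
  have below: "hnorm H x \<le> M * hnorm H (B x)" if x: "x \<in> carrier H" for x
  proof (rule LIMSEQ_le_const2)
    show "(\<lambda>N. hnorm H x - C * hnorm H x * q ^ N) \<longlonglongrightarrow> hnorm H x"
      using tendsto_diff[OF tendsto_const q0] by simp
    have "hnorm H x - C * hnorm H x * q ^ N \<le> M * hnorm H (B x)" for N
      using Gle[OF Bc[OF x], of N] tail[OF x, of N] hnorm_le_add_diff[of x "geometric A z N (B x)"] x
        geometric_closed[OF Bc[OF x]] geometric_right[OF x, of z N]
      by (simp add: M_def power_closed flip: B_def)
    thus "\<exists>N. \<forall>n\<ge>N. hnorm H x - C * hnorm H x * q ^ n \<le> M * hnorm H (B x)" by blast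
  qed
  \<comment> \<open>The partial sums \<open>s N\<close> solve the equation up to the tail, and
    \<open>below\<close> turns small residuals into small differences. So they form a Cauchy
    sequence, and \<open>B\<close> is continuous at its limit.\<close>
  have surj: "\<exists>x\<in>carrier H. B x = y" if y: "y \<in> carrier H" for y
  proof -
    define s where "s N = geometric A z N y" for N
    have s: "s N \<in> carrier H" for N unfolding s_def by (rule geometric_closed[OF y])
    have Bs: "B (s N) = y - smult H (z ^ N) ((A ^^ N) y)" for N
      unfolding s_def B_def by (rule geometric_left[OF y])
    have Bdiff: "B (u - v) = B u - B v" if "u \<in> carrier H" "v \<in> carrier H" for u v
      using that by (simp add: B_def bounded_operator_diff[OF A] scale_right_diff_distrib)
    define c where "c = C * hnorm H y"
    have err: "hnorm H (B (s N) - y) \<le> c * q ^ N" for N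
      unfolding Bs using tail[OF y, of N] y by (simp add: c_def power_closed)
    have "\<exists>x\<in>carrier H. (\<lambda>n. hnorm H (s n - x)) \<longlonglongrightarrow> 0"
    proof -
      have "\<exists>N. \<forall>m\<ge>N. \<forall>n\<ge>N. hnorm H (s m - s n) < e" if e: "e > 0" for e
      proof -
        have "(\<lambda>N. M * c * q ^ N) \<longlonglongrightarrow> 0" by (rule q0)
        then obtain N where N: "\<And>n. n \<ge> N \<Longrightarrow> \<bar>M * c * q ^ n\<bar> < e / 2"
          using LIMSEQ_D[of _ 0 "e/2"] e by fastforce
        have "hnorm H (s m - s n) < e" if "m \<ge> N" "n \<ge> N" for m n
        proof -
          have "hnorm H (s m - s n) \<le> M * hnorm H (B (s m) - B (s n))"
            using below[of "s m - s n"] s by (simp add: Bdiff)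
          also have "hnorm H (B (s m) - B (s n)) \<le> hnorm H (B (s m) - y) + hnorm H (B (s n) - y)"
            using hnorm_triangle_diff[OF Bc[OF s[of m]] y Bc[OF s[of n]]] hnorm_minus_commute[OF y Bc[OF s[of n]]]
            by simp
          also have "\<dots> \<le> c * q ^ m + c * q ^ n" by (intro add_mono err)
          finally have "hnorm H (s m - s n) \<le> M * c * q ^ m + M * c * q ^ n"
            using M by (simp add: mult_left_mono distrib_left mult.assoc)
          thus ?thesis using N[OF that(1)] N[OF that(2)] by linarith
        qed
        thus ?thesis by blast
      qed
      from Cauchy_converges[OF s this] show ?thesis by blast
    qed
    then obtain x where x: "x \<in> carrier H" and lim: "(\<lambda>n. hnorm H (s n - x)) \<longlonglongrightarrow> 0" by blast
    obtain K where K: "K \<ge> 0" "\<And>x. x \<in> carrier H \<Longrightarrow> hnorm H (A x) \<le> K * hnorm H x"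
      by (rule bounded_operator_bound[OF A]) (rule that; assumption)
    have "hnorm H (B x - y) \<le> 0"
    proof (rule LIMSEQ_le_const)
      show "(\<lambda>n. (1 + cmod z * K) * hnorm H (s n - x) + c * q ^ n) \<longlonglongrightarrow> 0"
        using tendsto_add[OF tendsto_mult_right_zero[OF lim] q0] by simp
      have "hnorm H (B x - y) \<le> (1 + cmod z * K) * hnorm H (s n - x) + c * q ^ n" for n
      proof -
        have d: "s n - x \<in> carrier H" using s x by simp
        have "hnorm H (B x - B (s n)) = hnorm H (B (s n - x))"
          using hnorm_minus_commute[OF Bc[OF x] Bc[OF s]] s x by (simp add: Bdiff)
        also have "\<dots> \<le> hnorm H (s n - x) + cmod z * hnorm H (A (s n - x))"
          using hnorm_triangle[of "s n - x" "- smult H z (A (s n - x))"] bounded_operatorD(1)[OF A d] d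
          by (simp add: B_def)
        also have "\<dots> \<le> hnorm H (s n - x) + cmod z * (K * hnorm H (s n - x))"
          using K(2)[OF d] by (simp add: mult_left_mono)
        finally show ?thesis
          using hnorm_triangle_diff[OF Bc[OF x] Bc[OF s[of n]] y] err[of n] by (simp add: algebra_simps)
      qed
      thus "\<exists>N. \<forall>n\<ge>N. hnorm H (B x - y) \<le> (1 + cmod z * K) * hnorm H (s n - x) + c * q ^ n" by blast
    qed
    hence "B x = y" using hnorm_pos[of "B x - y"] Bc[OF x] y by (metis diff_closed leD right_minus_eq)
    thus ?thesis using x by blast
  qed
  show ?thesis
    unfolding not_in_spectrum_iff[OF A] Bl
  proof (intro conjI ballI exI[of _ "M / cmod l"])
    show "hnorm H x \<le> M / cmod l * hnorm H (smult H (- l) (B x))" if "x \<in> carrier H" for x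
      using below[OF that] Bc[OF that] l by simp
    fix y assume y: "y \<in> carrier H"
    obtain x where "x \<in> carrier H" "B x = smult H (- 1 / l) y" using surj[of "smult H (- 1 / l) y"] y by auto
    thus "\<exists>x\<in>carrier H. smult H (- l) (B x) = y" using l by (intro bexI[of _ x]) auto
  qed
qed

text \<open>For \<open>0 < k < N\<close> the \<open>k\<close>-th powers of the \<open>N\<close>-th
  roots of unity sum to 0, so only the term \<open>k = 0\<close> survives.\<close>

lemma geometric_roots_of_unity_average:
  assumes N: "N > 0" and x: "x \<in> carrier H"
  shows "(\<Sum>j<N. geometric A (cis (2 * pi / N) ^ j * z) N x) = smult H (of_nat N) x"
proof -
  define w where "w = cis (2 * pi / N)"
  have "w ^ N = cis (real N * (2 * pi / N))" unfolding w_def by (rule Complex.DeMoivre)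
  hence wN: "w ^ N = 1" using N by (simp add: cis_2pi)
  have w1: "w ^ k \<noteq> 1" if k: "0 < k" "k < N" for k
  proof -
    have "w ^ k = cis (real k * (2 * pi / N))" unfolding w_def by (rule Complex.DeMoivre)
    also have "\<dots> = exp (2 * of_real pi * \<i> * of_nat k / of_nat N)" by (simp add: cis_conv_exp mult_ac)
    finally have "w ^ k = exp (2 * of_real pi * \<i> * of_nat k / of_nat N)" .
    thus ?thesis using complex_root_unity_eq_1[of N k] k by (auto dest: dvd_imp_le)
  qed
  have root_sum: "(\<Sum>j<N. (w ^ j) ^ k) = (if k = 0 then of_nat N else 0)" if "k < N" for k
  proof (cases "k = 0")
    case False
    have "(\<Sum>j<N. (w ^ j) ^ k) = (\<Sum>j<N. (w ^ k) ^ j)"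
      by (simp add: power_mult[symmetric] mult.commute)
    also have "\<dots> = ((w ^ k) ^ N - 1) / (w ^ k - 1)"
      using w1[of k] False that by (intro geometric_sum) auto
    also have "(w ^ k) ^ N = 1" by (metis wN mult.commute power_mult power_one)
    finally show ?thesis using False by simp
  qed simp
  have "(\<Sum>j<N. geometric A (w ^ j * z) N x)
      = (\<Sum>k<N. \<Sum>j<N. smult H ((w ^ j * z) ^ k) ((A ^^ k) x))"
    unfolding geometric_def by (rule sum.swap)
  also have "\<dots> = (\<Sum>k<N. smult H ((\<Sum>j<N. (w ^ j) ^ k) * z ^ k) ((A ^^ k) x))"
    by (simp add: scale_sum_left[symmetric] power_mult_distrib sum_distrib_right)
  also have "\<dots> = (\<Sum>k<N. if k = 0 then smult H (of_nat N) x else 0)"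
    by (intro sum.cong refl) (auto simp: root_sum)
  also have "\<dots> = smult H (of_nat N) x" using N by simp
  finally show ?thesis by (simp add: w_def)
qed

text \<open>A lower bound at \<open>z\<close> persists, with twice the constant, on a small ball
  around \<open>z\<close>; finitely many such balls cover the closed disc. The point
  \<open>z = 0\<close> corresponds to no \<open>l = 1 / z\<close> and is treated separately.\<close>

lemma resolvent_lower_bound_on_disc:
  assumes S: "S > 0" and spec: "\<And>l. cmod l \<ge> 1 / S \<Longrightarrow> l \<notin> spectrum H A"
  obtains M where "M > 0"
    "\<And>z x. cmod z \<le> S \<Longrightarrow> x \<in> carrier H \<Longrightarrow> hnorm H x \<le> M * hnorm H (x - smult H z (A x))"
proof -
  obtain a where a: "a \<ge> 0" "\<And>x. x \<in> carrier H \<Longrightarrow> hnorm H (A x) \<le> a * hnorm H x"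
    by (rule bounded_operator_bound[OF A]) (rule that; assumption)
  have "\<exists>M>0. \<forall>x\<in>carrier H. hnorm H x \<le> M * hnorm H (x - smult H z (A x))" if z: "z \<in> cball 0 S" for z
  proof (cases "z = 0")
    case True
    thus ?thesis by (intro exI[of _ 1]) simp
  next
    case False
    have "cmod (1 / z) \<ge> 1 / S" using False z S by (simp add: norm_divide frac_le)
    from spec[OF this] obtain M where
      M: "\<And>x. x \<in> carrier H \<Longrightarrow> hnorm H x \<le> M * hnorm H (A x - smult H (1 / z) x)"
      unfolding not_in_spectrum_iff[OF A] by blast
    \<comment> \<open>The sign of \<open>M\<close> is unknown; the absolute value and the summand 1
      make the new constant positive.\<close>
    have "hnorm H x \<le> (\<bar>M\<bar> / cmod z + 1) * hnorm H (x - smult H z (A x))" if x: "x \<in> carrier H" for x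
    proof -
      have c: "x - smult H z (A x) \<in> carrier H" using x bounded_operatorD(1)[OF A x] by simp
      have "A x - smult H (1 / z) x = smult H (- 1 / z) (x - smult H z (A x))"
        using False by (simp add: scale_right_diff_distrib)
      hence "hnorm H x \<le> M * (1 / cmod z * hnorm H (x - smult H z (A x)))"
        using M[OF x] c by (simp add: norm_divide)
      also have "\<dots> \<le> \<bar>M\<bar> * (1 / cmod z * hnorm H (x - smult H z (A x)))"
        using c by (intro mult_right_mono) auto
      also have "\<dots> \<le> (\<bar>M\<bar> / cmod z + 1) * hnorm H (x - smult H z (A x))"
        using c by (simp add: distrib_right)
      finally show ?thesis .
    qed
    moreover have "\<bar>M\<bar> / cmod z + 1 > 0" by (simp add: add_nonneg_pos)
    ultimately show ?thesis by blast
  qed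
  then obtain m where m: "\<And>z. z \<in> cball 0 S \<Longrightarrow> m z > 0"
    "\<And>z x. z \<in> cball 0 S \<Longrightarrow> x \<in> carrier H \<Longrightarrow> hnorm H x \<le> m z * hnorm H (x - smult H z (A x))"
    by metis
  \<comment> \<open>On a ball of this radius the perturbation costs at most half of
    \<open>hnorm H x\<close>, as \<open>m z * d z * (a + 1) = 1 / 2\<close>. Absorbing it doubles
    the constant.\<close>
  define d where "d z = 1 / (2 * m z * (a + 1))" for z
  have d: "d z > 0" if "z \<in> cball 0 S" for z using m(1)[OF that] a by (simp add: d_def)
  have near: "hnorm H x \<le> 2 * m z * hnorm H (x - smult H w (A x))"
    if z: "z \<in> cball 0 S" and w: "w \<in> ball z (d z)" and x: "x \<in> carrier H" for z w x
  proof -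
    note Ax = bounded_operatorD(1)[OF A x]
    have c: "x - smult H w (A x) \<in> carrier H" using x Ax by simp
    have eq: "x - smult H z (A x) = (x - smult H w (A x)) + smult H (w - z) (A x)"
      by (simp add: scale_left_diff_distrib)
    have "hnorm H (x - smult H z (A x)) \<le> hnorm H (x - smult H w (A x)) + cmod (w - z) * hnorm H (A x)"
      unfolding eq using hnorm_triangle[OF c, of "smult H (w - z) (A x)"] Ax by simp
    also have "cmod (w - z) * hnorm H (A x) \<le> d z * ((a + 1) * hnorm H x)"
    proof (rule mult_mono)
      show "cmod (w - z) \<le> d z" using w by (simp add: dist_norm norm_minus_commute)
      show "hnorm H (A x) \<le> (a + 1) * hnorm H x" using a(2)[OF x] x by (simp add: distrib_right add_increasing2)
    qed (use d[OF z] Ax in auto)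
    finally have "m z * hnorm H (x - smult H z (A x))
        \<le> m z * (hnorm H (x - smult H w (A x)) + d z * ((a + 1) * hnorm H x))"
      using m(1)[OF z] by simp
    also have "\<dots> = m z * hnorm H (x - smult H w (A x)) + hnorm H x / 2"
    proof -
      have "m z * d z * (a + 1) = 1 / 2" using m(1)[OF z] add_nonneg_pos[OF a(1) zero_less_one]
        by (simp add: d_def)
      hence "m z * (d z * ((a + 1) * hnorm H x)) = hnorm H x / 2" by (metis mult.assoc mult.commute mult_1 times_divide_eq_right)
      thus ?thesis by (simp add: distrib_left)
    qed
    finally show ?thesis using m(2)[OF z x] by simp
  qed
  obtain D where D: "D \<subseteq> cball 0 S" "finite D" "cball 0 S \<subseteq> (\<Union>z\<in>D. ball z (d z))"
    by (rule compactE_image[of "cball (0::complex) S" "cball 0 S" "\<lambda>z. ball z (d z)"])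
      (use d that in \<open>auto intro!: bexI simp: dist_commute\<close>)
  \<comment> \<open>The sum dominates every local constant of the finite subcover, and the 1 gives
    \<open>M > 0\<close>.\<close>
  define M where "M = (\<Sum>z\<in>D. 2 * m z) + 1"
  show ?thesis
  proof
    have mn: "0 \<le> 2 * m z" if "z \<in> D" for z using m(1)[of z] D that by fastforce
    show "M > 0" unfolding M_def using mn by (intro add_nonneg_pos sum_nonneg) auto
    fix w x assume w: "cmod w \<le> S" and x: "x \<in> carrier H"
    have c: "x - smult H w (A x) \<in> carrier H" using x bounded_operatorD(1)[OF A x] by simp
    have "w \<in> cball 0 S" using w by simp
    then obtain z where z: "z \<in> D" "w \<in> ball z (d z)" using D by blast
    have "2 * m z \<le> M" unfolding M_def using member_le_sum[of z D "\<lambda>z. 2 * m z"] z D mn by fastforce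
    hence "2 * m z * hnorm H (x - smult H w (A x)) \<le> M * hnorm H (x - smult H w (A x))"
      using c by (intro mult_right_mono) auto
    thus "hnorm H x \<le> M * hnorm H (x - smult H w (A x))" using near[of z w x] z D x by fastforce
  qed
qed

text \<open>Averaging the resolvents \<open>(1 - \<omega> s A)\<^sup>-\<^sup>1\<close> over the \<open>N\<close>-th roots of unity \<open>\<omega>\<close> gives
  \<open>(1 - s\<^sup>N A\<^sup>N)\<^sup>-\<^sup>1\<close>. The averages are Lipschitz continuous in \<open>s\<close> uniformly in \<open>N\<close>, which transports
  bounds on \<open>s\<^sup>N A\<^sup>N\<close> to nearby values of \<open>s\<close>.\<close>

lemma power_bound_step:
  assumes M: "M > 0" and low: "\<And>z x. cmod z \<le> S \<Longrightarrow> x \<in> carrier H \<Longrightarrow> hnorm H x \<le> M * hnorm H (x - smult H z (A x))"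
    and surj: "\<And>z y. cmod z \<le> S \<Longrightarrow> y \<in> carrier H \<Longrightarrow> \<exists>x\<in>carrier H. x - smult H z (A x) = y"
    and a: "0 \<le> a" "\<And>x. x \<in> carrier H \<Longrightarrow> hnorm H (A x) \<le> a * hnorm H x"
    and s: "0 \<le> s" "s \<le> S" and s': "0 \<le> s'" "s' \<le> S" and close: "M\<^sup>2 * a * \<bar>s - s'\<bar> \<le> 1 / 4"
    and N: "N > 0" and bnd: "\<And>x. x \<in> carrier H \<Longrightarrow> s' ^ N * hnorm H ((A ^^ N) x) \<le> hnorm H x"
    and x: "x \<in> carrier H"
  shows "s ^ N * hnorm H ((A ^^ N) x) \<le> 5 * hnorm H x"
proof -
  define w where "w = cis (2 * pi / N)"
  have w: "cmod (w ^ j) = 1" for j by (simp add: w_def norm_power)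
  have "w ^ N = cis (real N * (2 * pi / N))" unfolding w_def by (rule Complex.DeMoivre)
  hence wN: "w ^ N = 1" using N by (simp add: cis_2pi)
  have zN: "(w ^ j * c) ^ N = c ^ N" for j c
    by (simp add: power_mult_distrib power_mult[symmetric] mult.commute[of j] power_mult[of w N j] wN)
  define y where "y = x - smult H (of_real s ^ N) ((A ^^ N) x)"
  have y: "y \<in> carrier H" using x power_closed by (simp add: y_def)
  \<comment> \<open>The geometric sum in \<open>x\<close> telescopes to \<open>y\<close>, so
    \<open>u j\<close> is the resolvent at \<open>w ^ j * of_real s\<close> applied to
    \<open>y\<close>, and \<open>x\<close> is the average of the \<open>u j\<close>.\<close>
  define u where "u j = geometric A (w ^ j * of_real s) N x" for j
  have u: "u j \<in> carrier H" for j unfolding u_def by (rule geometric_closed[OF x])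
  have uB: "u j - smult H (w ^ j * of_real s) (A (u j)) = y" for j
    unfolding u_def geometric_left[OF x] y_def zN ..
  have zs: "cmod (w ^ j * of_real s) \<le> S" "cmod (w ^ j * of_real s') \<le> S" for j
    using s s' w[of j] by (auto simp: norm_mult)
  \<comment> \<open>At \<open>s'\<close> the given vector is \<open>y\<close>, so surjectivity
    provides the resolvent values \<open>v j\<close>. Their average \<open>x'\<close> will solve the
    equation of \<open>x\<close> with \<open>s'\<close> in place of \<open>s\<close>.\<close>
  have "\<forall>j. \<exists>v\<in>carrier H. v - smult H (w ^ j * of_real s') (A v) = y"
    using surj[OF zs(2) y] by blast
  then obtain v where v: "\<And>j. v j \<in> carrier H"
    and vB: "\<And>j. v j - smult H (w ^ j * of_real s') (A (v j)) = y" by metis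
  have uv: "hnorm H (u j - v j) \<le> 1 / 4 * hnorm H y" for j
  proof -
    note Av = bounded_operatorD(1)[OF A v]
    \<comment> \<open>The resolvent identity: both equations have right-hand side \<open>y\<close>,
      which leaves only the change of the coefficient of \<open>A\<close>.\<close>
    have "u j - v j - smult H (w ^ j * of_real s) (A (u j - v j))
        = (u j - smult H (w ^ j * of_real s) (A (u j))) - (v j - smult H (w ^ j * of_real s) (A (v j)))"
      using u v by (simp add: bounded_operator_diff[OF A] scale_right_diff_distrib)
    also have "\<dots> = (v j - smult H (w ^ j * of_real s') (A (v j))) - (v j - smult H (w ^ j * of_real s) (A (v j)))"
      unfolding uB vB ..
    also have "\<dots> = smult H (w ^ j * of_real (s - s')) (A (v j))"
      by (simp add: right_diff_distrib scale_left_diff_distrib)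
    finally have "hnorm H (u j - v j) \<le> M * hnorm H (smult H (w ^ j * of_real (s - s')) (A (v j)))"
      using low[OF zs(1), of "u j - v j" j] u v by simp
    also have "hnorm H (smult H (w ^ j * of_real (s - s')) (A (v j))) = \<bar>s - s'\<bar> * hnorm H (A (v j))"
      using Av w[of j] by (simp add: norm_mult del: of_real_diff)
    also have "hnorm H (A (v j)) \<le> a * hnorm H (v j)" by (rule a(2)[OF v])
    also have "hnorm H (v j) \<le> M * hnorm H y" using low[OF zs(2) v, of j j] by (simp add: vB)
    finally have "hnorm H (u j - v j) \<le> M * (\<bar>s - s'\<bar> * (a * (M * hnorm H y)))"
      using M a(1) by (simp add: mult_left_mono)
    also have "\<dots> = (M\<^sup>2 * a * \<bar>s - s'\<bar>) * hnorm H y" by (simp add: power2_eq_square mult_ac)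
    also have "\<dots> \<le> 1 / 4 * hnorm H y" using close y by (intro mult_right_mono) auto
    finally show ?thesis .
  qed
  define c where "c = (1 / of_nat N :: complex)"
  define x' where "x' = smult H c (\<Sum>j<N. v j)"
  have x': "x' \<in> carrier H" using v by (simp add: x'_def)
  have x_avg: "x = smult H c (\<Sum>j<N. u j)"
    using geometric_roots_of_unity_average[OF N x, of "of_real s"] N by (simp add: u_def w_def c_def)
  have "x' - smult H (of_real s' ^ N) ((A ^^ N) x')
      = smult H c (\<Sum>j<N. v j - smult H (of_real s' ^ N) ((A ^^ N) (v j)))"
    unfolding x'_def using v power_closed
    by (simp add: bounded_operatorD(3)[OF bounded_operator_power[OF A]] bounded_operator_sum[OF bounded_operator_power[OF A]]
        sum_subtractf scale_right_diff_distrib scale_sum_right mult.commute)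
  also have "\<dots> = smult H c (\<Sum>j<N. geometric A (w ^ j * of_real s') N y)"
  proof -
    have "v j - smult H (of_real s' ^ N) ((A ^^ N) (v j)) = geometric A (w ^ j * of_real s') N y" for j
      using geometric_right[OF v, of "w ^ j * of_real s'" N j] unfolding vB zN by simp
    thus ?thesis by simp
  qed
  also have "\<dots> = y"
    using geometric_roots_of_unity_average[OF N y, of "of_real s'"] N by (simp add: w_def c_def)
  finally have y_eq: "y = x' - smult H (of_real s' ^ N) ((A ^^ N) x')" ..
  have "hnorm H y \<le> hnorm H x' + s' ^ N * hnorm H ((A ^^ N) x')"
    unfolding y_eq using hnorm_triangle[of x' "- smult H (of_real s' ^ N) ((A ^^ N) x')"] x' power_closed[OF x'] s'
    by (simp add: norm_power)
  hence y2: "hnorm H y \<le> 2 * hnorm H x'" using bnd[OF x'] by simp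
  have "x' - x = smult H c (\<Sum>j<N. v j - u j)"
    unfolding x'_def x_avg by (simp add: scale_right_diff_distrib sum_subtractf)
  hence "hnorm H (x' - x) = 1 / N * hnorm H (\<Sum>j<N. v j - u j)"
    using u v by (simp add: c_def norm_divide)
  also have "\<dots> \<le> 1 / N * (\<Sum>j<N. hnorm H (v j - u j))"
    using u v by (intro mult_left_mono hnorm_sum) auto
  also have "(\<Sum>j<N. hnorm H (v j - u j)) \<le> (\<Sum>j<N. 1 / 4 * hnorm H y)"
    by (intro sum_mono) (metis uv hnorm_minus_commute u v)
  hence "1 / N * (\<Sum>j<N. hnorm H (v j - u j)) \<le> 1 / N * (\<Sum>j<N. 1 / 4 * hnorm H y)"
    by (intro mult_left_mono) auto
  also have "\<dots> = 1 / 4 * hnorm H y" using N by simp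
  finally have "hnorm H x' \<le> hnorm H x + 1 / 4 * hnorm H y"
    using hnorm_le_add_diff[OF x' x] by simp
  \<comment> \<open>\<open>\<parallel>y\<parallel> \<le> 2 \<parallel>x'\<parallel>\<close> and
    \<open>\<parallel>x'\<parallel> \<le> \<parallel>x\<parallel> + \<parallel>y\<parallel> /
    4\<close> combine to \<open>\<parallel>y\<parallel> \<le> 2 \<parallel>x\<parallel> +
    \<parallel>y\<parallel> / 2\<close>. This explains the 1/4 in \<open>close\<close>; the final 5
    is 1 + 4.\<close>
  hence y4: "hnorm H y \<le> 4 * hnorm H x" using y2 by simp
  have "smult H (of_real s ^ N) ((A ^^ N) x) = x - y" by (simp add: y_def)
  hence "s ^ N * hnorm H ((A ^^ N) x) = hnorm H (x - y)"
    using s power_closed[OF x] hnorm_smult[OF power_closed[OF x], of "of_real s ^ N" N]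
    by (simp add: norm_power)
  also have "\<dots> \<le> hnorm H x + hnorm H y" using hnorm_triangle[of x "- y"] x y by simp
  finally show ?thesis using y4 by simp
qed

text \<open>Continuation of \<open>P s\<close> from 0 to \<open>S\<close>. Going back from
  \<open>s0\<close> to a smaller \<open>s'\<close> improves the constant 5 to 1 for large
  \<open>N\<close>, because \<open>5 * (s' / s0) ^ N\<close> tends to 0;
  \<open>power_bound_step\<close> then moves beyond \<open>s0\<close> at the price of 5 again. The
  step length is independent of \<open>s0\<close>, so finitely many steps reach
  \<open>S\<close>.\<close>

lemma growth_bound_if_disjoint_spectrum:
  assumes S: "S > 0" and spec: "\<And>l. cmod l \<ge> 1 / S \<Longrightarrow> l \<notin> spectrum H A"
  shows "growth_bound H A (1 / S)"
proof -
  obtain a where a: "a \<ge> 0" "\<And>x. x \<in> carrier H \<Longrightarrow> hnorm H (A x) \<le> a * hnorm H x"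
    by (rule bounded_operator_bound[OF A]) (rule that; assumption)
  obtain M where M: "M > 0"
    and low: "\<And>z x. cmod z \<le> S \<Longrightarrow> x \<in> carrier H \<Longrightarrow> hnorm H x \<le> M * hnorm H (x - smult H z (A x))"
    by (rule resolvent_lower_bound_on_disc[OF S spec]) (assumption | (rule that; assumption))+
  have surj: "\<exists>x\<in>carrier H. x - smult H z (A x) = y" if z: "cmod z \<le> S" and y: "y \<in> carrier H" for z y
  proof (cases "z = 0")
    case False
    have "cmod (1 / z) \<ge> 1 / S" using False z S by (simp add: norm_divide frac_le)
    from spec[OF this] obtain x where x: "x \<in> carrier H" "A x - smult H (1 / z) x = smult H (- 1 / z) y"
      unfolding not_in_spectrum_iff[OF A] using y by (meson smult_closed)
    have "x - smult H z (A x) = smult H (- z) (A x - smult H (1 / z) x)"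
      using False by (simp add: scale_right_diff_distrib)
    thus ?thesis using x False by (intro bexI[of _ x]) auto
  qed (use y in auto)
  define P where "P s \<longleftrightarrow> (\<exists>N0. \<forall>N\<ge>N0. \<forall>x\<in>carrier H. s ^ N * hnorm H ((A ^^ N) x) \<le> 5 * hnorm H x)" for s
  \<comment> \<open>Going back by \<open>d\<close> and forward by \<open>d\<close> changes
    \<open>s\<close> by at most \<open>2 * d\<close>, and
    \<open>M\<^sup>2 * (a + 1) * (2 * d) = 1 / 4\<close> is the closeness that
    \<open>power_bound_step\<close> requires.\<close>
  define d where "d = 1 / (8 * M\<^sup>2 * (a + 1))"
  have d: "d > 0" using M a by (simp add: d_def)
  have step: "P s" if s0: "0 \<le> s0" "s0 \<le> S" and P0: "P s0" and s: "s0 \<le> s" "s \<le> S" "s \<le> s0 + d" for s0 s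
  proof -
    define s' where "s' = max 0 (s0 - d)"
    have "\<exists>N0. \<forall>N\<ge>N0. \<forall>x\<in>carrier H. s' ^ N * hnorm H ((A ^^ N) x) \<le> hnorm H x"
    proof (cases "s' = 0")
      case True
      show ?thesis by (rule exI[of _ 1]) (auto simp: True power_0_left)
    next
      case False
      hence lt: "0 < s'" "s' < s0" using d by (auto simp: s'_def max_def split: if_splits)
      obtain N0 where N0: "\<And>N x. N \<ge> N0 \<Longrightarrow> x \<in> carrier H \<Longrightarrow> s0 ^ N * hnorm H ((A ^^ N) x) \<le> 5 * hnorm H x"
        using P0 by (auto simp: P_def)
      have "(\<lambda>N. (s' / s0) ^ N) \<longlonglongrightarrow> 0" using lt by (intro LIMSEQ_realpow_zero) auto
      then obtain N1 where N1: "\<And>N. N \<ge> N1 \<Longrightarrow> (s' / s0) ^ N < 1 / 5"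
        using LIMSEQ_D[of "\<lambda>N. (s' / s0) ^ N" 0 "1 / 5"] lt by fastforce
      have "s' ^ N * hnorm H ((A ^^ N) x) \<le> hnorm H x" if N: "N \<ge> max N0 N1" and x: "x \<in> carrier H" for N x
      proof -
        have "s' ^ N * hnorm H ((A ^^ N) x) = (s' / s0) ^ N * (s0 ^ N * hnorm H ((A ^^ N) x))"
          using lt by (simp add: power_divide)
        also have "\<dots> \<le> 1 / 5 * (5 * hnorm H x)"
          by (rule mult_mono) (use N0[of N x] N1[of N] N x lt power_closed[OF x] in auto)
        finally show ?thesis by simp
      qed
      thus ?thesis by blast
    qed
    then obtain N0 where N0: "\<And>N x. N \<ge> N0 \<Longrightarrow> x \<in> carrier H \<Longrightarrow> s' ^ N * hnorm H ((A ^^ N) x) \<le> hnorm H x"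
      by blast
    have "\<bar>s - s'\<bar> \<le> 2 * d" using s0 s d by (auto simp: s'_def max_def)
    hence "M\<^sup>2 * a * \<bar>s - s'\<bar> \<le> M\<^sup>2 * (a + 1) * (2 * d)" using a by (intro mult_mono) auto
    also have "\<dots> = 1 / 4" using M add_nonneg_pos[OF a(1) zero_less_one] by (simp add: d_def)
    finally have close: "M\<^sup>2 * a * \<bar>s - s'\<bar> \<le> 1 / 4" .
    have "s ^ N * hnorm H ((A ^^ N) x) \<le> 5 * hnorm H x" if "N \<ge> max 1 N0" "x \<in> carrier H" for N x
    proof (rule power_bound_step[OF M low surj a _ _ _ _ close])
      show "0 \<le> s" "s \<le> S" "0 \<le> s'" "s' \<le> S" using s s0 d by (auto simp: s'_def)
      show "N > 0" using that by simp
      show "s' ^ N * hnorm H ((A ^^ N) x) \<le> hnorm H x" if "x \<in> carrier H" for x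
        using N0 that \<open>N \<ge> max 1 N0\<close> by simp
    qed (use that in auto)
    thus ?thesis unfolding P_def by blast
  qed
  have "P (min S (of_nat k * d))" for k
  proof (induction k)
    case 0
    show ?case unfolding P_def using S by (intro exI[of _ 1]) (auto simp: power_0_left)
  next
    case (Suc k)
    show ?case
      by (rule step[OF _ _ Suc.IH]) (use S d in \<open>auto simp: algebra_simps min_def\<close>)
  qed
  moreover obtain k :: nat where "S \<le> of_nat k * d"
    using reals_Archimedean3[OF d] by (meson less_imp_le)
  ultimately have "P S" by (metis min.absorb1)
  then obtain N0 where N0: "\<And>N x. N \<ge> N0 \<Longrightarrow> x \<in> carrier H \<Longrightarrow> S ^ N * hnorm H ((A ^^ N) x) \<le> 5 * hnorm H x"
    by (auto simp: P_def)
  \<comment> \<open>The sum absorbs the finitely many exponents below \<open>N0\<close>, where only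
    \<open>a ^ N\<close> bounds the power.\<close>
  define C where "C = 5 + (\<Sum>k<N0. (S * a) ^ k)"
  have Cs: "(\<Sum>k<N0. (S * a) ^ k) \<ge> 0" using S a by (intro sum_nonneg) auto
  have "S ^ N * hnorm H ((A ^^ N) x) \<le> C * hnorm H x" if x: "x \<in> carrier H" for N x
  proof (cases "N \<ge> N0")
    case True
    have "5 * hnorm H x \<le> C * hnorm H x" using Cs x by (intro mult_right_mono) (auto simp: C_def)
    thus ?thesis using N0[OF True x] by simp
  next
    case False
    have "S ^ N * hnorm H ((A ^^ N) x) \<le> S ^ N * (a ^ N * hnorm H x)"
      using hnorm_power_le[OF a x] S by (intro mult_left_mono) auto
    also have "\<dots> = (S * a) ^ N * hnorm H x" by (simp add: power_mult_distrib)
    also have "(S * a) ^ N \<le> (\<Sum>k<N0. (S * a) ^ k)"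
      using False S a by (intro member_le_sum) auto
    hence "(S * a) ^ N * hnorm H x \<le> C * hnorm H x"
      using x by (intro mult_right_mono) (auto simp: C_def)
    finally show ?thesis .
  qed
  hence "hnorm H ((A ^^ N) x) \<le> C * (1 / S) ^ N * hnorm H x" if "x \<in> carrier H" for N x
    using that S by (simp add: power_one_over field_simps)
  moreover have "C \<ge> 0" using Cs by (simp add: C_def)
  ultimately show ?thesis unfolding growth_bound_def by blast
qed

text \<open>With an empty spectrum the powers would decay at every rate \<open>1 / S\<close>. But if
  0 is not in the spectrum then \<open>A\<close> is bounded below, and \<open>(A ^^ k) x\<close>
  cannot decay faster than \<open>1 / m ^ k\<close>.\<close>

lemma spectrum_nonempty:
  assumes ne: "carrier H \<noteq> {0}"
  shows "spectrum H A \<noteq> {}"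
proof
  assume empty: "spectrum H A = {}"
  hence gb: "growth_bound H A (1 / S)" if "S > 0" for S
    using that by (intro growth_bound_if_disjoint_spectrum) auto
  obtain x where x: "x \<in> carrier H" "x \<noteq> 0" using ne zero_closed by blast
  from empty have "0 \<notin> spectrum H A" by simp
  then obtain M where M: "\<And>x. x \<in> carrier H \<Longrightarrow> hnorm H x \<le> M * hnorm H (A x)"
    unfolding not_in_spectrum_iff[OF A] by auto
  define m where "m = \<bar>M\<bar> + 1"
  have m: "m > 0" by (simp add: m_def)
  have le: "hnorm H x \<le> m ^ k * hnorm H ((A ^^ k) x)" for k
  proof (induction k)
    case (Suc k)
    note c = power_closed[OF x(1)]
    have "hnorm H ((A ^^ k) x) \<le> M * hnorm H ((A ^^ Suc k) x)" using M[OF c] by simp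
    also have "\<dots> \<le> m * hnorm H ((A ^^ Suc k) x)"
      using c[of "Suc k"] by (intro mult_right_mono) (auto simp: m_def)
    finally have "m ^ k * hnorm H ((A ^^ k) x) \<le> m ^ k * (m * hnorm H ((A ^^ Suc k) x))"
      using m by (intro mult_left_mono) auto
    thus ?case using Suc.IH by (simp add: mult_ac)
  qed simp
  \<comment> \<open>The rate \<open>1 / (2 * m)\<close> beats the lower bound by the factor
    \<open>(1 / 2) ^ k\<close>.\<close>
  obtain C where C: "C \<ge> 0" "\<And>k. hnorm H ((A ^^ k) x) \<le> C * (1 / (2 * m)) ^ k * hnorm H x"
    using gb[of "2 * m"] m x(1) unfolding growth_bound_def by auto
  have "hnorm H x \<le> C * hnorm H x * (1 / 2) ^ k" for k
  proof -
    have "hnorm H x \<le> m ^ k * (C * (1 / (2 * m)) ^ k * hnorm H x)"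
      by (rule order_trans[OF le mult_left_mono[OF C(2)]]) (use m in simp)
    thus ?thesis using m by (simp add: power_divide power_mult_distrib mult_ac)
  qed
  moreover have "(\<lambda>k. C * hnorm H x * (1 / 2) ^ k) \<longlonglongrightarrow> 0"
    using tendsto_mult_right_zero[OF LIMSEQ_realpow_zero[of "1/2"]] by simp
  ultimately have "hnorm H x \<le> 0" by (intro LIMSEQ_le_const) auto
  thus False using hnorm_pos[OF x(1)] x(2) by simp
qed

text \<open>Together with nonemptiness, this is what makes the supremum in
  \<open>spectral_radius\<close> a least upper bound.\<close>

lemma spectrum_bounded: "bdd_above (cmod ` spectrum H A)"
proof -
  obtain a where a: "a \<ge> 0" "\<And>x. x \<in> carrier H \<Longrightarrow> hnorm H (A x) \<le> a * hnorm H x"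
    by (rule bounded_operator_bound[OF A]) (rule that; assumption)
  have "growth_bound H A a" unfolding growth_bound_def
    using hnorm_power_le[OF a] by (intro exI[of _ 1]) auto
  hence "cmod l \<le> a" if "l \<in> spectrum H A" for l
    using growth_bound_not_in_spectrum[of a l] a(1) that by fastforce
  thus ?thesis by (intro bdd_aboveI2)
qed

lemma spectral_radius_nonneg:
  assumes "carrier H \<noteq> {0}"
  shows "0 \<le> spectral_radius H A"
proof -
  obtain l where "l \<in> spectrum H A" using spectrum_nonempty[OF assms] by blast
  thus ?thesis unfolding spectral_radius_def
    using cSUP_upper[OF _ spectrum_bounded] norm_ge_zero order_trans by blast
qed

lemma spectral_radius_le:
  assumes "carrier H \<noteq> {0}" "growth_bound H A r" "0 \<le> r"
  shows "spectral_radius H A \<le> r"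
  unfolding spectral_radius_def
  using spectrum_nonempty[OF assms(1)] growth_bound_not_in_spectrum[OF assms(2,3)]
  by (intro cSUP_least) force+

text \<open>Strictness frees the whole closed region \<open>cmod l \<ge> r\<close> from the
  spectrum, as the continuation up to \<open>S = 1 / r\<close> requires.\<close>

lemma growth_bound_above_spectral_radius:
  assumes "carrier H \<noteq> {0}" and r: "spectral_radius H A < r"
  shows "growth_bound H A r"
proof -
  have "0 < r" using spectral_radius_nonneg[OF assms(1)] r by simp
  moreover have "l \<notin> spectrum H A" if "cmod l \<ge> r" for l
    using cSUP_upper[OF _ spectrum_bounded, of l] r that unfolding spectral_radius_def by force
  ultimately show ?thesis using growth_bound_if_disjoint_spectrum[of "1 / r"] by simp
qed

end

end

section \<open>The spectral radius of a symmetric tensor power\<close>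

context hilbert_tensor_power
begin

text \<open>Replaces powers of the symmetric product by a tensor operator with \<open>A ^^ k\<close>
  in every slot, to which the slotwise estimates apply.\<close>

lemma sym_tensor_operator_funpow:
  assumes A: "bounded_operator H A" and v: "v \<in> carrier (sym_tensor_power H n)"
  shows "((sym_tensor_operator H n (\<lambda>_. A)) ^^ k) v = tensor_operator H n (\<lambda>_. A ^^ k) v"
proof -
  let ?S = "sym_tensor_operator H n (\<lambda>_. A)" and ?R = "tensor_operator H n (\<lambda>_. A)"
  have vT: "v \<in> carrier (tensor_power H n)" using v by (simp add: sym_tensor_power_carrier)
  have R: "bounded_operator (tensor_power H n) ?R" using A by (intro tensor_operator_bounded)
  \<comment> \<open>Membership is carried through the induction because \<open>?S\<close> and
    \<open>?R\<close> are identified on symmetric vectors only.\<close>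
  have "(?S ^^ k) v = (?R ^^ k) v \<and> (?R ^^ k) v \<in> carrier (sym_tensor_power H n)"
    by (induction k) (auto simp: v sym_tensor_operator_power intro: tensor_operator_power_in_sym[OF A])
  moreover have "(?R ^^ k) v = tensor_operator H n (\<lambda>_. A ^^ k) v"
  proof (rule T.operators_eqI[OF T.T.bounded_operator_power[OF R] tensor_operator_bounded _ vT])
    show Ak: "bounded_operator H (A ^^ k)" for k by (rule bounded_operator_power[OF A])
    fix u assume u: "u \<in> tuples H n"
    have "(?R ^^ k) (simple_tensor H n u) = simple_tensor H n (\<lambda>i. (A ^^ k) (u i))"
    proof (induction k)
      case (Suc k)
      have "(\<lambda>i. (A ^^ k) (u i)) \<in> tuples H n"
        by (rule Pi_I) (rule bounded_operatorD(1)[OF Ak Pi_mem[OF u]])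
      hence "?R (simple_tensor H n (\<lambda>i. (A ^^ k) (u i))) = simple_tensor H n (\<lambda>i. A ((A ^^ k) (u i)))"
        by (rule tensor_operator_simple[OF A])
      with Suc.IH show ?case by simp
    qed simp
    also have "\<dots> = tensor_operator H n (\<lambda>_. A ^^ k) (simple_tensor H n u)"
      by (rule tensor_operator_simple[OF Ak u, symmetric])
    finally show "(?R ^^ k) (simple_tensor H n u) = tensor_operator H n (\<lambda>_. A ^^ k) (simple_tensor H n u)" .
  qed
  ultimately show ?thesis by simp
qed

lemma growth_bound_sym_tensor_operator:
  assumes A: "bounded_operator H A" and r: "0 \<le> r" and gb: "growth_bound H A r"
  shows "growth_bound (sym_tensor_power H n) (sym_tensor_operator H n (\<lambda>_. A)) (r ^ n)"
proof -
  obtain C where C: "C \<ge> 0" "\<And>k x. x \<in> carrier H \<Longrightarrow> hnorm H ((A ^^ k) x) \<le> C * r ^ k * hnorm H x"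
    using gb by (auto simp: growth_bound_def)
  have "hnorm (sym_tensor_power H n) ((sym_tensor_operator H n (\<lambda>_. A) ^^ k) v)
      \<le> C ^ n * (r ^ n) ^ k * hnorm (sym_tensor_power H n) v"
    if v: "v \<in> carrier (sym_tensor_power H n)" for k v
  proof -
    have "v \<in> carrier (tensor_power H n)" using v by (simp add: sym_tensor_power_carrier)
    hence "hnorm (tensor_power H n) (tensor_operator H n (\<lambda>_. A ^^ k) v)
        \<le> (\<Prod>i=1..n. C * r ^ k) * hnorm (tensor_power H n) v"
      by (intro hnorm_tensor_operator_le bounded_operator_power[OF A] C(2)) (use C r in auto)
    also have "(\<Prod>i=1..n. C * r ^ k) = C ^ n * (r ^ n) ^ k"
      by (simp add: power_mult_distrib power_mult[symmetric] mult.commute)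
    finally show ?thesis using sym_tensor_operator_funpow[OF A v] by simp
  qed
  thus ?thesis unfolding growth_bound_def using C by (intro exI[of _ "C ^ n"]) auto
qed

text \<open>Tested on \<open>x \<otimes> ... \<otimes> x\<close>, whose image has norm
  \<open>\<parallel>A\<^sup>k x\<parallel>\<^sup>n\<close>, the bound gives the claim after taking
  \<open>n\<close>-th roots.\<close>

lemma growth_bound_of_sym_tensor_operator:
  assumes A: "bounded_operator H A" and r: "0 \<le> r" and n: "n \<ge> 1"
    and gb: "growth_bound (sym_tensor_power H n) (sym_tensor_operator H n (\<lambda>_. A)) (r ^ n)"
  shows "growth_bound H A r"
proof -
  obtain C where C: "C \<ge> 0"
    "\<And>k v. v \<in> carrier (sym_tensor_power H n) \<Longrightarrow> hnorm (sym_tensor_power H n) ((sym_tensor_operator H n (\<lambda>_. A) ^^ k) v)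
      \<le> C * (r ^ n) ^ k * hnorm (sym_tensor_power H n) v"
    using gb unfolding growth_bound_def by blast
  have "hnorm H ((A ^^ k) x) \<le> (C + 1) * r ^ k * hnorm H x" if x: "x \<in> carrier H" for k x
  proof -
    have Ak: "bounded_operator H (A ^^ k)" by (rule bounded_operator_power[OF A])
    note Akx = bounded_operatorD(1)[OF Ak x]
    have "tensor_operator H n (\<lambda>_. A ^^ k) (simple_tensor H n (\<lambda>_. x)) = simple_tensor H n (\<lambda>_. (A ^^ k) x)"
      by (rule tensor_operator_simple[OF Ak]) (use x in auto)
    hence "hnorm H ((A ^^ k) x) ^ n \<le> C * (r ^ n) ^ k * hnorm H x ^ n"
      using C(2)[OF pure_in_sym_tensor_power[OF x], of k] x
      by (simp add: sym_tensor_operator_funpow[OF A pure_in_sym_tensor_power[OF x]] hnorm_pure Akx)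
    also have "\<dots> = C * (r ^ k * hnorm H x) ^ n"
      by (simp add: power_mult_distrib power_mult[symmetric] mult.commute)
    \<comment> \<open>Enlarging \<open>C\<close> to \<open>(C + 1) ^ n\<close> makes the right-hand
      side an \<open>n\<close>-th power; this works because \<open>C + 1 \<ge> 1\<close> and
      \<open>n \<ge> 1\<close>.\<close>
    also have "\<dots> \<le> (C + 1) ^ n * (r ^ k * hnorm H x) ^ n"
    proof (rule mult_right_mono)
      have "C + 1 \<le> (C + 1) ^ n" using C n by (intro self_le_power) auto
      thus "C \<le> (C + 1) ^ n" by simp
    qed (use r x in auto)
    also have "\<dots> = ((C + 1) * r ^ k * hnorm H x) ^ n" by (simp add: power_mult_distrib)
    finally show ?thesis
      by (subst (asm) power_mono_iff) (use C r x n Akx in auto)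
  qed
  thus ?thesis unfolding growth_bound_def using C(1) by (intro exI[of _ "C + 1"]) auto
qed

lemma spectral_radius_sym_tensor_operator:
  assumes A: "bounded_operator H A" and ne: "carrier H \<noteq> {0}" and n: "n \<ge> 1"
  shows "spectral_radius (sym_tensor_power H n) (sym_tensor_operator H n (\<lambda>_. A)) = spectral_radius H A ^ n"
proof -
  let ?S = "sym_tensor_operator H n (\<lambda>_. A)"
  interpret S: hilbert_space "sym_tensor_power H n" by (rule hilbert_space_sym_tensor_power)
  note S = sym_tensor_operator_power_bounded[OF A]
  obtain x where x: "x \<in> carrier H" "x \<noteq> 0" using ne zero_closed by blast
  \<comment> \<open>The symmetric power has to be nonzero for its spectrum to be nonempty.\<close>
  have "hnorm (tensor_power H n) (simple_tensor H n (\<lambda>_. x)) > 0" using x by (simp add: hnorm_pure)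
  hence "simple_tensor H n (\<lambda>_. x) \<noteq> 0" by auto
  hence neS: "carrier (sym_tensor_power H n) \<noteq> {0}" using pure_in_sym_tensor_power[OF x(1)] by blast
  note nn = spectral_radius_nonneg[OF A ne] S.spectral_radius_nonneg[OF S neS]
  show ?thesis
  proof (rule antisym)
    show "spectral_radius (sym_tensor_power H n) ?S \<le> spectral_radius H A ^ n"
    \<comment> \<open>Growth bounds are available strictly above the spectral radius, so the
      comparison is made for every larger \<open>R\<close>, with \<open>r\<close> its
      \<open>n\<close>-th root.\<close>
    proof (rule dense_ge)
      fix R assume R: "spectral_radius H A ^ n < R"
      hence R0: "R \<ge> 0" using nn(1) by (meson less_imp_le order_trans zero_le_power)
      define r where "r = root n R"
      have r: "r ^ n = R" "r \<ge> 0" using n R0 by (auto simp: r_def)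
      hence "spectral_radius H A < r" using R by (metis power_less_imp_less_base)
      hence "growth_bound H A r" by (rule growth_bound_above_spectral_radius[OF A ne])
      from growth_bound_sym_tensor_operator[OF A r(2) this]
      show "spectral_radius (sym_tensor_power H n) ?S \<le> R"
        using S.spectral_radius_le[OF S neS] R0 r(1) by simp
    qed
    show "spectral_radius H A ^ n \<le> spectral_radius (sym_tensor_power H n) ?S"
    proof (rule dense_ge)
      fix R assume R: "spectral_radius (sym_tensor_power H n) ?S < R"
      hence R0: "R \<ge> 0" using nn(2) by simp
      define r where "r = root n R"
      have r: "r ^ n = R" "r \<ge> 0" using n R0 by (auto simp: r_def)
      have "growth_bound (sym_tensor_power H n) ?S (r ^ n)"
        using S.growth_bound_above_spectral_radius[OF S neS R] r(1) by simp
      from growth_bound_of_sym_tensor_operator[OF A r(2) n this]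
      have "spectral_radius H A \<le> r" by (rule spectral_radius_le[OF A ne _ r(2)])
      thus "spectral_radius H A ^ n \<le> R" using nn(1) r(1) power_mono by blast
    qed
  qed
qed

end

theorem theorem5p1:
  fixes H :: "'a::ab_group_add hilb" and A B :: "'a \<Rightarrow> 'a"
  assumes "separable_hilbert_space H" and "carrier H \<noteq> {0}"
    and "bounded_operator H A" and "bounded_operator H B"
  shows
    "((1 / sqrt 2) * (SUP x\<in>{x \<in> carrier H. hnorm H x = 1}. hnorm H (A x) * hnorm H (B x))
        \<le> op_norm (sym_tensor_power H 2) (sym_tensor_operator2 H A B)
      \<and> (\<exists>(K :: (nat \<Rightarrow> complex) hilb) C D.
           separable_hilbert_space K \<and> carrier K \<noteq> {0} \<and>
           bounded_operator K C \<and> bounded_operator K D \<and>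
           nonzero_operator K C \<and> nonzero_operator K D \<and>
           (1 / sqrt 2) * (SUP x\<in>{x \<in> carrier K. hnorm K x = 1}. hnorm K (C x) * hnorm K (D x))
             = op_norm (sym_tensor_power K 2) (sym_tensor_operator2 K C D)))
     \<and> (nonzero_operator H A \<and> nonzero_operator H B \<longrightarrow>
          nonzero_operator (sym_tensor_power H 2) (sym_tensor_operator2 H A B))
     \<and> (\<forall>n\<ge>1. spectral_radius (sym_tensor_power H n) (sym_tensor_operator H n (\<lambda>_. A))
                = spectral_radius H A ^ n)"
proof (intro conjI impI allI)
  obtain E where E: "orthonormal_basis H E" and H: "hilbert_space H"
    using assms(1) by (auto simp: separable_hilbert_space_def)
  interpret hilbert_space H by (rule H)
  interpret sq: hilbert_tensor_square H E by unfold_locales (rule E)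
  obtain x where "x \<in> carrier H" "x \<noteq> 0" using assms(2) zero_closed by blast
  \<comment> \<open>A normalised vector shows that the supremum runs over a nonempty set.\<close>
  hence unit: "smult H (1 / hnorm H x) x \<in> {x \<in> carrier H. hnorm H x = 1}" by (simp add: norm_divide)
  have "(SUP x\<in>{x \<in> carrier H. hnorm H x = 1}. hnorm H (A x) * hnorm H (B x))
      \<le> sqrt 2 * op_norm (sym_tensor_power H 2) (sym_tensor_operator2 H A B)"
  proof (rule cSUP_least)
    fix x assume "x \<in> {x \<in> carrier H. hnorm H x = 1}"
    thus "hnorm H (A x) * hnorm H (B x) \<le> sqrt 2 * op_norm (sym_tensor_power H 2) (sym_tensor_operator2 H A B)"
      using sq.product_norm_le_op_norm[OF assms(3,4), of x] by (simp add: field_simps)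
  qed (use unit in blast)
  thus "(1 / sqrt 2) * (SUP x\<in>{x \<in> carrier H. hnorm H x = 1}. hnorm H (A x) * hnorm H (B x))
      \<le> op_norm (sym_tensor_power H 2) (sym_tensor_operator2 H A B)"
    by (simp add: field_simps)
  show "nonzero_operator (sym_tensor_power H 2) (sym_tensor_operator2 H A B)"
    if "nonzero_operator H A \<and> nonzero_operator H B"
    using that sq.sym_tensor_operator2_nonzero[OF assms(3,4)] by blast
  fix n :: nat assume n: "n \<ge> 1"
  interpret tp: hilbert_tensor_power H n E by unfold_locales (rule E)
  show "spectral_radius (sym_tensor_power H n) (sym_tensor_operator H n (\<lambda>_. A)) = spectral_radius H A ^ n"
    by (rule tp.spectral_radius_sym_tensor_operator[OF assms(3,2) n])
qed (rule product_norm_bound_sharp)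

end
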